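(* Let $(M^{2n+s},\phi,\xi_i,\eta_j,g)$ be a metric $f$-manifold whose characteristic vector fields commute, i.e. $[\xi_i,\xi_j]=0$ for all $i,j\in\{1,\dots,s\}$. Then the following conditions are equivalent: (1) $N^{(1)}$ is totally skew-symmetric and $\xi_1,\dots,\xi_s$ are Killing vector fields. (2) $(M^{2n+s},\phi,\xi_i,\eta_j,g)$ admits an almost metric $\phi$-connection with totally skew-symmetric torsion tensor $T$. In particular, this connection $\nabla$ is unique and is determined by the relation $\nabla=\nabla^g+\frac{1}{2}T$, where the torsion 3-form is $$T=\sum_{i=1}^{s}\eta_i\wedge d\eta_i+d^{\phi}F+N^{(1)}-\sum_{i=1}^{s}\eta_i\wedge(\xi_i\lrcorner N^{(1)}).$$
   Context: Manifolds are smooth and connected. A metric $f$-manifold $(M^{2n+s},\phi,\xi_i,\eta_j,g)$ is a $(2n+s)$-dimensional manifold $M$ with a $(1,1)$-tensor field $\phi$ of constant rank $2n$ satisfying $\phi^3+\phi=0$, global vector fields $\xi_1,\dots,\xi_s$ (the characteristic vector fields) and 1-forms $\eta_1,\dots,\eta_s$ with $\ker\phi=\langle\xi_1,\dots,\xi_s\rangle$, $\eta_i(\xi_j)=\delta_{ij}$, $\eta_i\circ\phi=0$, $\phi^2=-\mathrm{Id}+\sum_i\eta_i\otimes\xi_i$, and a Riemannian metric $g$ with $g(\phi X,\phi Y)=g(X,Y)-\sum_i\eta_i(X)\eta_i(Y)$. (For $s=0$ terms involving $\xi_i,\eta_i$ are omitted.) $\nabla^g$ is the Levi-Civita connection of $g$.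 The fundamental 2-form is $F(X,Y)=g(X,\phi Y)$, and $d^{\phi}F(X,Y,Z):=-dF(\phi X,\phi Y,\phi Z)$. Convention: $d\eta(X,Y)=X\eta(Y)-Y\eta(X)-\eta([X,Y])$, and correspondingly (no numerical factors) for 2-forms; $u\wedge v=u\otimes v-v\otimes u$ for 1-forms, and for a 1-form $\eta$ and a 2-form $\omega$, $(\eta\wedge\omega)(X,Y,Z)=\eta(X)\omega(Y,Z)-\eta(Y)\omega(X,Z)+\eta(Z)\omega(X,Y)$. The Nijenhuis tensor is $N^{(1)}=N_\phi+\sum_i d\eta_i\otimes\xi_i$ with $N_\phi(X,Y)=[\phi X,\phi Y]+\phi^2[X,Y]-\phi[X,\phi Y]-\phi[\phi X,Y]$; write $N^{(1)}(X,Y,Z)=g(N^{(1)}(X,Y),Z)$, and call $N^{(1)}$ totally skew-symmetric if this is a 3-form. An affine connection $\nabla$ is an almost metric $\phi$-connection if $\nabla g=0$, $\nabla\phi=0$, $\nabla\xi_i=0$, $\nabla\eta_i=0$ for all $i$. It has (totally) skew-torsion if $T(X,Y,Z):=g(T(X,Y),Z)$ is a 3-form, where $T(X,Y)=\nabla_XY-\nabla_YX-[X,Y]$. The notation $\nabla=\nabla^g+\frac12T$ means $g(\nabla_XY,Z)=g(\nabla^g_XY,Z)+\frac12T(X,Y,Z)$. *)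

theory Defs
  imports "HOL-Analysis.Analysis" "HOL-Library.Function_Algebras"
begin

section \<open>Functions into a real vector space form a real vector space\<close>

instantiation "fun" :: (type, scaleR) scaleR
begin

definition scaleR_fun :: "real \<Rightarrow> ('a \<Rightarrow> 'b) \<Rightarrow> 'a \<Rightarrow> 'b" where
  "scaleR_fun r f = (\<lambda>x. r *\<^sub>R f x)"

instance ..

end

instance "fun" :: (type, real_vector) real_vector
  by standard (auto simp: scaleR_fun_def fun_eq_iff plus_fun_def algebra_simps)


section \<open>Smooth manifolds\<close>

text \<open>
  On an open set the derivative within the set is the ordinary derivative.  On a one-point set,
  which occurs below only as the model space of dimension 0, every function is smooth.
\<close>

primrec C_k_on :: "nat \<Rightarrow> 'e::real_normed_vector set \<Rightarrow> ('e \<Rightarrow> 'b::real_normed_vector) \<Rightarrow> bool" where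
  "C_k_on 0 S f \<longleftrightarrow> continuous_on S f"
| "C_k_on (Suc k) S f \<longleftrightarrow>
     (\<forall>x\<in>S. f differentiable (at x within S)) \<and>
     (\<forall>v. C_k_on k S (\<lambda>x. frechet_derivative f (at x within S) v))"

definition smooth_on :: "'e::real_normed_vector set \<Rightarrow> ('e \<Rightarrow> 'b::real_normed_vector) \<Rightarrow> bool" where
  "smooth_on S f \<longleftrightarrow> (\<forall>k. C_k_on k S f)"

type_synonym ('a, 'e) chart = "'a set \<times> ('a \<Rightarrow> 'e)"

text \<open>
  A manifold is a whole type \<open>'a\<close>; charts take values in \<open>'e\<close>, which represents \<open>\<real>\<^sup>m\<close> when
  \<open>m = DIM('e)\<close>.  As \<open>DIM('e) > 0\<close>, the space \<open>\<real>\<^sup>0\<close> is represented by the subset \<open>{0}\<close>.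
\<close>

definition model_space :: "nat \<Rightarrow> 'e::euclidean_space set" where
  "model_space m = (if m = 0 then {0} else UNIV)"

locale smooth_manifold =
  fixes A :: "('a::{t2_space, second_countable_topology}, 'e::euclidean_space) chart set"
    and m :: nat
  assumes dimension: "m = DIM('e) \<or> m = 0"
    and chart_domain: "\<And>U c. (U, c) \<in> A \<Longrightarrow> open U"
    and chart_range: "\<And>U c. (U, c) \<in> A \<Longrightarrow> openin (top_of_set (model_space m)) (c ` U)"
    and chart_homeomorphism: "\<And>U c. (U, c) \<in> A \<Longrightarrow> homeomorphism U (c ` U) c (inv_into U c)"
    and charts_cover: "(\<Union>(U, c)\<in>A. U) = UNIV"
    and charts_compatible: "\<And>U c V d. (U, c) \<in> A \<Longrightarrow> (V, d) \<in> A \<Longrightarrow>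
          smooth_on (c ` (U \<inter> V)) (\<lambda>x. d (inv_into U c x))"
    and connected: "connected (UNIV :: 'a set)"

definition smooth_functions ::
    "('a, 'e::real_normed_vector) chart set \<Rightarrow> ('a \<Rightarrow> real) set" where
  "smooth_functions A = {f. \<forall>(U, c)\<in>A. smooth_on (c ` U) (\<lambda>x. f (inv_into U c x))}"

text \<open>
  Tangent vectors at \<open>p\<close> are the derivations at \<open>p\<close> of the algebra of smooth functions.  They are
  required to vanish on non-smooth arguments, so that equality of tangent vectors is equality of
  HOL functions.
\<close>

type_synonym 'a tangent = "('a \<Rightarrow> real) \<Rightarrow> real"

definition tangent_space ::
    "('a, 'e::real_normed_vector) chart set \<Rightarrow> 'a \<Rightarrow> 'a tangent set" where
  "tangent_space A p = {v.
     (\<forall>f\<in>smooth_functions A. \<forall>h\<in>smooth_functions A. v (\<lambda>q. f q + h q) = v f + v h) \<and>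
     (\<forall>f\<in>smooth_functions A. \<forall>r. v (\<lambda>q. r * f q) = r * v f) \<and>
     (\<forall>f\<in>smooth_functions A. \<forall>h\<in>smooth_functions A.
        v (\<lambda>q. f q * h q) = v f * h p + f p * v h) \<and>
     (\<forall>f. f \<notin> smooth_functions A \<longrightarrow> v f = 0)}"

type_synonym 'a vfield = "'a \<Rightarrow> 'a tangent"

definition vector_fields ::
    "('a, 'e::real_normed_vector) chart set \<Rightarrow> 'a vfield set" where
  "vector_fields A = {X. (\<forall>p. X p \<in> tangent_space A p) \<and>
     (\<forall>f\<in>smooth_functions A. (\<lambda>p. X p f) \<in> smooth_functions A)}"

definition deriv_along :: "'a vfield \<Rightarrow> ('a \<Rightarrow> real) \<Rightarrow> 'a \<Rightarrow> real" where
  "deriv_along X f = (\<lambda>p. X p f)"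

definition fmult :: "('a \<Rightarrow> real) \<Rightarrow> 'a vfield \<Rightarrow> 'a vfield" where
  "fmult f X = (\<lambda>p. f p *\<^sub>R X p)"

definition lie_bracket :: "'a vfield \<Rightarrow> 'a vfield \<Rightarrow> 'a vfield" where
  "lie_bracket X Y = (\<lambda>p f. X p (deriv_along Y f) - Y p (deriv_along X f))"


section \<open>Tensor fields\<close>

text \<open>
  Tensor fields are families of multilinear maps on the tangent spaces; their values outside the
  tangent spaces are irrelevant.  Such a family is smooth iff it takes smooth vector fields to
  smooth objects.
\<close>

definition linear_on :: "'v::real_vector set \<Rightarrow> ('v \<Rightarrow> 'w::real_vector) \<Rightarrow> bool" where
  "linear_on S f \<longleftrightarrow>
     (\<forall>u\<in>S. \<forall>v\<in>S. f (u + v) = f u + f v) \<and> (\<forall>r. \<forall>v\<in>S. f (r *\<^sub>R v) = r *\<^sub>R f v)"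

type_synonym 'a endo = "'a \<Rightarrow> 'a tangent \<Rightarrow> 'a tangent"
type_synonym 'a covector = "'a \<Rightarrow> 'a tangent \<Rightarrow> real"
type_synonym 'a metric = "'a \<Rightarrow> 'a tangent \<Rightarrow> 'a tangent \<Rightarrow> real"

definition endo_app :: "'a endo \<Rightarrow> 'a vfield \<Rightarrow> 'a vfield" where
  "endo_app \<phi> X = (\<lambda>p. \<phi> p (X p))"

definition form_app :: "'a covector \<Rightarrow> 'a vfield \<Rightarrow> 'a \<Rightarrow> real" where
  "form_app \<eta> X = (\<lambda>p. \<eta> p (X p))"

definition metric_app :: "'a metric \<Rightarrow> 'a vfield \<Rightarrow> 'a vfield \<Rightarrow> 'a \<Rightarrow> real" where
  "metric_app g X Y = (\<lambda>p. g p (X p) (Y p))"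

definition endo_field :: "('a, 'e::real_normed_vector) chart set \<Rightarrow> 'a endo \<Rightarrow> bool" where
  "endo_field A \<phi> \<longleftrightarrow>
     (\<forall>p. linear_on (tangent_space A p) (\<phi> p) \<and> \<phi> p ` tangent_space A p \<subseteq> tangent_space A p) \<and>
     (\<forall>X\<in>vector_fields A. endo_app \<phi> X \<in> vector_fields A)"

definition one_form :: "('a, 'e::real_normed_vector) chart set \<Rightarrow> 'a covector \<Rightarrow> bool" where
  "one_form A \<eta> \<longleftrightarrow>
     (\<forall>p. linear_on (tangent_space A p) (\<eta> p)) \<and>
     (\<forall>X\<in>vector_fields A. form_app \<eta> X \<in> smooth_functions A)"

definition riemannian_metric :: "('a, 'e::real_normed_vector) chart set \<Rightarrow> 'a metric \<Rightarrow> bool" where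
  "riemannian_metric A g \<longleftrightarrow>
     (\<forall>p. (\<forall>u\<in>tangent_space A p. linear_on (tangent_space A p) (g p u)) \<and>
          (\<forall>u\<in>tangent_space A p. \<forall>v\<in>tangent_space A p. g p u v = g p v u) \<and>
          (\<forall>u\<in>tangent_space A p. u \<noteq> 0 \<longrightarrow> g p u u > 0)) \<and>
     (\<forall>X\<in>vector_fields A. \<forall>Y\<in>vector_fields A. metric_app g X Y \<in> smooth_functions A)"


section \<open>Differential forms\<close>

text \<open>
  Forms of degree 2 and 3 are treated as multilinear maps over the ring of smooth functions,
  defined on vector fields.
\<close>

type_synonym 'a form1 = "'a vfield \<Rightarrow> 'a \<Rightarrow> real"
type_synonym 'a form2 = "'a vfield \<Rightarrow> 'a vfield \<Rightarrow> 'a \<Rightarrow> real"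
type_synonym 'a form3 = "'a vfield \<Rightarrow> 'a vfield \<Rightarrow> 'a vfield \<Rightarrow> 'a \<Rightarrow> real"

text \<open>Linearity in the second and third argument follows from linearity in the first.\<close>

definition three_form :: "('a, 'e::real_normed_vector) chart set \<Rightarrow> 'a form3 \<Rightarrow> bool" where
  "three_form A \<omega> \<longleftrightarrow>
     (\<forall>X\<in>vector_fields A. \<forall>Y\<in>vector_fields A. \<forall>Z\<in>vector_fields A.
        \<omega> X Y Z \<in> smooth_functions A \<and>
        (\<forall>W\<in>vector_fields A. \<omega> (X + W) Y Z = \<omega> X Y Z + \<omega> W Y Z) \<and>
        (\<forall>f\<in>smooth_functions A. \<omega> (fmult f X) Y Z = f * \<omega> X Y Z) \<and>
        \<omega> Y X Z = - \<omega> X Y Z \<and> \<omega> X Z Y = - \<omega> X Y Z)"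

definition ext_deriv1 :: "'a form1 \<Rightarrow> 'a form2" where
  "ext_deriv1 \<eta> X Y =
     deriv_along X (\<eta> Y) - deriv_along Y (\<eta> X) - \<eta> (lie_bracket X Y)"

definition ext_deriv2 :: "'a form2 \<Rightarrow> 'a form3" where
  "ext_deriv2 \<omega> X Y Z =
     deriv_along X (\<omega> Y Z) - deriv_along Y (\<omega> X Z) + deriv_along Z (\<omega> X Y)
     - \<omega> (lie_bracket X Y) Z + \<omega> (lie_bracket X Z) Y - \<omega> (lie_bracket Y Z) X"

definition wedge12 :: "'a form1 \<Rightarrow> 'a form2 \<Rightarrow> 'a form3" where
  "wedge12 \<eta> \<omega> X Y Z = \<eta> X * \<omega> Y Z - \<eta> Y * \<omega> X Z + \<eta> Z * \<omega> X Y"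

definition interior3 :: "'a vfield \<Rightarrow> 'a form3 \<Rightarrow> 'a form2" where
  "interior3 X \<omega> Y Z = \<omega> X Y Z"


section \<open>Affine connections\<close>

type_synonym 'a connection = "'a vfield \<Rightarrow> 'a vfield \<Rightarrow> 'a vfield"

definition affine_connection ::
    "('a, 'e::real_normed_vector) chart set \<Rightarrow> 'a connection \<Rightarrow> bool" where
  "affine_connection A D \<longleftrightarrow>
     (\<forall>X\<in>vector_fields A. \<forall>Y\<in>vector_fields A.
        D X Y \<in> vector_fields A \<and>
        (\<forall>Z\<in>vector_fields A. D (X + Z) Y = D X Y + D Z Y \<and> D X (Y + Z) = D X Y + D X Z) \<and>
        (\<forall>f\<in>smooth_functions A.
           D (fmult f X) Y = fmult f (D X Y) \<and>
           D X (fmult f Y) = fmult (deriv_along X f) Y + fmult f (D X Y)))"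

definition torsion :: "'a connection \<Rightarrow> 'a vfield \<Rightarrow> 'a vfield \<Rightarrow> 'a vfield" where
  "torsion D X Y = D X Y - D Y X - lie_bracket X Y"

definition torsion3 :: "'a metric \<Rightarrow> 'a connection \<Rightarrow> 'a form3" where
  "torsion3 g D X Y Z = metric_app g (torsion D X Y) Z"

definition cov_deriv_metric ::
    "'a connection \<Rightarrow> 'a metric \<Rightarrow> 'a form3" where
  "cov_deriv_metric D g X Y Z =
     deriv_along X (metric_app g Y Z) - metric_app g (D X Y) Z - metric_app g Y (D X Z)"

definition cov_deriv_endo ::
    "'a connection \<Rightarrow> 'a endo \<Rightarrow> 'a vfield \<Rightarrow> 'a vfield \<Rightarrow> 'a vfield" where
  "cov_deriv_endo D \<phi> X Y = D X (endo_app \<phi> Y) - endo_app \<phi> (D X Y)"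

definition cov_deriv_form ::
    "'a connection \<Rightarrow> 'a covector \<Rightarrow> 'a form2" where
  "cov_deriv_form D \<eta> X Y = deriv_along X (form_app \<eta> Y) - form_app \<eta> (D X Y)"

definition metric_connection ::
    "('a, 'e::real_normed_vector) chart set \<Rightarrow> 'a metric \<Rightarrow> 'a connection \<Rightarrow> bool" where
  "metric_connection A g D \<longleftrightarrow> affine_connection A D \<and>
     (\<forall>X\<in>vector_fields A. \<forall>Y\<in>vector_fields A. \<forall>Z\<in>vector_fields A.
        cov_deriv_metric D g X Y Z = 0)"

text \<open>
  The choice is harmless: the connection exists, and its values on vector fields are unique
  (fundamental theorem of Riemannian geometry).
\<close>

definition levi_civita ::
    "('a, 'e::real_normed_vector) chart set \<Rightarrow> 'a metric \<Rightarrow> 'a connection" where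
  "levi_civita A g = (SOME D. metric_connection A g D \<and>
     (\<forall>X\<in>vector_fields A. \<forall>Y\<in>vector_fields A. torsion D X Y = 0))"

text \<open>Vanishing of the Lie derivative of \<open>g\<close> along \<open>V\<close>.\<close>

definition killing ::
    "('a, 'e::real_normed_vector) chart set \<Rightarrow> 'a metric \<Rightarrow> 'a vfield \<Rightarrow> bool" where
  "killing A g V \<longleftrightarrow> V \<in> vector_fields A \<and>
     (\<forall>X\<in>vector_fields A. \<forall>Y\<in>vector_fields A.
        deriv_along V (metric_app g X Y)
        - metric_app g (lie_bracket V X) Y - metric_app g X (lie_bracket V Y) = 0)"


section \<open>Metric f-manifolds\<close>

text \<open>The families \<open>\<xi>\<close> and \<open>\<eta>\<close> are indexed by \<open>{1..s}\<close>; other indices are irrelevant.\<close>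

locale metric_f_manifold = smooth_manifold A "2 * n + s"
  for A :: "('a::{t2_space, second_countable_topology}, 'e::euclidean_space) chart set"
    and n s :: nat +
  fixes \<phi> :: "'a endo"
    and \<xi> :: "nat \<Rightarrow> 'a vfield"
    and \<eta> :: "nat \<Rightarrow> 'a covector"
    and g :: "'a metric"
  assumes phi_tensor: "endo_field A \<phi>"
    and xi_field: "\<And>i. i \<in> {1..s} \<Longrightarrow> \<xi> i \<in> vector_fields A"
    and eta_form: "\<And>i. i \<in> {1..s} \<Longrightarrow> one_form A (\<eta> i)"
    and metric: "riemannian_metric A g"
    and phi_rank: "\<And>p. dim (\<phi> p ` tangent_space A p) = 2 * n"
    and phi_cubed: "\<And>p v. v \<in> tangent_space A p \<Longrightarrow> \<phi> p (\<phi> p (\<phi> p v)) + \<phi> p v = 0"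
    and phi_kernel: "\<And>p. {v \<in> tangent_space A p. \<phi> p v = 0} = span ((\<lambda>i. \<xi> i p) ` {1..s})"
    and eta_xi: "\<And>p i j. i \<in> {1..s} \<Longrightarrow> j \<in> {1..s} \<Longrightarrow> \<eta> i p (\<xi> j p) = (if i = j then 1 else 0)"
    and eta_phi: "\<And>p i v. i \<in> {1..s} \<Longrightarrow> v \<in> tangent_space A p \<Longrightarrow> \<eta> i p (\<phi> p v) = 0"
    and phi_squared: "\<And>p v. v \<in> tangent_space A p \<Longrightarrow>
          \<phi> p (\<phi> p v) = - v + (\<Sum>i\<in>{1..s}. \<eta> i p v *\<^sub>R \<xi> i p)"
    and metric_compatible: "\<And>p u v. u \<in> tangent_space A p \<Longrightarrow> v \<in> tangent_space A p \<Longrightarrow>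
          g p (\<phi> p u) (\<phi> p v) = g p u v - (\<Sum>i\<in>{1..s}. \<eta> i p u * \<eta> i p v)"

definition fundamental_form :: "'a metric \<Rightarrow> 'a endo \<Rightarrow> 'a form2" where
  "fundamental_form g \<phi> X Y = metric_app g X (endo_app \<phi> Y)"

definition dphi_F :: "'a metric \<Rightarrow> 'a endo \<Rightarrow> 'a form3" where
  "dphi_F g \<phi> X Y Z =
     - ext_deriv2 (fundamental_form g \<phi>) (endo_app \<phi> X) (endo_app \<phi> Y) (endo_app \<phi> Z)"

definition nijenhuis_phi :: "'a endo \<Rightarrow> 'a vfield \<Rightarrow> 'a vfield \<Rightarrow> 'a vfield" where
  "nijenhuis_phi \<phi> X Y =
     lie_bracket (endo_app \<phi> X) (endo_app \<phi> Y)
     + endo_app \<phi> (endo_app \<phi> (lie_bracket X Y))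
     - endo_app \<phi> (lie_bracket X (endo_app \<phi> Y))
     - endo_app \<phi> (lie_bracket (endo_app \<phi> X) Y)"

definition N1_vector ::
    "nat \<Rightarrow> 'a endo \<Rightarrow> (nat \<Rightarrow> 'a vfield) \<Rightarrow> (nat \<Rightarrow> 'a covector) \<Rightarrow>
     'a vfield \<Rightarrow> 'a vfield \<Rightarrow> 'a vfield" where
  "N1_vector s \<phi> \<xi> \<eta> X Y =
     nijenhuis_phi \<phi> X Y + (\<Sum>i\<in>{1..s}. fmult (ext_deriv1 (form_app (\<eta> i)) X Y) (\<xi> i))"

definition N1 ::
    "nat \<Rightarrow> 'a endo \<Rightarrow> (nat \<Rightarrow> 'a vfield) \<Rightarrow> (nat \<Rightarrow> 'a covector) \<Rightarrow> 'a metric \<Rightarrow> 'a form3" where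
  "N1 s \<phi> \<xi> \<eta> g X Y Z = metric_app g (N1_vector s \<phi> \<xi> \<eta> X Y) Z"

definition almost_metric_phi_connection ::
    "('a, 'e::real_normed_vector) chart set \<Rightarrow> nat \<Rightarrow> 'a endo \<Rightarrow> (nat \<Rightarrow> 'a vfield) \<Rightarrow>
     (nat \<Rightarrow> 'a covector) \<Rightarrow> 'a metric \<Rightarrow> 'a connection \<Rightarrow> bool" where
  "almost_metric_phi_connection A s \<phi> \<xi> \<eta> g D \<longleftrightarrow>
     metric_connection A g D \<and>
     (\<forall>X\<in>vector_fields A. \<forall>Y\<in>vector_fields A. cov_deriv_endo D \<phi> X Y = 0) \<and>
     (\<forall>i\<in>{1..s}. \<forall>X\<in>vector_fields A. D X (\<xi> i) = 0) \<and>
     (\<forall>i\<in>{1..s}. \<forall>X\<in>vector_fields A. \<forall>Y\<in>vector_fields A. cov_deriv_form D (\<eta> i) X Y = 0)"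

definition skew_torsion ::
    "('a, 'e::real_normed_vector) chart set \<Rightarrow> 'a metric \<Rightarrow> 'a connection \<Rightarrow> bool" where
  "skew_torsion A g D \<longleftrightarrow> three_form A (torsion3 g D)"

definition torsion_formula ::
    "nat \<Rightarrow> 'a endo \<Rightarrow> (nat \<Rightarrow> 'a vfield) \<Rightarrow> (nat \<Rightarrow> 'a covector) \<Rightarrow> 'a metric \<Rightarrow> 'a form3" where
  "torsion_formula s \<phi> \<xi> \<eta> g =
     (\<Sum>i\<in>{1..s}. wedge12 (form_app (\<eta> i)) (ext_deriv1 (form_app (\<eta> i))))
     + dphi_F g \<phi> + N1 s \<phi> \<xi> \<eta> g
     - (\<Sum>i\<in>{1..s}. wedge12 (form_app (\<eta> i)) (interior3 (\<xi> i) (N1 s \<phi> \<xi> \<eta> g)))"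

end

theory Submission
  imports Defs
begin

text \<open>
  Both directions rest on one computation.  Let \<open>D\<close> be a metric connection with skew torsion \<open>T\<close>
  for which the characteristic fields are parallel, and put \<open>P(X,Y,Z) = g((D\<^sub>X \<phi>)Y, Z)\<close>.
  Replacing Lie brackets by \<open>D\<^sub>X Y - D\<^sub>Y X - T(X,Y)\<close> expresses \<open>d\<eta>\<^sub>i\<close>, \<open>dF\<close> and \<open>N\<close> (short for
  the Nijenhuis tensor of the theorem) through \<open>T\<close> and \<open>P\<close> (lemmas \<open>d_eta_torsion\<close>,
  \<open>dF_torsion\<close>, \<open>N_torsion\<close>), and the torsion formula becomes \<open>T\<close> plus terms that are linear in
  \<open>P\<close> (\<open>torsion_formula_defect\<close>).

  If \<open>D\<close> is an almost metric \<open>\<phi>\<close>-connection, then \<open>P = 0\<close>.  So \<open>T\<close> is given by the formula, \<open>N\<close>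
  is visibly alternating, and the Lie derivative of \<open>g\<close> along \<open>\<xi>\<^sub>i\<close>, being the symmetric part of
  \<open>T(\<xi>\<^sub>i,_,_)\<close>, vanishes.  A metric connection is determined by its skew torsion through the
  Koszul formula, which also shows that it is the Levi-Civita connection plus half the torsion.

  Conversely, let \<open>N\<close> be alternating and the \<open>\<xi>\<^sub>i\<close> Killing fields.  Then the torsion formula is a
  3-form, and there is a metric connection \<open>D\<close> with this torsion.  As the \<open>\<xi>\<^sub>i\<close> commute, the
  formula reduces to \<open>d\<eta>\<^sub>i\<close> when \<open>\<xi>\<^sub>i\<close> is inserted, and the Koszul formula gives \<open>D \<xi>\<^sub>i = 0\<close>.
  Now the computation above applies: the terms in \<open>P\<close> have to cancel, and together with the
  skewness of \<open>N\<close> this forces \<open>P = 0\<close> (\<open>phi_parallel\<close>).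

  The existence of metric connections with prescribed torsion needs the musical isomorphism
  (\<open>musical_isomorphism\<close>): every functional on vector fields that is linear over the smooth
  functions has the form \<open>g(W,_)\<close> with a smooth field \<open>W\<close>.  It follows from local orthogonal
  frames, which come from coordinate fields by Gram-Schmidt.  That coordinate vectors span the
  tangent space, that is, the space of derivations, is a consequence of Hadamard's lemma; bump
  functions turn local objects into global ones.
\<close>

section \<open>Calculus of \<open>C\<^sup>k\<close> functions\<close>

lemma C_k_on_cong:
  assumes "\<And>x. x \<in> S \<Longrightarrow> f x = h x" and "C_k_on k S f"
  shows "C_k_on k S h"
  using assms
proof (induction k arbitrary: f h)
  case 0
  then show ?case
    by (metis C_k_on.simps(1) continuous_on_cong)
next
  case (Suc k)
  have der: "(f has_derivative D) (at x within S) \<longleftrightarrow> (h has_derivative D) (at x within S)"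
    if "x \<in> S" for x D
    using Suc.prems(1) that by (metis has_derivative_transform)
  have "h differentiable (at x within S)" if "x \<in> S" for x
    using Suc.prems(2) der that by (auto simp: differentiable_def)
  moreover have "frechet_derivative f (at x within S) = frechet_derivative h (at x within S)"
    if "x \<in> S" for x
    using der[OF that] by (simp add: frechet_derivative_def)
  moreover have "C_k_on k S (\<lambda>x. frechet_derivative h (at x within S) v)" for v
    by (rule Suc.IH[of "\<lambda>x. frechet_derivative f (at x within S) v"])
      (use calculation Suc.prems(2) in auto)
  ultimately show ?case by simp
qed

text \<open>
  On an open set any family of derivatives will do, and the derivative within the set can be
  replaced by the ordinary one.  After this lemma and the next two the recursive definition of
  \<open>C_k_on\<close> need not be unfolded in its second clause.
\<close>

lemma C_k_on_SucI:
  assumes "open S" and der: "\<And>x. x \<in> S \<Longrightarrow> (f has_derivative f' x) (at x)"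
    and "\<And>v. C_k_on k S (\<lambda>x. f' x v)"
  shows "C_k_on (Suc k) S f"
proof -
  have "frechet_derivative f (at x within S) = f' x" if "x \<in> S" for x
    using frechet_derivative_at[OF der[OF that]] at_within_open[OF that assms(1)] by simp
  moreover have "f differentiable (at x within S)" if "x \<in> S" for x
    using der[OF that] differentiable_at_withinI differentiable_def by blast
  ultimately show ?thesis
    using assms(3) C_k_on_cong[of S "\<lambda>x. f' x v" "\<lambda>x. frechet_derivative f (at x within S) v" for v]
    by simp
qed

lemma C_k_on_SucD:
  assumes "open S" "C_k_on (Suc k) S f" "x \<in> S"
  shows "(f has_derivative frechet_derivative f (at x)) (at x)"
proof -
  have "f differentiable (at x)"
    using assms(2,3) by (simp add: at_within_open[OF assms(3,1), symmetric])
  then show ?thesis by (rule frechet_derivative_works[THEN iffD1])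
qed

lemma C_k_on_deriv:
  assumes "open S" "C_k_on (Suc k) S f"
  shows "C_k_on k S (\<lambda>x. frechet_derivative f (at x) v)"
proof (rule C_k_on_cong)
  show "C_k_on k S (\<lambda>x. frechet_derivative f (at x within S) v)"
    using assms(2) by simp
  show "frechet_derivative f (at x within S) v = frechet_derivative f (at x) v" if "x \<in> S" for x
    by (simp only: at_within_open[OF that assms(1)])
qed

lemma C_k_on_mono:
  assumes "open S" "open T" "T \<subseteq> S" "C_k_on k S f"
  shows "C_k_on k T f"
  using assms(4)
proof (induction k arbitrary: f)
  case 0
  then show ?case using assms(3) continuous_on_subset by auto
next
  case (Suc k)
  show ?case
    using assms(3) by (intro C_k_on_SucI[OF assms(2) C_k_on_SucD[OF assms(1) Suc.prems]]
        Suc.IH C_k_on_deriv[OF assms(1) Suc.prems]) auto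
qed

lemma C_k_on_local:
  assumes "open S" "\<And>x. x \<in> S \<Longrightarrow> \<exists>T. open T \<and> x \<in> T \<and> C_k_on k T f"
  shows "C_k_on k S f"
  using assms(2)
proof (induction k arbitrary: f)
  case 0
  have "continuous (at x) f" if x: "x \<in> S" for x
  proof -
    obtain T where "open T" "x \<in> T" "continuous_on T f"
      using 0[OF x] by auto
    then show ?thesis by (simp add: continuous_on_eq_continuous_at)
  qed
  then show ?case by (simp add: continuous_at_imp_continuous_on)
next
  case (Suc k)
  show ?case
  proof (rule C_k_on_SucI[OF assms(1)])
    show "(f has_derivative frechet_derivative f (at x)) (at x)" if "x \<in> S" for x
      using Suc.prems[OF that] C_k_on_SucD by blast
    show "C_k_on k S (\<lambda>x. frechet_derivative f (at x) v)" for v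
    proof (rule Suc.IH)
      fix x assume "x \<in> S"
      then obtain T where "open T" "x \<in> T" "C_k_on (Suc k) T f"
        using Suc.prems by blast
      then show "\<exists>T. open T \<and> x \<in> T \<and> C_k_on k T (\<lambda>x. frechet_derivative f (at x) v)"
        using C_k_on_deriv[of T k f] by blast
    qed
  qed
qed

lemma C_k_on_continuous:
  assumes "open S" "C_k_on k S f"
  shows "continuous_on S f"
proof (cases k)
  case (Suc j)
  then show ?thesis
    using C_k_on_SucD[OF assms(1) assms(2)[unfolded Suc]]
    by (intro continuous_at_imp_continuous_on ballI has_derivative_continuous)
qed (use assms in auto)

lemma C_k_on_Suc_imp:
  assumes "open S" "C_k_on (Suc k) S f"
  shows "C_k_on k S f"
  using assms(2)
proof (induction k arbitrary: f)
  case 0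
  then show ?case using C_k_on_continuous[OF assms(1) 0] by simp
next
  case (Suc k)
  show ?case
    by (intro C_k_on_SucI[OF assms(1) C_k_on_SucD[OF assms(1) Suc.prems]]
        Suc.IH C_k_on_deriv[OF assms(1) Suc.prems])
qed

lemma C_k_on_const: "open S \<Longrightarrow> C_k_on k S (\<lambda>_. a)"
proof (induction k arbitrary: a)
  case (Suc k)
  show ?case
    by (rule C_k_on_SucI[OF Suc.prems, where f' = "\<lambda>_ _. 0"]) (use Suc in auto)
qed auto

lemma C_k_on_bounded_linear:
  assumes "bounded_linear L" "open S" "C_k_on k S f"
  shows "C_k_on k S (\<lambda>x. L (f x))"
  using assms(3)
proof (induction k arbitrary: f)
  case 0
  then show ?case using assms(1) bounded_linear.continuous_on by auto
next
  case (Suc k)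
  show ?case
    by (rule C_k_on_SucI[OF assms(2) bounded_linear.has_derivative[OF assms(1)
          C_k_on_SucD[OF assms(2) Suc.prems]]])
      (auto intro: Suc.IH C_k_on_deriv[OF assms(2) Suc.prems])
qed

lemma C_k_on_linear_map:
  assumes "bounded_linear L" "open S"
  shows "C_k_on k S L"
proof (cases k)
  case 0
  then show ?thesis using assms(1) linear_continuous_on by auto
next
  case (Suc j)
  show ?thesis
    unfolding Suc
    by (rule C_k_on_SucI[OF assms(2), where f' = "\<lambda>_. L"])
      (auto intro: C_k_on_const assms bounded_linear_imp_has_derivative)
qed

lemma C_k_on_add:
  assumes "open S" "C_k_on k S f" "C_k_on k S h"
  shows "C_k_on k S (\<lambda>x. f x + h x)"
  using assms(2,3)
proof (induction k arbitrary: f h)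
  case 0
  then show ?case by (auto intro: continuous_on_add)
next
  case (Suc k)
  show ?case
    by (rule C_k_on_SucI[OF assms(1) has_derivative_add[OF
          C_k_on_SucD[OF assms(1) Suc.prems(1)] C_k_on_SucD[OF assms(1) Suc.prems(2)]]])
      (assumption+, rule Suc.IH[OF C_k_on_deriv[OF assms(1) Suc.prems(1)]
          C_k_on_deriv[OF assms(1) Suc.prems(2)]])
qed

lemma C_k_on_sum:
  assumes "open S" "\<And>i. i \<in> I \<Longrightarrow> C_k_on k S (f i)"
  shows "C_k_on k S (\<lambda>x. \<Sum>i\<in>I. f i x)"
  using assms(2)
proof (induction I rule: infinite_finite_induct)
  case (insert i I)
  then show ?case using C_k_on_add[OF assms(1), of k "f i"] by simp
qed (simp_all add: C_k_on_const[OF assms(1)])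

lemma C_k_on_mult:
  fixes f h :: "'e::real_normed_vector \<Rightarrow> real"
  assumes "open S" "C_k_on k S f" "C_k_on k S h"
  shows "C_k_on k S (\<lambda>x. f x * h x)"
  using assms(2,3)
proof (induction k arbitrary: f h)
  case 0
  then show ?case by (auto intro: continuous_on_mult)
next
  case (Suc k)
  show ?case
    by (rule C_k_on_SucI[OF assms(1) has_derivative_mult[OF
          C_k_on_SucD[OF assms(1) Suc.prems(1)] C_k_on_SucD[OF assms(1) Suc.prems(2)]]])
      (assumption+, rule C_k_on_add[OF assms(1)
          Suc.IH[OF C_k_on_Suc_imp[OF assms(1) Suc.prems(1)] C_k_on_deriv[OF assms(1) Suc.prems(2)]]
          Suc.IH[OF C_k_on_deriv[OF assms(1) Suc.prems(1)] C_k_on_Suc_imp[OF assms(1) Suc.prems(2)]]])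
qed

lemma C_k_on_inverse:
  fixes f :: "'e::real_normed_vector \<Rightarrow> real"
  assumes "open S" "C_k_on k S f" and nz: "\<And>x. x \<in> S \<Longrightarrow> f x \<noteq> 0"
  shows "C_k_on k S (\<lambda>x. inverse (f x))"
  using assms(2)
proof (induction k)
  case 0
  then show ?case using nz by (auto intro: continuous_on_inverse)
next
  case (Suc k)
  have inv: "C_k_on k S (\<lambda>x. inverse (f x))"
    using Suc C_k_on_Suc_imp[OF assms(1)] by blast
  show ?case
  proof (rule C_k_on_SucI[OF assms(1) Deriv.has_derivative_inverse[OF nz
          C_k_on_SucD[OF assms(1) Suc.prems]]])
    fix v
    have "C_k_on k S (\<lambda>x. (- 1) * (inverse (f x) * (frechet_derivative f (at x) v * inverse (f x))))"
      by (intro C_k_on_mult C_k_on_const inv C_k_on_deriv[OF _ Suc.prems] assms(1))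
    then show "C_k_on k S (\<lambda>x. - (inverse (f x) * frechet_derivative f (at x) v * inverse (f x)))"
      by (simp add: mult.assoc)
  qed auto
qed

text \<open>
  Expanding the chain rule over a basis turns the derivative of a composition into a sum of
  products of compositions of lower order, so that the order can be the induction variable.
\<close>

lemma C_k_on_compose:
  fixes h :: "'d::real_normed_vector \<Rightarrow> 'e::euclidean_space" and f :: "'e \<Rightarrow> real"
  assumes "open S" "open T" "h ` S \<subseteq> T" "C_k_on k S h" "C_k_on k T f"
  shows "C_k_on k S (\<lambda>x. f (h x))"
  using assms(4,5)
proof (induction k arbitrary: f)
  case 0
  then show ?case
    using assms(3) by (auto intro: continuous_on_compose2)
next
  case (Suc k)
  show ?case
  proof (rule C_k_on_SucI[OF assms(1)])
    fix x assume x: "x \<in> S"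
    have dh: "(h has_derivative frechet_derivative h (at x)) (at x)"
      by (rule C_k_on_SucD[OF assms(1) Suc.prems(1) x])
    have df: "(f has_derivative frechet_derivative f (at (h x))) (at (h x))"
      by (rule C_k_on_SucD[OF assms(2) Suc.prems(2)]) (use x assms(3) in auto)
    have lin: "linear (frechet_derivative f (at (h x)))"
      using df has_derivative_linear by blast
    have "frechet_derivative f (at (h x)) w
        = (\<Sum>b\<in>Basis. (w \<bullet> b) * frechet_derivative f (at (h x)) b)" for w
    proof -
      have "frechet_derivative f (at (h x)) (\<Sum>b\<in>Basis. (w \<bullet> b) *\<^sub>R b)
          = (\<Sum>b\<in>Basis. (w \<bullet> b) * frechet_derivative f (at (h x)) b)"
        by (simp add: linear_sum[OF lin] linear_cmul[OF lin])
      then show ?thesis by (simp add: euclidean_representation)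
    qed
    then have "frechet_derivative f (at (h x)) \<circ> frechet_derivative h (at x)
        = (\<lambda>v. \<Sum>b\<in>Basis. (frechet_derivative h (at x) v \<bullet> b) *
             frechet_derivative f (at (h x)) b)"
      unfolding comp_def by (intro ext) blast
    then show "((\<lambda>x. f (h x)) has_derivative
        (\<lambda>v. \<Sum>b\<in>Basis. (frechet_derivative h (at x) v \<bullet> b) *
             frechet_derivative f (at (h x)) b)) (at x)"
      using diff_chain_at[OF dh df] by (simp add: comp_def)
  next
    fix v
    show "C_k_on k S (\<lambda>x. \<Sum>b\<in>Basis. (frechet_derivative h (at x) v \<bullet> b) *
             frechet_derivative f (at (h x)) b)"
      by (intro C_k_on_sum C_k_on_mult C_k_on_bounded_linear[OF bounded_linear_inner_left]
          C_k_on_deriv[OF assms(1) Suc.prems(1)] Suc.IH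
          C_k_on_deriv[OF assms(2) Suc.prems(2)] C_k_on_Suc_imp[OF assms(1) Suc.prems(1)] assms(1))
  qed
qed

section \<open>Bump functions\<close>

text \<open>
  The function \<open>exp (- 1 / t)\<close>, extended by 0, and its multiples by powers of \<open>1 / t\<close>.  The
  derivative of such a multiple is a linear combination of two others, so that smoothness of
  all of them can be proved by a simultaneous induction.
\<close>

definition flat_exp :: "nat \<Rightarrow> real \<Rightarrow> real" where
  "flat_exp j t = (if t \<le> 0 then 0 else inverse t ^ j * exp (- inverse t))"

lemma flat_exp_tendsto: "((\<lambda>t. flat_exp j t) \<longlongrightarrow> 0) (at 0)"
proof -
  have "((\<lambda>u. u ^ j / exp u) \<longlongrightarrow> (0::real)) at_top"
    by (rule tendsto_power_div_exp_0)
  then have "((\<lambda>t::real. inverse t ^ j / exp (inverse t)) \<longlongrightarrow> 0) (at_right 0)"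
    by (rule filterlim_compose) (rule filterlim_inverse_at_top_right)
  then have "(flat_exp j \<longlongrightarrow> 0) (at_right 0)"
    by (rule Lim_transform_eventually)
      (auto simp: eventually_at_filter flat_exp_def exp_minus field_simps)
  moreover have "(flat_exp j \<longlongrightarrow> 0) (at_left 0)"
    by (rule Lim_transform_eventually[OF tendsto_const])
      (auto simp: eventually_at_filter flat_exp_def)
  ultimately show ?thesis
    using filterlim_split_at_real by blast
qed

lemma flat_exp_has_derivative:
  "(flat_exp j has_real_derivative flat_exp (j + 2) t - real j * flat_exp (j + 1) t) (at t)"
proof -
  consider "t < 0" | "t > 0" | "t = 0" by linarith
  then show ?thesis
  proof cases
    case 1
    have "((\<lambda>_. 0) has_real_derivative flat_exp (j + 2) t - real j * flat_exp (j + 1) t) (at t)"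
      using 1 by (auto simp: flat_exp_def)
    moreover have "\<forall>\<^sub>F y in nhds t. flat_exp j y = 0"
      by (rule eventually_mono[OF eventually_nhds_in_open[of "{..<0}"]])
        (use 1 in \<open>auto simp: flat_exp_def\<close>)
    ultimately show ?thesis
      by (subst DERIV_cong_ev[OF refl _ refl, where g = "\<lambda>_. 0"]) auto
  next
    case 2
    have "((\<lambda>t. inverse t ^ j) has_real_derivative - (real j * inverse t ^ (j + 1))) (at t)"
      using DERIV_power[OF DERIV_inverse[of t], of j] 2 by (cases j) (auto simp: mult_ac)
    moreover have "((\<lambda>t. exp (- inverse t)) has_real_derivative exp (- inverse t) * inverse t ^ 2) (at t)"
      using 2 by (auto intro!: derivative_eq_intros simp: power2_eq_square)
    ultimately have "((\<lambda>t. inverse t ^ j * exp (- inverse t)) has_real_derivative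
        - (real j * inverse t ^ (j + 1)) * exp (- inverse t)
        + exp (- inverse t) * inverse t ^ 2 * inverse t ^ j) (at t)"
      by (rule DERIV_mult)
    then have "((\<lambda>t. inverse t ^ j * exp (- inverse t)) has_real_derivative
        flat_exp (j + 2) t - real j * flat_exp (j + 1) t) (at t)"
      using 2 by (simp add: flat_exp_def power_add power2_eq_square algebra_simps)
    moreover have "\<forall>\<^sub>F y in nhds t. flat_exp j y = inverse y ^ j * exp (- inverse y)"
      by (rule eventually_mono[OF eventually_nhds_in_open[of "{0<..}"]])
        (use 2 in \<open>auto simp: flat_exp_def\<close>)
    ultimately show ?thesis
      by (subst DERIV_cong_ev[OF refl _ refl,
            where g = "\<lambda>t. inverse t ^ j * exp (- inverse t)"]) auto
  next
    case 3
    have "(\<lambda>t. (flat_exp j t - flat_exp j 0) / (t - 0)) = flat_exp (j + 1)"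
      by (auto simp: flat_exp_def field_simps fun_eq_iff)
    then show ?thesis
      using flat_exp_tendsto[of "j + 1"] 3
      by (simp add: has_field_derivative_iff flat_exp_def[of _ 0])
  qed
qed

lemma C_k_on_flat_exp: "C_k_on k UNIV (flat_exp j)"
proof (induction k arbitrary: j)
  case 0
  have "isCont (flat_exp j) t" for t
    using flat_exp_has_derivative DERIV_isCont by blast
  then show ?case by (simp add: continuous_at_imp_continuous_on)
next
  case (Suc k)
  show ?case
  proof (rule C_k_on_SucI[where f' = "\<lambda>t v. (flat_exp (j + 2) t + (- real j) * flat_exp (j + 1) t) * v"])
    show "(flat_exp j has_derivative
        (*) (flat_exp (j + 2) t + (- real j) * flat_exp (j + 1) t)) (at t)" for t
      using flat_exp_has_derivative[of j t] by (simp add: has_field_derivative_def)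
    show "C_k_on k UNIV (\<lambda>t. (flat_exp (j + 2) t + (- real j) * flat_exp (j + 1) t) * v)" for v
      by (intro C_k_on_mult C_k_on_add C_k_on_const Suc.IH) auto
  qed auto
qed

lemma bump_function:
  fixes x0 :: "'e::euclidean_space"
  assumes "r > 0"
  obtains \<beta> :: "'e \<Rightarrow> real" where "smooth_on UNIV \<beta>" "\<beta> x0 \<noteq> 0" "\<And>x. x \<notin> cball x0 r \<Longrightarrow> \<beta> x = 0"
proof
  define \<beta> where "\<beta> x = flat_exp 0 (r\<^sup>2 + (- 1) * (\<Sum>b\<in>Basis. ((x + - x0) \<bullet> b) * ((x + - x0) \<bullet> b)))"
    for x :: 'e
  have poly: "C_k_on k UNIV
      (\<lambda>x. r\<^sup>2 + (- 1) * (\<Sum>b\<in>Basis. ((x + - x0) \<bullet> b) * ((x + - x0) \<bullet> b)))" for k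
    by (intro C_k_on_add C_k_on_mult C_k_on_sum C_k_on_const
        C_k_on_bounded_linear[OF bounded_linear_inner_left] C_k_on_linear_map[OF bounded_linear_ident])
      auto
  show "smooth_on UNIV \<beta>"
    unfolding smooth_on_def \<beta>_def
    by (intro allI C_k_on_compose[OF _ _ _ poly C_k_on_flat_exp]) auto
  have norm: "(\<Sum>b\<in>Basis. ((x + - x0) \<bullet> b) * ((x + - x0) \<bullet> b)) = (dist x0 x)\<^sup>2" for x
  proof -
    have "(dist x0 x)\<^sup>2 = (x + - x0) \<bullet> (x + - x0)"
      by (metis dist_commute dist_norm dot_square_norm uminus_add_conv_diff add.commute)
    then show ?thesis by (simp add: euclidean_inner[of "x - x0" "x - x0"])
  qed
  show "\<beta> x0 \<noteq> 0"
    unfolding \<beta>_def norm using assms by (simp add: flat_exp_def)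
  show "\<beta> x = 0" if "x \<notin> cball x0 r" for x
  proof -
    have "r\<^sup>2 \<le> (dist x0 x)\<^sup>2"
      using that assms by (intro power_mono) auto
    then show ?thesis unfolding \<beta>_def norm by (simp add: flat_exp_def)
  qed
qed



section \<open>The Hadamard lemma\<close>

lemma segment_in_convex:
  assumes "convex S" "x0 \<in> S" "x \<in> S" "t \<in> {0..1}"
  shows "x0 + t *\<^sub>R (x - x0) \<in> S"
proof -
  have "x0 + t *\<^sub>R (x - x0) = (1 - t) *\<^sub>R x0 + t *\<^sub>R x"
    by (simp add: algebra_simps)
  then show ?thesis using convexD[OF assms(1-3), of "1 - t" t] assms(4) by simp
qed

lemma segment_continuous:
  fixes f :: "'e::euclidean_space \<Rightarrow> real"
  assumes "convex S" "x0 \<in> S" "continuous_on S f"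
  shows "continuous_on (S \<times> {0..1}) (\<lambda>(x, t). t ^ j * f (x0 + t *\<^sub>R (x - x0)))"
  unfolding split_beta
  by (intro continuous_intros continuous_on_compose2[OF assms(3)])
    (auto intro: segment_in_convex[OF assms(1,2)])

text \<open>
  Each differentiation under the integral sign brings out a factor \<open>t\<close>; the power of \<open>t\<close> in the
  integrand makes the induction on the order go through.
\<close>

lemma C_k_on_segment_integral:
  fixes f :: "'e::euclidean_space \<Rightarrow> real"
  assumes "open S" "convex S" "x0 \<in> S" "C_k_on k S f"
  shows "C_k_on k S (\<lambda>x. integral {0..1} (\<lambda>t. t ^ j * f (x0 + t *\<^sub>R (x - x0))))"
  using assms(4)
proof (induction k arbitrary: f j)
  case 0
  show ?case
    using integral_continuous_on_param[OF segment_continuous[OF assms(2,3), of f j, folded box_real(2)]] 0 by simp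
next
  case (Suc k)
  define D where "D x v = frechet_derivative f (at x) v" for x v
  have der: "(f has_derivative D x) (at x)" if "x \<in> S" for x
    using C_k_on_SucD[OF assms(1) Suc.prems that] by (simp add: D_def[abs_def])
  have D_k: "C_k_on k S (\<lambda>x. D x v)" for v
    unfolding D_def by (rule C_k_on_deriv[OF assms(1) Suc.prems])
  have D_cont: "continuous_on S (\<lambda>x. D x v)" for v
    by (rule C_k_on_continuous[OF assms(1) D_k])
  have D_expand: "D x v = (\<Sum>b\<in>Basis. (v \<bullet> b) * D x b)" if "x \<in> S" for x v
  proof -
    have lin: "linear (D x)" using der[OF that] has_derivative_linear by blast
    have "D x (\<Sum>b\<in>Basis. (v \<bullet> b) *\<^sub>R b) = (\<Sum>b\<in>Basis. (v \<bullet> b) * D x b)"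
      by (simp add: linear_sum[OF lin] linear_cmul[OF lin])
    then show ?thesis by (simp add: euclidean_representation)
  qed
  define L where "L x t = (\<Sum>b\<in>Basis. (t ^ Suc j * D (x0 + t *\<^sub>R (x - x0)) b) *\<^sub>R blinfun_inner_left b)"
    for x and t :: real
  have L_apply: "blinfun_apply (L x t) v = t ^ Suc j * D (x0 + t *\<^sub>R (x - x0)) v"
    if "x \<in> S" "t \<in> {0..1}" for x t v
    unfolding D_expand[OF segment_in_convex[OF assms(2,3) that], of v]
    by (simp add: L_def blinfun.sum_left blinfun.scaleR_left sum_distrib_left mult_ac inner_commute)
  have L_cont: "continuous_on (S \<times> {0..1}) (\<lambda>(x, t). L x t)"
    unfolding L_def split_beta
    by (intro continuous_on_sum continuous_on_scaleR continuous_on_const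
        segment_continuous[OF assms(2,3) D_cont, unfolded split_beta])
  show ?case
  proof (rule C_k_on_SucI[OF assms(1), where
        f' = "\<lambda>x v. integral {0..1} (\<lambda>t. t ^ Suc j * D (x0 + t *\<^sub>R (x - x0)) v)"])
    fix x assume x: "x \<in> S"
    have "((\<lambda>x. integral (cbox 0 1) (\<lambda>t. t ^ j * f (x0 + t *\<^sub>R (x - x0))))
        has_derivative blinfun_apply (integral (cbox 0 1) (L x))) (at x within S)"
    proof (rule leibniz_rule[OF _ _ _ x assms(2)])
      fix y and t :: real assume yt: "y \<in> S" "t \<in> cbox 0 1"
      have seg: "x0 + t *\<^sub>R (y - x0) \<in> S"
        using segment_in_convex[OF assms(2,3)] yt by auto
      have "((\<lambda>x. x0 + t *\<^sub>R (x - x0)) has_derivative (\<lambda>v. t *\<^sub>R v)) (at y within S)"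
        by (auto intro!: derivative_eq_intros)
      from has_derivative_compose[OF this der[OF seg]]
      have "((\<lambda>x. f (x0 + t *\<^sub>R (x - x0))) has_derivative
          (\<lambda>v. D (x0 + t *\<^sub>R (y - x0)) (t *\<^sub>R v))) (at y within S)"
        by simp
      moreover have "D (x0 + t *\<^sub>R (y - x0)) (t *\<^sub>R v) = t * D (x0 + t *\<^sub>R (y - x0)) v" for v
        using linear_cmul[OF has_derivative_linear[OF der[OF seg]]] by simp
      ultimately have "((\<lambda>x. t ^ j * f (x0 + t *\<^sub>R (x - x0))) has_derivative
          (\<lambda>v. t ^ j * (t * D (x0 + t *\<^sub>R (y - x0)) v))) (at y within S)"
        by (intro has_derivative_mult_right) simp
      moreover have "blinfun_apply (L y t) = (\<lambda>v. t ^ j * (t * D (x0 + t *\<^sub>R (y - x0)) v))"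
        using L_apply yt by (auto simp: fun_eq_iff)
      ultimately show "((\<lambda>x. t ^ j * f (x0 + t *\<^sub>R (x - x0))) has_derivative
          blinfun_apply (L y t)) (at y within S)"
        by simp
    next
      fix y assume "y \<in> S"
      then have "continuous_on {0..1} (\<lambda>t. t ^ j * f (x0 + t *\<^sub>R (y - x0)))"
        by (intro continuous_intros continuous_on_compose2[OF C_k_on_continuous[OF assms(1) Suc.prems]])
          (auto intro: segment_in_convex[OF assms(2,3)])
      then show "(\<lambda>t. t ^ j * f (x0 + t *\<^sub>R (y - x0))) integrable_on cbox 0 1"
        by (simp add: integrable_continuous_interval)
    next
      show "continuous_on (S \<times> cbox 0 1) (\<lambda>(x, t). L x t)"
        using L_cont by simp
    qed
    moreover have "blinfun_apply (integral (cbox 0 1) (L x))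
        = (\<lambda>v. integral {0..1} (\<lambda>t. t ^ Suc j * D (x0 + t *\<^sub>R (x - x0)) v))"
    proof
      fix v
      have "continuous_on {0..1} (L x)"
        by (rule continuous_on_compose2[OF L_cont, of _ "\<lambda>t. (x, t)", simplified])
          (use x in \<open>auto intro!: continuous_intros\<close>)
      then have "L x integrable_on {0..1}" by (rule integrable_continuous_interval)
      then have "blinfun_apply (integral {0..1} (L x)) v = integral {0..1} (\<lambda>t. blinfun_apply (L x t) v)"
        using integral_linear[of "L x" "{0..1}" "\<lambda>L. blinfun_apply L v"]
        by (simp add: o_def blinfun.bounded_linear_left)
      also have "\<dots> = integral {0..1} (\<lambda>t. t ^ Suc j * D (x0 + t *\<^sub>R (x - x0)) v)"
        by (rule integral_cong) (rule L_apply[OF x])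
      finally show "blinfun_apply (integral (cbox 0 1) (L x)) v
          = integral {0..1} (\<lambda>t. t ^ Suc j * D (x0 + t *\<^sub>R (x - x0)) v)"
        by simp
    qed
    ultimately show "((\<lambda>x. integral {0..1} (\<lambda>t. t ^ j * f (x0 + t *\<^sub>R (x - x0)))) has_derivative
        (\<lambda>v. integral {0..1} (\<lambda>t. t ^ Suc j * D (x0 + t *\<^sub>R (x - x0)) v))) (at x)"
      by (simp add: at_within_open[OF x assms(1)])
  next
    show "C_k_on k S (\<lambda>x. integral {0..1} (\<lambda>t. t ^ Suc j * D (x0 + t *\<^sub>R (x - x0)) v))" for v
      by (rule Suc.IH[OF D_k])
  qed
qed

text \<open>
  Integrate the derivative of \<open>f\<close> along the segment from \<open>x0\<close> to \<open>x\<close>, and expand it over the basis.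
\<close>

lemma hadamard:
  fixes f :: "'e::euclidean_space \<Rightarrow> real"
  assumes "open S" "convex S" "x0 \<in> S" "smooth_on S f"
  obtains h where "\<And>b. smooth_on S (h b)" "\<And>b. h b x0 = frechet_derivative f (at x0) b"
    "\<And>x. x \<in> S \<Longrightarrow> f x = f x0 + (\<Sum>b\<in>Basis. ((x - x0) \<bullet> b) * h b x)"
proof
  define D where "D x v = frechet_derivative f (at x) v" for x v
  define h where "h b x = integral {0..1} (\<lambda>t. D (x0 + t *\<^sub>R (x - x0)) b)" for b x
  have f_k: "C_k_on k S f" for k using assms(4) by (simp add: smooth_on_def)
  have der: "(f has_derivative D x) (at x)" if "x \<in> S" for x
    using C_k_on_SucD[OF assms(1) f_k that] by (simp add: D_def[abs_def])
  have D_k: "C_k_on k S (\<lambda>x. D x v)" for v k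
    unfolding D_def by (rule C_k_on_deriv[OF assms(1) f_k])
  show "smooth_on S (h b)" for b
    unfolding smooth_on_def h_def
    using C_k_on_segment_integral[OF assms(1-3) D_k, of _ 0] by simp
  show "h b x0 = frechet_derivative f (at x0) b" for b
    by (simp add: h_def D_def)
  show "f x = f x0 + (\<Sum>b\<in>Basis. ((x - x0) \<bullet> b) * h b x)" if x: "x \<in> S" for x
  proof -
    have "((\<lambda>t. f (x0 + t *\<^sub>R (x - x0))) has_vector_derivative
        D (x0 + t *\<^sub>R (x - x0)) (x - x0)) (at t within {0..1})" if "t \<in> {0..1}" for t
    proof -
      have seg: "x0 + t *\<^sub>R (x - x0) \<in> S"
        using segment_in_convex[OF assms(2,3)] x that by auto
      have "((\<lambda>t. x0 + t *\<^sub>R (x - x0)) has_derivative (\<lambda>u. u *\<^sub>R (x - x0))) (at t within {0..1})"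
        by (auto intro!: derivative_eq_intros)
      from has_derivative_compose[OF this der[OF seg]]
      have "((\<lambda>t. f (x0 + t *\<^sub>R (x - x0))) has_derivative
          (\<lambda>u. D (x0 + t *\<^sub>R (x - x0)) (u *\<^sub>R (x - x0)))) (at t within {0..1})" .
      moreover have "D (x0 + t *\<^sub>R (x - x0)) (u *\<^sub>R (x - x0)) = u * D (x0 + t *\<^sub>R (x - x0)) (x - x0)"
        for u
        using linear_cmul[OF has_derivative_linear[OF der[OF seg]]] by simp
      ultimately show ?thesis by (simp add: has_vector_derivative_def)
    qed
    then have "((\<lambda>t. D (x0 + t *\<^sub>R (x - x0)) (x - x0)) has_integral
        f (x0 + 1 *\<^sub>R (x - x0)) - f (x0 + 0 *\<^sub>R (x - x0))) {0..1}"
      by (intro fundamental_theorem_of_calculus) auto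
    then have int: "integral {0..1} (\<lambda>t. D (x0 + t *\<^sub>R (x - x0)) (x - x0)) = f x - f x0"
      by (simp add: integral_unique)
    have expand: "D (x0 + t *\<^sub>R (x - x0)) (x - x0)
        = (\<Sum>b\<in>Basis. ((x - x0) \<bullet> b) * D (x0 + t *\<^sub>R (x - x0)) b)" if "t \<in> {0..1}" for t
    proof -
      have lin: "linear (D (x0 + t *\<^sub>R (x - x0)))"
        using has_derivative_linear der segment_in_convex[OF assms(2,3) x that] by blast
      have "D (x0 + t *\<^sub>R (x - x0)) (\<Sum>b\<in>Basis. ((x - x0) \<bullet> b) *\<^sub>R b)
          = (\<Sum>b\<in>Basis. ((x - x0) \<bullet> b) * D (x0 + t *\<^sub>R (x - x0)) b)"
        by (simp add: linear_sum[OF lin] linear_cmul[OF lin])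
      then show ?thesis by (simp add: euclidean_representation)
    qed
    have "(\<lambda>t. D (x0 + t *\<^sub>R (x - x0)) b) integrable_on {0..1}" for b
      by (intro integrable_continuous_interval
          continuous_on_compose2[OF C_k_on_continuous[OF assms(1) D_k[of 0]]] continuous_intros)
        (auto intro: segment_in_convex[OF assms(2,3) x])
    then have "integral {0..1} (\<lambda>t. \<Sum>b\<in>Basis. ((x - x0) \<bullet> b) * D (x0 + t *\<^sub>R (x - x0)) b)
        = (\<Sum>b\<in>Basis. ((x - x0) \<bullet> b) * h b x)"
      unfolding h_def by (subst integral_sum) (auto intro: integrable_on_mult_right)
    moreover have "integral {0..1} (\<lambda>t. D (x0 + t *\<^sub>R (x - x0)) (x - x0))
        = integral {0..1} (\<lambda>t. \<Sum>b\<in>Basis. ((x - x0) \<bullet> b) * D (x0 + t *\<^sub>R (x - x0)) b)"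
      by (rule integral_cong) (rule expand)
    ultimately show ?thesis using int by simp
  qed
qed

section \<open>Smooth functions and tangent vectors\<close>

text \<open>
  For manifolds of dimension 0, where charts take values in \<open>{0}\<close>.
\<close>

lemma C_k_on_origin: "S \<subseteq> {0} \<Longrightarrow> C_k_on k S f"
proof (induction k arbitrary: f)
  case 0
  then have "S = {} \<or> S = {0}" by blast
  then show ?case by auto
next
  case (Suc k)
  have "f differentiable (at x within S)" if "x \<in> S" for x and f :: "'a \<Rightarrow> 'b"
  proof -
    have "S = {x}" using Suc.prems that by auto
    then have "(f has_derivative (\<lambda>_. 0)) (at x within S)"
      by (simp add: has_derivative_within_singleton_iff)
    then show ?thesis by (auto simp: differentiable_def)
  qed
  then show ?case using Suc by auto
qed

context smooth_manifold
begin

lemma smooth_zero_dimensional: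
  assumes "m = 0"
  shows "f \<in> smooth_functions A"
proof -
  have "c ` U \<subseteq> {0}" if "(U, c) \<in> A" for U c
    using openin_imp_subset[OF chart_range[OF that]] assms by (simp add: model_space_def)
  then show ?thesis
    by (auto simp: smooth_functions_def smooth_on_def intro!: C_k_on_origin)
qed

lemma chart_range_open: "m \<noteq> 0 \<Longrightarrow> (U, c) \<in> A \<Longrightarrow> open (c ` U)"
  using chart_range[of U c] by (simp add: model_space_def)

lemma chart_inverse:
  assumes "(U, c) \<in> A"
  shows "q \<in> U \<Longrightarrow> inv_into U c (c q) = q" "x \<in> c ` U \<Longrightarrow> c (inv_into U c x) = x"
    "x \<in> c ` U \<Longrightarrow> inv_into U c x \<in> U"
  using homeomorphism_apply1[OF chart_homeomorphism[OF assms]]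
  by (auto intro: f_inv_into_f inv_into_into)

lemma smoothI:
  assumes "\<And>U c k. m \<noteq> 0 \<Longrightarrow> (U, c) \<in> A \<Longrightarrow> open (c ` U) \<Longrightarrow> C_k_on k (c ` U) (\<lambda>x. f (inv_into U c x))"
  shows "f \<in> smooth_functions A"
proof (cases "m = 0")
  case False
  have "C_k_on k (c ` U) (\<lambda>x. f (inv_into U c x))" if "(U, c) \<in> A" for U c k
    using assms[OF False that chart_range_open[OF False that]] .
  then show ?thesis
    unfolding smooth_functions_def smooth_on_def by blast
qed (rule smooth_zero_dimensional)

lemma smoothD:
  "f \<in> smooth_functions A \<Longrightarrow> (U, c) \<in> A \<Longrightarrow> C_k_on k (c ` U) (\<lambda>x. f (inv_into U c x))"
  unfolding smooth_functions_def smooth_on_def by blast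

lemma smooth_const: "(\<lambda>_. r) \<in> smooth_functions A"
  by (rule smoothI) (rule C_k_on_const)

lemma smooth_add:
  assumes "f \<in> smooth_functions A" "h \<in> smooth_functions A"
  shows "(\<lambda>q. f q + h q) \<in> smooth_functions A"
  by (rule smoothI) (rule C_k_on_add[OF _ smoothD[OF assms(1)] smoothD[OF assms(2)]])

lemma smooth_mult:
  assumes "f \<in> smooth_functions A" "h \<in> smooth_functions A"
  shows "(\<lambda>q. f q * h q) \<in> smooth_functions A"
  by (rule smoothI) (rule C_k_on_mult[OF _ smoothD[OF assms(1)] smoothD[OF assms(2)]])

lemma smooth_minus:
  assumes "f \<in> smooth_functions A"
  shows "(\<lambda>q. - f q) \<in> smooth_functions A"
  using smooth_mult[OF smooth_const[of "-1"] assms] by simp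

lemma smooth_diff:
  assumes "f \<in> smooth_functions A" "h \<in> smooth_functions A"
  shows "(\<lambda>q. f q - h q) \<in> smooth_functions A"
  using smooth_add[OF assms(1) smooth_minus[OF assms(2)]] by simp

lemma smooth_sum:
  assumes "\<And>i. i \<in> I \<Longrightarrow> f i \<in> smooth_functions A"
  shows "(\<lambda>q. \<Sum>i\<in>I. f i q) \<in> smooth_functions A"
  using assms
proof (induction I rule: infinite_finite_induct)
  case (insert i I)
  then show ?case using smooth_add[of "f i"] by simp
qed (simp_all add: smooth_const)

lemma smooth_prod:
  assumes "\<And>i. i \<in> I \<Longrightarrow> f i \<in> smooth_functions A"
  shows "(\<lambda>q. \<Prod>i\<in>I. f i q) \<in> smooth_functions A"
  using assms
proof (induction I rule: infinite_finite_induct)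
  case (insert i I)
  then show ?case using smooth_mult[of "f i"] by simp
qed (simp_all add: smooth_const)

text \<open>
  This form of locality spares partitions of unity: near \<open>p\<close> the function \<open>f\<close> is the
  quotient of \<open>\<rho> f\<close> by \<open>\<rho>\<close>.
\<close>

lemma smooth_local:
  assumes "\<And>p. \<exists>\<rho>\<in>smooth_functions A. \<rho> p \<noteq> 0 \<and> (\<lambda>q. \<rho> q * f q) \<in> smooth_functions A"
  shows "f \<in> smooth_functions A"
proof (rule smoothI)
  fix U c k assume c: "(U, c) \<in> A" and op: "open (c ` U)"
  show "C_k_on k (c ` U) (\<lambda>x. f (inv_into U c x))"
  proof (rule C_k_on_local[OF op])
    fix x assume x: "x \<in> c ` U"
    obtain \<rho> where \<rho>: "\<rho> \<in> smooth_functions A" "\<rho> (inv_into U c x) \<noteq> 0"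
      "(\<lambda>q. \<rho> q * f q) \<in> smooth_functions A"
      using assms by blast
    define T where "T = {y \<in> c ` U. \<rho> (inv_into U c y) \<noteq> 0}"
    have "continuous_on (c ` U) (\<lambda>y. \<rho> (inv_into U c y))"
      by (rule C_k_on_continuous[OF op smoothD[OF \<rho>(1) c]])
    then have "open ((\<lambda>y. \<rho> (inv_into U c y)) -` (- {0}) \<inter> c ` U)"
      using op by (simp add: continuous_on_open_vimage open_Compl)
    moreover have "T = (\<lambda>y. \<rho> (inv_into U c y)) -` (- {0}) \<inter> c ` U"
      by (auto simp: T_def)
    ultimately have T: "open T" by simp
    have sub: "T \<subseteq> c ` U" by (auto simp: T_def)
    have "C_k_on k T (\<lambda>y. (\<rho> (inv_into U c y) * f (inv_into U c y)) * inverse (\<rho> (inv_into U c y)))"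
      by (intro C_k_on_mult C_k_on_inverse T C_k_on_mono[OF op T sub smoothD[OF \<rho>(3) c]]
          C_k_on_mono[OF op T sub smoothD[OF \<rho>(1) c]])
        (simp add: T_def)
    then have "C_k_on k T (\<lambda>y. f (inv_into U c y))"
      by (rule C_k_on_cong[rotated]) (simp add: T_def)
    then show "\<exists>T. open T \<and> x \<in> T \<and> C_k_on k T (\<lambda>x. f (inv_into U c x))"
      using T x \<rho>(2) by (auto simp: T_def)
  qed
qed

lemma tangent_add:
  "v \<in> tangent_space A p \<Longrightarrow> f \<in> smooth_functions A \<Longrightarrow> h \<in> smooth_functions A \<Longrightarrow>
    v (\<lambda>q. f q + h q) = v f + v h"
  and tangent_cmult:
  "v \<in> tangent_space A p \<Longrightarrow> f \<in> smooth_functions A \<Longrightarrow> v (\<lambda>q. r * f q) = r * v f"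
  and tangent_mult:
  "v \<in> tangent_space A p \<Longrightarrow> f \<in> smooth_functions A \<Longrightarrow> h \<in> smooth_functions A \<Longrightarrow>
    v (\<lambda>q. f q * h q) = v f * h p + f p * v h"
  and tangent_nonsmooth:
  "v \<in> tangent_space A p \<Longrightarrow> f \<notin> smooth_functions A \<Longrightarrow> v f = 0"
  unfolding tangent_space_def by blast+

lemma tangent_const:
  assumes "v \<in> tangent_space A p"
  shows "v (\<lambda>_. r) = 0"
proof -
  have "v (\<lambda>_. 1 * 1) = v (\<lambda>_. 1) * 1 + 1 * v (\<lambda>_. 1)"
    by (rule tangent_mult[OF assms smooth_const smooth_const])
  moreover have "v (\<lambda>_. r * 1) = r * v (\<lambda>_. 1)"
    by (rule tangent_cmult[OF assms smooth_const])
  ultimately show ?thesis by (simp only: mult_1 mult_1_right) simp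
qed

lemma tangent_minus:
  assumes "v \<in> tangent_space A p" "f \<in> smooth_functions A"
  shows "v (\<lambda>q. - f q) = - v f"
  using tangent_cmult[OF assms, of "-1"] by simp

lemma tangent_diff:
  assumes "v \<in> tangent_space A p" "f \<in> smooth_functions A" "h \<in> smooth_functions A"
  shows "v (\<lambda>q. f q - h q) = v f - v h"
  using tangent_add[OF assms(1,2) smooth_minus[OF assms(3)]] tangent_minus[OF assms(1,3)] by simp

lemma tangent_sum:
  assumes "v \<in> tangent_space A p" "\<And>i. i \<in> I \<Longrightarrow> f i \<in> smooth_functions A"
  shows "v (\<lambda>q. \<Sum>i\<in>I. f i q) = (\<Sum>i\<in>I. v (f i))"
  using assms(2)
proof (induction I rule: infinite_finite_induct)
  case (insert i I)
  then show ?case using tangent_add[OF assms(1), of "f i" "\<lambda>q. \<Sum>i\<in>I. f i q"] smooth_sum[of I f] by simp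
qed (simp_all add: tangent_const[OF assms(1)])

lemma subspace_tangent_space: "subspace (tangent_space A p)"
  unfolding subspace_def
  by (auto simp: tangent_space_def zero_fun_def plus_fun_def scaleR_fun_def algebra_simps)

lemma tangent_space_zero_dimensional:
  assumes "m = 0"
  shows "tangent_space A p = {0}"
proof -
  have "v f = 0" if v: "v \<in> tangent_space A p" for v f
  proof -
    \<comment> \<open>The indicator of a point is smooth here, and it is idempotent.\<close>
    define e where "e q = (if q = p then 1 else 0 :: real)" for q
    have sm: "h \<in> smooth_functions A" for h by (rule smooth_zero_dimensional[OF assms])
    have "(\<lambda>q. e q * e q) = e" by (auto simp: e_def)
    then have "v e = 0" using tangent_mult[OF v sm[of e] sm[of e]] by (simp add: e_def)
    moreover have "(\<lambda>q. f q * e q) = (\<lambda>q. f p * e q)" by (auto simp: e_def)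
    ultimately show ?thesis
      using tangent_mult[OF v sm[of f] sm[of e]] tangent_cmult[OF v sm[of e], of "f p"]
      by (simp add: e_def)
  qed
  then have "tangent_space A p \<subseteq> {0}" by (auto simp: zero_fun_def fun_eq_iff)
  moreover have "0 \<in> tangent_space A p"
    by (rule subspace_0[OF subspace_tangent_space])
  ultimately show ?thesis by auto
qed

section \<open>Coordinate fields\<close>

text \<open>
  Outside the chart domain the function vanishes near every point, because the preimage of the
  compact set \<open>K\<close> is closed in the Hausdorff space \<open>'a\<close>.
\<close>

lemma smooth_extend_by_zero:
  assumes "m \<noteq> 0" "(U, c) \<in> A" "smooth_on (c ` U) h" "compact K" "K \<subseteq> c ` U"
    and zero: "\<And>x. x \<in> c ` U - K \<Longrightarrow> h x = 0"
  shows "(\<lambda>q. if q \<in> U then h (c q) else 0) \<in> smooth_functions A" (is "?f \<in> _")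
proof (rule smoothI)
  fix V d k assume d: "(V, d) \<in> A" and op: "open (d ` V)"
  have image_open: "open (d ` (V \<inter> W))" if "open W" for W
  proof -
    have "openin (top_of_set V) (V \<inter> W)" using that by (simp add: openin_open_Int)
    then have "openin (top_of_set (d ` V)) (d ` (V \<inter> W))"
      by (rule homeomorphism_imp_open_map[OF chart_homeomorphism[OF d]])
    then show ?thesis using op openin_open_trans by blast
  qed
  have "compact (inv_into U c ` K)"
    using chart_homeomorphism[OF assms(2)] assms(4,5)
    by (meson compact_continuous_image continuous_on_subset homeomorphism_def)
  then have closed: "closed (inv_into U c ` K)" by (rule compact_imp_closed)
  show "C_k_on k (d ` V) (\<lambda>x. ?f (inv_into V d x))"
  proof (rule C_k_on_local[OF op])
    fix x assume x: "x \<in> d ` V"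
    let ?q = "inv_into V d x"
    show "\<exists>T. open T \<and> x \<in> T \<and> C_k_on k T (\<lambda>x. ?f (inv_into V d x))"
    proof (cases "?q \<in> U")
      case True
      have T: "open (d ` (V \<inter> U))" by (rule image_open[OF chart_domain[OF assms(2)]])
      have sub: "(\<lambda>x. c (inv_into V d x)) ` d ` (V \<inter> U) \<subseteq> c ` U"
        using chart_inverse(1)[OF d] by auto
      have "C_k_on k (d ` (V \<inter> U)) (\<lambda>x. h (c (inv_into V d x)))"
        using charts_compatible[OF d assms(2)] assms(3)
        by (intro C_k_on_compose[OF T chart_range_open[OF assms(1,2)] sub])
          (auto simp: smooth_on_def)
      then have "C_k_on k (d ` (V \<inter> U)) (\<lambda>x. ?f (inv_into V d x))"
        by (rule C_k_on_cong[rotated]) (use chart_inverse(1)[OF d] in auto)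
      moreover have "x \<in> d ` (V \<inter> U)"
        using True chart_inverse(2,3)[OF d x] by (metis IntI imageI)
      ultimately show ?thesis using T by blast
    next
      case False
      let ?W = "- inv_into U c ` K"
      have T: "open (d ` (V \<inter> ?W))" using closed by (intro image_open) (simp add: open_Compl)
      have "?q \<in> ?W"
        using False chart_inverse(3)[OF assms(2)] assms(5) by auto
      then have "x \<in> d ` (V \<inter> ?W)"
        using chart_inverse(2,3)[OF d x] by (metis IntI imageI)
      moreover have "?f (inv_into V d y) = 0" if y: "y \<in> d ` (V \<inter> ?W)" for y
      proof -
        obtain q where q: "q \<in> V" "q \<in> ?W" "y = d q" using y by blast
        have "c q \<notin> K" if "q \<in> U"
          using q(2) chart_inverse(1)[OF assms(2) that] by (metis ComplD imageI)
        then show ?thesis using q zero by (auto simp: chart_inverse(1)[OF d])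
      qed
      then have "C_k_on k (d ` (V \<inter> ?W)) (\<lambda>x. ?f (inv_into V d x))"
        by (intro C_k_on_cong[OF _ C_k_on_const[OF T, of _ 0]]) simp
      ultimately show ?thesis using T by blast
    qed
  qed
qed

end

lemma smooth_on_has_derivative:
  "open S \<Longrightarrow> smooth_on S f \<Longrightarrow> x \<in> S \<Longrightarrow> (f has_derivative frechet_derivative f (at x)) (at x)"
  using C_k_on_SucD[of S 0 f x] unfolding smooth_on_def by blast

text \<open>The factor \<open>h\<close> only has to be defined near the support of the bump function.\<close>

lemma smooth_on_cutoff:
  fixes h \<beta> :: "'e::euclidean_space \<Rightarrow> real"
  assumes "open S" "open B" "cball x0 r \<subseteq> B" "smooth_on UNIV \<beta>" "smooth_on B h"
    and zero: "\<And>x. x \<notin> cball x0 r \<Longrightarrow> \<beta> x = 0"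
  shows "smooth_on S (\<lambda>x. \<beta> x * h x)"
  unfolding smooth_on_def
proof (rule allI, rule C_k_on_local[OF assms(1)])
  fix k x
  show "\<exists>T. open T \<and> x \<in> T \<and> C_k_on k T (\<lambda>x. \<beta> x * h x)"
  proof (cases "x \<in> B")
    case True
    have "C_k_on k B (\<lambda>x. \<beta> x * h x)"
      using assms(4,5)
      by (intro C_k_on_mult assms(2) C_k_on_mono[OF open_UNIV assms(2), of k \<beta>])
        (simp_all add: smooth_on_def)
    then show ?thesis using True assms(2) by blast
  next
    case False
    have op: "open (- cball x0 r)" by (simp add: open_Compl)
    have "C_k_on k (- cball x0 r) (\<lambda>x. \<beta> x * h x)"
      by (rule C_k_on_cong[OF _ C_k_on_const[OF op, of _ 0]]) (use zero in auto)
    then show ?thesis using False assms(3) op by blast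
  qed
qed

text \<open>
  The partial derivative in direction \<open>b\<close> with respect to the chart \<open>(U, c)\<close>, as a derivation
  at \<open>q\<close>.
\<close>

definition coordinate_vector ::
    "('a, 'e::euclidean_space) chart set \<Rightarrow> 'a set \<Rightarrow> ('a \<Rightarrow> 'e) \<Rightarrow> 'e \<Rightarrow> 'a \<Rightarrow> 'a tangent" where
  "coordinate_vector A U c b q f = (if f \<in> smooth_functions A
     then frechet_derivative (\<lambda>x. f (inv_into U c x)) (at (c q)) b else 0)"

context smooth_manifold
begin

lemma chart_has_derivative:
  assumes "m \<noteq> 0" "(U, c) \<in> A" "f \<in> smooth_functions A" "q \<in> U"
  shows "((\<lambda>x. f (inv_into U c x)) has_derivative
    (\<lambda>b. coordinate_vector A U c b q f)) (at (c q))"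
  using smooth_on_has_derivative[OF chart_range_open[OF assms(1,2)], of "\<lambda>x. f (inv_into U c x)" "c q"]
    assms(2-4)
  by (auto simp: smooth_functions_def coordinate_vector_def[abs_def])

lemma coordinate_vector_eqI:
  assumes "f \<in> smooth_functions A" "((\<lambda>x. f (inv_into U c x)) has_derivative D) (at (c q))"
  shows "coordinate_vector A U c b q f = D b"
  using frechet_derivative_at[OF assms(2)] assms(1) by (simp add: coordinate_vector_def)

lemma coordinate_vector_tangent:
  assumes "m \<noteq> 0" "(U, c) \<in> A" "q \<in> U"
  shows "coordinate_vector A U c b q \<in> tangent_space A q"
proof -
  note der = chart_has_derivative[OF assms(1,2) _ assms(3)]
  show ?thesis
    unfolding tangent_space_def
  proof (intro CollectI conjI ballI allI impI)
    fix f h assume f: "f \<in> smooth_functions A" and h: "h \<in> smooth_functions A"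
    show "coordinate_vector A U c b q (\<lambda>q. f q + h q)
        = coordinate_vector A U c b q f + coordinate_vector A U c b q h"
      by (rule coordinate_vector_eqI[OF smooth_add[OF f h] has_derivative_add[OF der[OF f] der[OF h]]])
    show "coordinate_vector A U c b q (\<lambda>q. f q * h q)
        = coordinate_vector A U c b q f * h q + f q * coordinate_vector A U c b q h"
      using coordinate_vector_eqI[OF smooth_mult[OF f h] has_derivative_mult[OF der[OF f] der[OF h]], of b]
      by (simp add: chart_inverse(1)[OF assms(2,3)])
  next
    fix f r assume f: "f \<in> smooth_functions A"
    show "coordinate_vector A U c b q (\<lambda>q. r * f q) = r * coordinate_vector A U c b q f"
      by (rule coordinate_vector_eqI[OF smooth_mult[OF smooth_const f] has_derivative_mult_right[OF der[OF f]]])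
  qed (simp add: coordinate_vector_def)
qed

text \<open>
  The convex set \<open>B\<close> leaves room around the support of \<open>\<beta>\<close> for Hadamard's lemma.
\<close>

lemma chart_bump:
  assumes "m \<noteq> 0" "(U, c) \<in> A" "p \<in> U"
  obtains B r \<beta> where "open B" "convex B" "c p \<in> B" "B \<subseteq> c ` U" "cball (c p) r \<subseteq> B"
    "smooth_on UNIV \<beta>" "\<beta> (c p) = (1::real)" "\<forall>x. x \<notin> cball (c p) r \<longrightarrow> \<beta> x = 0"
proof -
  obtain R where R: "R > 0" "ball (c p) R \<subseteq> c ` U"
    using chart_range_open[OF assms(1,2)] assms(3) open_contains_ball by blast
  obtain \<beta> where \<beta>: "smooth_on UNIV \<beta>" "\<beta> (c p) \<noteq> (0::real)" "\<And>x. x \<notin> cball (c p) (R / 2) \<Longrightarrow> \<beta> x = 0"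
    using bump_function[of "R / 2" "c p"] R(1) by (metis half_gt_zero)
  have "smooth_on UNIV (\<lambda>x. inverse (\<beta> (c p)) * \<beta> x)"
    using \<beta>(1) by (auto simp: smooth_on_def intro!: C_k_on_mult C_k_on_const)
  moreover have "cball (c p) (R / 2) \<subseteq> ball (c p) R" using R(1) by auto
  ultimately show ?thesis
    using R \<beta> that[of "ball (c p) R" "R / 2" "\<lambda>x. inverse (\<beta> (c p)) * \<beta> x"] by simp
qed

text \<open>
  Multiplying the Hadamard expansion of \<open>f\<close> in a chart by the square of a bump function makes
  all its terms globally smooth, so that a derivation can be applied to them.
\<close>

lemma tangent_expansion:
  assumes "m \<noteq> 0" "(U, c) \<in> A" "p \<in> U"
  obtains y where "\<forall>b. y b \<in> smooth_functions A"
    "\<forall>v\<in>tangent_space A p. v = (\<Sum>b\<in>Basis. v (y b) *\<^sub>R coordinate_vector A U c b p)"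
    "\<forall>b\<in>Basis. \<forall>b'\<in>Basis.
      coordinate_vector A U c b p (y b') = (if b = b' then 1 else 0)"
proof -
  obtain B r \<beta> where B: "open B" "convex B" "c p \<in> B" "B \<subseteq> c ` U" "cball (c p) r \<subseteq> B"
    and \<beta>: "smooth_on UNIV \<beta>" "\<beta> (c p) = (1::real)" "\<forall>x. x \<notin> cball (c p) r \<longrightarrow> \<beta> x = 0"
    by (rule chart_bump[OF assms]) (rule that)
  note op = chart_range_open[OF assms(1,2)]
  define ext where "ext h q = (if q \<in> U then \<beta> (c q) * h (c q) else 0)" for h q
  have ext_smooth: "ext h \<in> smooth_functions A" if "smooth_on B h" for h
    unfolding ext_def
    by (rule smooth_extend_by_zero[OF assms(1,2)
          smooth_on_cutoff[OF op B(1,5) \<beta>(1) that \<beta>(3)[rule_format]]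
          compact_cball[of "c p" r] order_trans[OF B(5,4)]])
      (use \<beta>(3) in simp_all)
  define y where "y b = ext (\<lambda>x. (x - c p) \<bullet> b)" for b
  have y: "y b \<in> smooth_functions A" for b
    unfolding y_def
  proof (rule ext_smooth, unfold smooth_on_def, rule allI)
    fix k
    have "C_k_on k B (\<lambda>x. x \<bullet> b + - (c p \<bullet> b))"
      by (intro C_k_on_add C_k_on_const C_k_on_linear_map B bounded_linear_inner_left)
    then show "C_k_on k B (\<lambda>x. (x - c p) \<bullet> b)" by (simp add: inner_diff_left)
  qed
  have y_p: "y b p = 0" for b using assms(3) by (simp add: y_def ext_def)
  have expansion: "v f = (\<Sum>b\<in>Basis. v (y b) * coordinate_vector A U c b p f)"
    if v: "v \<in> tangent_space A p" and f: "f \<in> smooth_functions A" for v f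
  proof -
    have "smooth_on B (\<lambda>x. f (inv_into U c x))"
      using C_k_on_mono[OF op B(1,4) smoothD[OF f assms(2)]] by (simp add: smooth_on_def)
    from hadamard[OF B(1-3) this] obtain h where h: "\<And>b. smooth_on B (h b)"
      "\<And>b. h b (c p) = frechet_derivative (\<lambda>x. f (inv_into U c x)) (at (c p)) b"
      "\<And>x. x \<in> B \<Longrightarrow> f (inv_into U c x)
        = f (inv_into U c (c p)) + (\<Sum>b\<in>Basis. ((x - c p) \<bullet> b) * h b x)"
      by blast
    define \<psi> where "\<psi> = ext (\<lambda>_. 1)"
    \<comment> \<open>\<open>\<psi>\<close> is the bump function \<open>\<beta>\<close> itself, carried to the manifold.\<close>
    have \<psi>: "\<psi> \<in> smooth_functions A"
      unfolding \<psi>_def by (rule ext_smooth) (simp add: smooth_on_def C_k_on_const B)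
    have \<psi>_p: "\<psi> p = 1" using assms(3) \<beta>(2) by (simp add: \<psi>_def ext_def)
    have H: "ext (h b) \<in> smooth_functions A" for b by (rule ext_smooth[OF h(1)])
    have yH: "(\<lambda>q. y b q * ext (h b) q) \<in> smooth_functions A" for b
      by (rule smooth_mult[OF y H])
    have tangent_yH: "v (\<lambda>q. \<Sum>b\<in>Basis. y b q * ext (h b) q) = (\<Sum>b\<in>Basis. v (\<lambda>q. y b q * ext (h b) q))"
      by (rule tangent_sum[OF v yH])
    have H_p: "ext (h b) p = coordinate_vector A U c b p f" for b
      using assms(3) \<beta>(2) f h(2) by (simp add: ext_def coordinate_vector_def)
    have "\<psi> q * (\<psi> q * f q) = f p * (\<psi> q * \<psi> q) + (\<Sum>b\<in>Basis. y b q * ext (h b) q)" for q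
    proof (cases "q \<in> U \<and> c q \<in> B")
      case True
      then have "f q = f p + (\<Sum>b\<in>Basis. ((c q - c p) \<bullet> b) * h b (c q))"
        using h(3)[of "c q"] by (simp add: chart_inverse(1)[OF assms(2)] assms(3))
      then show ?thesis
        using True by (simp add: \<psi>_def y_def ext_def algebra_simps sum_distrib_left)
    next
      case False
      then have "q \<in> U \<Longrightarrow> \<beta> (c q) = 0" using \<beta>(3) B(5) by blast
      then show ?thesis by (simp add: \<psi>_def y_def ext_def)
    qed
    then have "v (\<lambda>q. \<psi> q * (\<psi> q * f q))
        = v (\<lambda>q. f p * (\<psi> q * \<psi> q) + (\<Sum>b\<in>Basis. y b q * ext (h b) q))" by simp
    moreover have "v (\<lambda>q. \<psi> q * (\<psi> q * f q)) = 2 * v \<psi> * f p + v f"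
      using tangent_mult[OF v \<psi> smooth_mult[OF \<psi> f]] tangent_mult[OF v \<psi> f] by (simp add: \<psi>_p)
    moreover have "v (\<lambda>q. f p * (\<psi> q * \<psi> q) + (\<Sum>b\<in>Basis. y b q * ext (h b) q))
        = f p * (2 * v \<psi>) + (\<Sum>b\<in>Basis. v (y b) * coordinate_vector A U c b p f)"
      using tangent_add[OF v smooth_mult[OF smooth_const[of "f p"] smooth_mult[OF \<psi> \<psi>]]
            smooth_sum[of Basis "\<lambda>b q. y b q * ext (h b) q", OF yH]]
          tangent_cmult[OF v smooth_mult[OF \<psi> \<psi>], of "f p"] tangent_mult[OF v \<psi> \<psi>]
          tangent_yH
      by (simp add: tangent_mult[OF v y H] y_p H_p \<psi>_p)
    ultimately show ?thesis by simp
  qed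
  show ?thesis
  proof (rule that; intro allI ballI)
    show "y b \<in> smooth_functions A" for b by (rule y)
  next
    fix v assume v: "v \<in> tangent_space A p"
    have expand: "v f = (\<Sum>b\<in>Basis. v (y b) * coordinate_vector A U c b p f)" for f
      using expansion[OF v, of f] tangent_nonsmooth[OF v, of f]
      by (cases "f \<in> smooth_functions A") (auto simp: coordinate_vector_def)
    have apply_at: "(\<Sum>b\<in>I. v (y b) *\<^sub>R coordinate_vector A U c b p) f
        = (\<Sum>b\<in>I. v (y b) * coordinate_vector A U c b p f)" for I f
      by (induction I rule: infinite_finite_induct) (auto simp: scaleR_fun_def)
    show "v = (\<Sum>b\<in>Basis. v (y b) *\<^sub>R coordinate_vector A U c b p)"
      by (rule ext, subst apply_at, rule expand)
  next
    fix b b' :: 'e assume b: "b \<in> Basis" "b' \<in> Basis"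
    have "(\<beta> has_derivative frechet_derivative \<beta> (at (c p))) (at (c p))"
      by (rule smooth_on_has_derivative[OF _ \<beta>(1)]) auto
    moreover have "((\<lambda>x. (x - c p) \<bullet> b') has_derivative (\<lambda>v. v \<bullet> b')) (at (c p))"
      by (auto intro!: derivative_eq_intros)
    ultimately have "((\<lambda>x. \<beta> x * ((x - c p) \<bullet> b')) has_derivative (\<lambda>v. v \<bullet> b')) (at (c p))"
      using has_derivative_mult by (fastforce simp: \<beta>(2))
    then have "((\<lambda>x. y b' (inv_into U c x)) has_derivative (\<lambda>v. v \<bullet> b')) (at (c p))"
      by (rule has_derivative_transform_within_open[OF _ op])
        (use assms(3) chart_inverse[OF assms(2)] in \<open>auto simp: y_def ext_def\<close>)
    then show "coordinate_vector A U c b p (y b') = (if b = b' then 1 else 0)"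
      using coordinate_vector_eqI[OF y] b by (auto simp: inner_Basis)
  qed
qed

text \<open>
  The fields are defined globally, but they form a frame only near \<open>p\<close>, where \<open>\<psi>\<close> does not vanish.
\<close>

lemma local_frame:
  obtains I :: "'e set" and E \<psi> where "finite I" "\<And>b. E b \<in> vector_fields A"
    "\<psi> \<in> smooth_functions A" "\<psi> p \<noteq> 0"
    "\<And>q. \<psi> q \<noteq> 0 \<Longrightarrow> tangent_space A q \<subseteq> span ((\<lambda>b. E b q) ` I)"
    "\<And>b. b \<in> I \<Longrightarrow> E b p \<notin> span ((\<lambda>b. E b p) ` (I - {b}))"
proof (cases "m = 0")
  case True
  have "(\<lambda>_. 0) \<in> vector_fields A"
    using True by (simp add: vector_fields_def tangent_space_zero_dimensional smooth_zero_dimensional)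
  then show ?thesis
    using that[of "{}" "\<lambda>_ _. 0" "\<lambda>_. 1"] smooth_const
    by (simp add: tangent_space_zero_dimensional[OF True])
next
  case False
  have "p \<in> (\<Union>(U, c)\<in>A. U)" using charts_cover by simp
  then obtain U c where c: "(U, c) \<in> A" and p: "p \<in> U" by auto
  obtain B r \<beta> where B: "open B" "convex B" "c p \<in> B" "B \<subseteq> c ` U" "cball (c p) r \<subseteq> B"
    and \<beta>: "smooth_on UNIV \<beta>" "\<beta> (c p) = (1::real)" "\<forall>x. x \<notin> cball (c p) r \<longrightarrow> \<beta> x = 0"
    by (rule chart_bump[OF False c p]) (rule that)
  note op = chart_range_open[OF False c]
  define ext where "ext h q = (if q \<in> U then \<beta> (c q) * h (c q) else 0)" for h q
  have ext_smooth: "ext h \<in> smooth_functions A" if "smooth_on (c ` U) h" for h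
    unfolding ext_def
    by (rule smooth_extend_by_zero[OF False c
          smooth_on_cutoff[OF op op order_trans[OF B(5,4)] \<beta>(1) that \<beta>(3)[rule_format]]
          compact_cball[of "c p" r] order_trans[OF B(5,4)]])
      (use \<beta>(3) in simp_all)
  define \<psi> where "\<psi> = ext (\<lambda>_. 1)"
  define E where "E b q = (if q \<in> U then \<beta> (c q) *\<^sub>R coordinate_vector A U c b q else 0)" for b q
  have \<psi>_U: "q \<in> U \<and> \<beta> (c q) \<noteq> 0" if "\<psi> q \<noteq> 0" for q
    using that by (auto simp: \<psi>_def ext_def split: if_splits)
  show ?thesis
  proof (rule that[of Basis E \<psi>])
    show "E b \<in> vector_fields A" for b
      unfolding vector_fields_def
    proof (intro CollectI conjI allI ballI)
      show "E b q \<in> tangent_space A q" for q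
        using subspace_tangent_space coordinate_vector_tangent[OF False c]
        by (auto simp: E_def intro: subspace_scale subspace_0)
      fix f assume f: "f \<in> smooth_functions A"
      have "smooth_on (c ` U) (\<lambda>x. frechet_derivative (\<lambda>x. f (inv_into U c x)) (at x) b)"
        unfolding smooth_on_def by (intro allI C_k_on_deriv[OF op smoothD[OF f c]])
      from ext_smooth[OF this]
      show "(\<lambda>q. E b q f) \<in> smooth_functions A"
        by (rule back_subst[of "\<lambda>f. f \<in> smooth_functions A"])
          (auto simp: fun_eq_iff ext_def E_def coordinate_vector_def f scaleR_fun_def)
    qed
    show "\<psi> \<in> smooth_functions A"
      unfolding \<psi>_def by (rule ext_smooth) (simp add: smooth_on_def C_k_on_const op)
    show "\<psi> p \<noteq> 0" using p \<beta>(2) by (simp add: \<psi>_def ext_def)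
    show "tangent_space A q \<subseteq> span ((\<lambda>b. E b q) ` Basis)" if "\<psi> q \<noteq> 0" for q
    proof
      fix v assume v: "v \<in> tangent_space A q"
      have q: "q \<in> U" "\<beta> (c q) \<noteq> 0" using \<psi>_U[OF that] by auto
      obtain y where
        "\<forall>v\<in>tangent_space A q. v = (\<Sum>b\<in>Basis. v (y b) *\<^sub>R coordinate_vector A U c b q)"
        by (rule tangent_expansion[OF False c q(1)]) (rule that)
      then have "v = (\<Sum>b\<in>Basis. v (y b) *\<^sub>R coordinate_vector A U c b q)" using v by (rule bspec)
      also have "\<dots> = (\<Sum>b\<in>Basis. (v (y b) / \<beta> (c q)) *\<^sub>R E b q)"
        using q by (simp add: E_def)
      also have "\<dots> \<in> span ((\<lambda>b. E b q) ` Basis)"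
        by (intro span_sum span_scale span_base) auto
      finally show "v \<in> span ((\<lambda>b. E b q) ` Basis)" .
    qed
    show "E b p \<notin> span ((\<lambda>b. E b p) ` (Basis - {b}))" if b: "b \<in> Basis" for b
    proof
      assume "E b p \<in> span ((\<lambda>b. E b p) ` (Basis - {b}))"
      moreover obtain y where "\<forall>b\<in>Basis. \<forall>b'\<in>Basis.
          coordinate_vector A U c b p (y b') = (if b = b' then 1 else 0)"
        by (rule tangent_expansion[OF False c p]) (rule that)
      then have y: "coordinate_vector A U c b p (y b') = (if b = b' then 1 else 0)"
        if "b \<in> Basis" "b' \<in> Basis" for b b'
        using that by blast
      have "subspace {v :: 'a tangent. v (y b) = 0}"
        by (auto simp: subspace_def scaleR_fun_def)
      moreover have "(\<lambda>b. E b p) ` (Basis - {b}) \<subseteq> {v. v (y b) = 0}"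
        using y[OF _ b] p by (auto simp: E_def \<beta>(2))
      ultimately have "E b p (y b) = 0"
        using span_minimal[of "(\<lambda>b. E b p) ` (Basis - {b})" "{v. v (y b) = 0}"] by auto
      then show False using y[OF b b] p by (simp add: E_def \<beta>(2))
    qed
  qed auto
qed

end

section \<open>Vector fields as a module over the smooth functions\<close>

lemma fun_sum_apply: "(\<Sum>i\<in>I. f i) x = (\<Sum>i\<in>I. f i x)"
  by (induction I rule: infinite_finite_induct) auto

lemma fmult_apply: "fmult f X p = f p *\<^sub>R X p"
  by (simp add: fmult_def)

lemma deriv_along_apply: "deriv_along X f p = X p f"
  by (simp add: deriv_along_def)

context smooth_manifold
begin

abbreviation "\<FF> \<equiv> smooth_functions A"
abbreviation "\<XX> \<equiv> vector_fields A"

lemma smooth_ring [simp, intro]: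
  "(\<lambda>_. r) \<in> \<FF>" "0 \<in> \<FF>" "1 \<in> \<FF>"
  "f \<in> \<FF> \<Longrightarrow> h \<in> \<FF> \<Longrightarrow> f + h \<in> \<FF>"
  "f \<in> \<FF> \<Longrightarrow> h \<in> \<FF> \<Longrightarrow> f * h \<in> \<FF>"
  "f \<in> \<FF> \<Longrightarrow> h \<in> \<FF> \<Longrightarrow> f - h \<in> \<FF>"
  "f \<in> \<FF> \<Longrightarrow> - f \<in> \<FF>"
  using smooth_const[of r] smooth_const[of 0] smooth_const[of 1] smooth_add[of f h] smooth_mult[of f h]
    smooth_diff[of f h] smooth_minus[of f]
  by (simp_all add: zero_fun_def one_fun_def plus_fun_def times_fun_def fun_diff_def fun_Compl_def)

lemma vector_field_tangent [simp, intro]: "X \<in> \<XX> \<Longrightarrow> X p \<in> tangent_space A p"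
  by (simp add: vector_fields_def)

lemma deriv_along_smooth [simp, intro]: "X \<in> \<XX> \<Longrightarrow> f \<in> \<FF> \<Longrightarrow> deriv_along X f \<in> \<FF>"
  unfolding vector_fields_def deriv_along_def by blast

lemma deriv_along_nonsmooth: "X \<in> \<XX> \<Longrightarrow> f \<notin> \<FF> \<Longrightarrow> deriv_along X f = 0"
  using tangent_nonsmooth[OF vector_field_tangent] by (auto simp: deriv_along_def zero_fun_def)

lemma deriv_along_function [simp]:
  assumes "X \<in> \<XX>"
  shows "f \<in> \<FF> \<Longrightarrow> h \<in> \<FF> \<Longrightarrow> deriv_along X (f + h) = deriv_along X f + deriv_along X h"
    "f \<in> \<FF> \<Longrightarrow> h \<in> \<FF> \<Longrightarrow> deriv_along X (f - h) = deriv_along X f - deriv_along X h"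
    "f \<in> \<FF> \<Longrightarrow> h \<in> \<FF> \<Longrightarrow> deriv_along X (f * h) = deriv_along X f * h + f * deriv_along X h"
    "f \<in> \<FF> \<Longrightarrow> deriv_along X (- f) = - deriv_along X f"
    "deriv_along X (\<lambda>_. r) = 0"
    "deriv_along X 0 = 0"
  using tangent_add[OF vector_field_tangent[OF assms], of f h]
    tangent_diff[OF vector_field_tangent[OF assms], of f h]
    tangent_mult[OF vector_field_tangent[OF assms], of f h]
    tangent_minus[OF vector_field_tangent[OF assms], of f]
    tangent_const[OF vector_field_tangent[OF assms]]
  by (simp_all add: deriv_along_def fun_eq_iff zero_fun_def one_fun_def plus_fun_def times_fun_def
      fun_diff_def fun_Compl_def)

lemma deriv_along_field [simp]:
  "deriv_along (X + Y) f = deriv_along X f + deriv_along Y f"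
  "deriv_along (X - Y) f = deriv_along X f - deriv_along Y f"
  "deriv_along (- X) f = - deriv_along X f"
  "deriv_along 0 f = 0"
  "deriv_along (fmult h X) f = h * deriv_along X f"
  by (simp_all add: fun_eq_iff deriv_along_def fmult_def scaleR_fun_def)

lemma vector_field_module [simp, intro]:
  "0 \<in> \<XX>"
  "X \<in> \<XX> \<Longrightarrow> Y \<in> \<XX> \<Longrightarrow> X + Y \<in> \<XX>"
  "X \<in> \<XX> \<Longrightarrow> Y \<in> \<XX> \<Longrightarrow> X - Y \<in> \<XX>"
  "X \<in> \<XX> \<Longrightarrow> - X \<in> \<XX>"
  "f \<in> \<FF> \<Longrightarrow> X \<in> \<XX> \<Longrightarrow> fmult f X \<in> \<XX>"
proof -
  have I: "X \<in> \<XX>" if "\<And>p. X p \<in> tangent_space A p" "\<And>f. f \<in> \<FF> \<Longrightarrow> deriv_along X f \<in> \<FF>" for X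
    using that unfolding vector_fields_def deriv_along_def by blast
  note sub = subspace_tangent_space
  show "0 \<in> \<XX>" by (rule I) (auto intro: subspace_0[OF sub])
  show "X \<in> \<XX> \<Longrightarrow> Y \<in> \<XX> \<Longrightarrow> X + Y \<in> \<XX>" by (rule I) (auto intro: subspace_add[OF sub])
  show "X \<in> \<XX> \<Longrightarrow> Y \<in> \<XX> \<Longrightarrow> X - Y \<in> \<XX>" by (rule I) (auto intro: subspace_diff[OF sub])
  show "X \<in> \<XX> \<Longrightarrow> - X \<in> \<XX>" by (rule I) (auto intro: subspace_neg[OF sub])
  show "f \<in> \<FF> \<Longrightarrow> X \<in> \<XX> \<Longrightarrow> fmult f X \<in> \<XX>"
    by (rule I) (auto simp: fmult_apply intro: subspace_scale[OF sub])
qed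

lemma vector_field_sum [simp, intro]:
  "(\<And>i. i \<in> I \<Longrightarrow> X i \<in> \<XX>) \<Longrightarrow> (\<Sum>i\<in>I. X i) \<in> \<XX>"
  by (induction I rule: infinite_finite_induct) auto

lemma lie_bracket_field [simp, intro]:
  assumes "X \<in> \<XX>" "Y \<in> \<XX>"
  shows "lie_bracket X Y \<in> \<XX>"
proof -
  have der: "deriv_along (lie_bracket X Y) f
      = deriv_along X (deriv_along Y f) - deriv_along Y (deriv_along X f)" for f
    by (simp add: lie_bracket_def deriv_along_def fun_eq_iff)
  have "lie_bracket X Y p \<in> tangent_space A p" for p
    unfolding tangent_space_def
  proof (intro CollectI conjI ballI allI impI)
    fix f h assume fh: "f \<in> \<FF>" "h \<in> \<FF>"
    have "deriv_along (lie_bracket X Y) (f + h) p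
        = deriv_along (lie_bracket X Y) f p + deriv_along (lie_bracket X Y) h p"
      using assms fh by (simp add: der)
    then show "lie_bracket X Y p (\<lambda>q. f q + h q) = lie_bracket X Y p f + lie_bracket X Y p h"
      by (simp add: deriv_along_def plus_fun_def)
    have "deriv_along (lie_bracket X Y) (f * h) p
        = deriv_along (lie_bracket X Y) f p * h p + f p * deriv_along (lie_bracket X Y) h p"
      using assms fh by (simp add: der algebra_simps)
    then show "lie_bracket X Y p (\<lambda>q. f q * h q) = lie_bracket X Y p f * h p + f p * lie_bracket X Y p h"
      by (simp add: deriv_along_def times_fun_def)
  next
    fix f r assume f: "f \<in> \<FF>"
    have "deriv_along (lie_bracket X Y) ((\<lambda>_. r) * f) p = r * deriv_along (lie_bracket X Y) f p"
      using assms f by (simp add: der algebra_simps)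
    then show "lie_bracket X Y p (\<lambda>q. r * f q) = r * lie_bracket X Y p f"
      by (simp add: deriv_along_def times_fun_def)
  next
    fix f assume "f \<notin> \<FF>"
    then have "deriv_along (lie_bracket X Y) f p = 0"
      using assms by (simp add: der deriv_along_nonsmooth)
    then show "lie_bracket X Y p f = 0" by (simp add: deriv_along_def)
  qed
  moreover have "deriv_along (lie_bracket X Y) f \<in> \<FF>" if "f \<in> \<FF>" for f
    using assms that by (simp add: der)
  ultimately show ?thesis unfolding vector_fields_def deriv_along_def by blast
qed

lemma lie_bracket_swap: "lie_bracket Y X = - lie_bracket X Y"
  by (simp add: lie_bracket_def fun_eq_iff)

lemma lie_bracket_linear [simp]:
  assumes "X \<in> \<XX>" "Z \<in> \<XX>"
  shows "Y \<in> \<XX> \<Longrightarrow> lie_bracket (X + Y) Z = lie_bracket X Z + lie_bracket Y Z"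
    "Y \<in> \<XX> \<Longrightarrow> lie_bracket Z (X + Y) = lie_bracket Z X + lie_bracket Z Y"
    "lie_bracket (- X) Z = - lie_bracket X Z"
    "lie_bracket Z (- X) = - lie_bracket Z X"
    "f \<in> \<FF> \<Longrightarrow> lie_bracket (fmult f X) Z = fmult f (lie_bracket X Z) - fmult (deriv_along Z f) X"
    "f \<in> \<FF> \<Longrightarrow> lie_bracket Z (fmult f X) = fmult f (lie_bracket Z X) + fmult (deriv_along Z f) X"
proof -
  have at: "Y \<in> \<XX> \<Longrightarrow> Z p (deriv_along (X + Y) f) = Z p (deriv_along X f) + Z p (deriv_along Y f)"
    "Z p (deriv_along (- X) f) = - Z p (deriv_along X f)"
    "h \<in> \<FF> \<Longrightarrow> Z p (deriv_along (fmult h X) f)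
      = Z p h * X p f + h p * Z p (deriv_along X f)" for f h p
  proof -
    consider "f \<in> \<FF>" | "f \<notin> \<FF>" by blast
    then have "(Y \<in> \<XX> \<longrightarrow> deriv_along Z (deriv_along (X + Y) f) p
          = deriv_along Z (deriv_along X f) p + deriv_along Z (deriv_along Y f) p) \<and>
        deriv_along Z (deriv_along (- X) f) p = - deriv_along Z (deriv_along X f) p \<and>
        (h \<in> \<FF> \<longrightarrow> deriv_along Z (deriv_along (fmult h X) f) p
          = deriv_along Z h p * deriv_along X f p + h p * deriv_along Z (deriv_along X f) p)"
      using assms by cases (simp_all add: deriv_along_nonsmooth)
    then show "Y \<in> \<XX> \<Longrightarrow> Z p (deriv_along (X + Y) f) = Z p (deriv_along X f) + Z p (deriv_along Y f)"
      "Z p (deriv_along (- X) f) = - Z p (deriv_along X f)"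
      "h \<in> \<FF> \<Longrightarrow> Z p (deriv_along (fmult h X) f)
        = Z p h * X p f + h p * Z p (deriv_along X f)"
      unfolding deriv_along_apply by blast+
  qed
  show "Y \<in> \<XX> \<Longrightarrow> lie_bracket (X + Y) Z = lie_bracket X Z + lie_bracket Y Z"
    "Y \<in> \<XX> \<Longrightarrow> lie_bracket Z (X + Y) = lie_bracket Z X + lie_bracket Z Y"
    "lie_bracket (- X) Z = - lie_bracket X Z"
    "lie_bracket Z (- X) = - lie_bracket Z X"
    "f \<in> \<FF> \<Longrightarrow> lie_bracket (fmult f X) Z = fmult f (lie_bracket X Z) - fmult (deriv_along Z f) X"
    "f \<in> \<FF> \<Longrightarrow> lie_bracket Z (fmult f X) = fmult f (lie_bracket Z X) + fmult (deriv_along Z f) X"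
    by (simp_all add: lie_bracket_def fun_eq_iff at scaleR_fun_def fmult_apply deriv_along_apply
        algebra_simps del: deriv_along_field)
qed

end

section \<open>Riemannian metrics\<close>

locale riemannian_manifold = smooth_manifold A m
  for A :: "('a::{t2_space, second_countable_topology}, 'e::euclidean_space) chart set" and m +
  fixes g :: "'a metric"
  assumes riemannian: "riemannian_metric A g"
begin

lemma metric_smooth [simp, intro]: "X \<in> \<XX> \<Longrightarrow> Y \<in> \<XX> \<Longrightarrow> metric_app g X Y \<in> \<FF>"
  using riemannian by (simp add: riemannian_metric_def)

lemma metric_linear: "u \<in> tangent_space A p \<Longrightarrow> linear_on (tangent_space A p) (g p u)"
  using riemannian by (simp add: riemannian_metric_def)

lemma metric_sym: "u \<in> tangent_space A p \<Longrightarrow> v \<in> tangent_space A p \<Longrightarrow> g p u v = g p v u"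
  using riemannian by (simp add: riemannian_metric_def)

lemma metric_add_right:
  "u \<in> tangent_space A p \<Longrightarrow> v \<in> tangent_space A p \<Longrightarrow> w \<in> tangent_space A p \<Longrightarrow>
    g p u (v + w) = g p u v + g p u w"
  using metric_linear[of u p] by (simp add: linear_on_def)

lemma metric_scale_right:
  "u \<in> tangent_space A p \<Longrightarrow> v \<in> tangent_space A p \<Longrightarrow> g p u (r *\<^sub>R v) = r * g p u v"
  using metric_linear[of u p] by (simp add: linear_on_def)

lemma metric_pos: "u \<in> tangent_space A p \<Longrightarrow> u \<noteq> 0 \<Longrightarrow> g p u u > 0"
  using riemannian by (simp add: riemannian_metric_def)

lemma metric_zero_right: "u \<in> tangent_space A p \<Longrightarrow> g p u 0 = 0"
  using metric_scale_right[of u p u 0] by simp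

lemma metric_app_swap: "X \<in> \<XX> \<Longrightarrow> Y \<in> \<XX> \<Longrightarrow> metric_app g X Y = metric_app g Y X"
  by (auto simp: metric_app_def intro: metric_sym)

lemma metric_app_right [simp]:
  assumes "X \<in> \<XX>"
  shows "Y \<in> \<XX> \<Longrightarrow> Z \<in> \<XX> \<Longrightarrow> metric_app g X (Y + Z) = metric_app g X Y + metric_app g X Z"
    "Y \<in> \<XX> \<Longrightarrow> metric_app g X (fmult f Y) = f * metric_app g X Y"
    "Y \<in> \<XX> \<Longrightarrow> metric_app g X (- Y) = - metric_app g X Y"
    "Y \<in> \<XX> \<Longrightarrow> Z \<in> \<XX> \<Longrightarrow> metric_app g X (Y - Z) = metric_app g X Y - metric_app g X Z"
    "metric_app g X 0 = 0"
proof -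
  show add: "metric_app g X (Y + Z) = metric_app g X Y + metric_app g X Z"
    if "Y \<in> \<XX>" "Z \<in> \<XX>" for Y Z
    using assms that by (simp add: metric_app_def fun_eq_iff metric_add_right)
  show scale: "metric_app g X (fmult f Y) = f * metric_app g X Y" if "Y \<in> \<XX>" for f Y
    using assms that by (simp add: metric_app_def fun_eq_iff metric_scale_right fmult_apply)
  have neg: "- Y = fmult (\<lambda>_. -1) Y" for Y :: "'a vfield"
    by (simp add: fmult_def fun_eq_iff scaleR_fun_def)
  show minus: "metric_app g X (- Y) = - metric_app g X Y" if "Y \<in> \<XX>" for Y
    unfolding neg scale[OF that] by (simp add: fun_eq_iff)
  show "metric_app g X (Y - Z) = metric_app g X Y - metric_app g X Z"
    if "Y \<in> \<XX>" "Z \<in> \<XX>" for Y Z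
    using add[of Y "- Z"] minus[of Z] that by simp
  show "metric_app g X 0 = 0"
    using assms by (simp add: metric_app_def fun_eq_iff metric_zero_right)
qed

lemma metric_app_left [simp]:
  assumes "X \<in> \<XX>"
  shows "Y \<in> \<XX> \<Longrightarrow> Z \<in> \<XX> \<Longrightarrow> metric_app g (Y + Z) X = metric_app g Y X + metric_app g Z X"
    "Y \<in> \<XX> \<Longrightarrow> f \<in> \<FF> \<Longrightarrow> metric_app g (fmult f Y) X = f * metric_app g Y X"
    "Y \<in> \<XX> \<Longrightarrow> metric_app g (- Y) X = - metric_app g Y X"
    "Y \<in> \<XX> \<Longrightarrow> Z \<in> \<XX> \<Longrightarrow> metric_app g (Y - Z) X = metric_app g Y X - metric_app g Z X"
    "metric_app g 0 X = 0"
  using assms by (simp_all add: metric_app_swap[of _ X])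

lemma metric_app_sum_left:
  assumes "X \<in> \<XX>" "\<And>i. i \<in> I \<Longrightarrow> Y i \<in> \<XX>"
  shows "metric_app g (\<Sum>i\<in>I. Y i) X = (\<Sum>i\<in>I. metric_app g (Y i) X)"
  using assms(2) by (induction I rule: infinite_finite_induct) (use assms(1) in auto)

text \<open>
  Test with \<open>X\<close> itself; no tangent vector has to be extended to a field.
\<close>

lemma metric_nondegenerate_at:
  assumes "X \<in> \<XX>" "\<And>Z. Z \<in> \<XX> \<Longrightarrow> metric_app g X Z p = 0"
  shows "X p = 0"
proof (rule ccontr)
  assume "X p \<noteq> 0"
  then have "g p (X p) (X p) > 0" using metric_pos assms(1) by blast
  then show False using assms(2)[OF assms(1)] by (simp add: metric_app_def)
qed

lemma metric_nondegenerate: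
  assumes "X \<in> \<XX>" "Y \<in> \<XX>" "\<And>Z. Z \<in> \<XX> \<Longrightarrow> metric_app g X Z = metric_app g Y Z"
  shows "X = Y"
proof
  fix p
  have "(X - Y) p = 0"
  proof (rule metric_nondegenerate_at)
    show "X - Y \<in> \<XX>" using assms(1,2) by (rule vector_field_module)
    show "metric_app g (X - Y) Z p = 0" if "Z \<in> \<XX>" for Z
      using assms that by simp
  qed
  then show "X p = Y p" by simp
qed

lemma span_scale_cancel: "c \<noteq> 0 \<Longrightarrow> c *\<^sub>R x \<in> span S \<Longrightarrow> x \<in> span S"
  using span_scale[of "c *\<^sub>R x" S "inverse c"] by simp

text \<open>
  Gram-Schmidt without denominators: multiplying the new vector by the squared lengths of the
  previous ones keeps all fields globally smooth.
\<close>

lemma orthogonal_fields: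
  fixes I :: "'i set"
  assumes "finite I" "\<And>i. i \<in> I \<Longrightarrow> E i \<in> \<XX>"
    and "\<And>i. i \<in> I \<Longrightarrow> E i p \<notin> span ((\<lambda>i. E i p) ` (I - {i}))"
  shows "\<exists>B. (\<forall>i\<in>I. B i \<in> \<XX> \<and> B i p \<noteq> 0 \<and> B i p \<in> span ((\<lambda>i. E i p) ` I)) \<and>
    (\<forall>i\<in>I. \<forall>j\<in>I. i \<noteq> j \<longrightarrow> metric_app g (B i) (B j) = 0) \<and>
    (\<forall>q. (\<forall>i\<in>I. B i q \<noteq> 0) \<longrightarrow> (\<forall>i\<in>I. E i q \<in> span ((\<lambda>i. B i q) ` I)))"
  using assms
proof (induction I rule: finite_induct)
  case empty
  then show ?case by simp
next
  case (insert k I)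
  have "E i p \<notin> span ((\<lambda>i. E i p) ` (I - {i}))" if "i \<in> I" for i
    using insert.prems(2)[of i] that span_mono[of "(\<lambda>i. E i p) ` (I - {i})" "(\<lambda>i. E i p) ` (insert k I - {i})"]
    by blast
  then have "\<exists>B. (\<forall>i\<in>I. B i \<in> \<XX> \<and> B i p \<noteq> 0 \<and> B i p \<in> span ((\<lambda>i. E i p) ` I)) \<and>
    (\<forall>i\<in>I. \<forall>j\<in>I. i \<noteq> j \<longrightarrow> metric_app g (B i) (B j) = 0) \<and>
    (\<forall>q. (\<forall>i\<in>I. B i q \<noteq> 0) \<longrightarrow> (\<forall>i\<in>I. E i q \<in> span ((\<lambda>i. B i q) ` I)))"
    using insert.prems(1) by (intro insert.IH) blast+
  then obtain B where *: "\<forall>i\<in>I. B i \<in> \<XX> \<and> B i p \<noteq> 0 \<and> B i p \<in> span ((\<lambda>i. E i p) ` I)"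
      "\<forall>i\<in>I. \<forall>j\<in>I. i \<noteq> j \<longrightarrow> metric_app g (B i) (B j) = 0"
      "\<forall>q. (\<forall>i\<in>I. B i q \<noteq> 0) \<longrightarrow> (\<forall>i\<in>I. E i q \<in> span ((\<lambda>i. B i q) ` I))"
    by blast
  have B: "B i \<in> \<XX>" "B i p \<noteq> 0" "B i p \<in> span ((\<lambda>i. E i p) ` I)" if "i \<in> I" for i
    using *(1) that by blast+
  have orth: "metric_app g (B i) (B j) = 0" if "i \<in> I" "j \<in> I" "i \<noteq> j" for i j
    using *(2) that by blast
  have span: "E i q \<in> span ((\<lambda>i. B i q) ` I)" if "\<forall>i\<in>I. B i q \<noteq> 0" "i \<in> I" for q i
    using *(3) that by blast
  have E: "E k \<in> \<XX>" using insert.prems by blast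
  define N where "N i = metric_app g (B i) (B i)" for i
  have N: "N i \<in> \<FF>" if "i \<in> I" for i using B(1)[OF that] by (simp add: N_def)
  have N_pos: "N i q > 0" if "i \<in> I" "B i q \<noteq> 0" for i q
    using that B(1) metric_pos[of "B i q" q] by (auto simp: N_def metric_app_def)
  define P where "P = (\<lambda>q. \<Prod>j\<in>I. N j q)"
  define a where "a i = (\<lambda>q. (\<Prod>j\<in>I - {i}. N j q)) * metric_app g (E k) (B i)" for i
  have P: "P \<in> \<FF>" unfolding P_def by (rule smooth_prod[OF N])
  have a: "a i \<in> \<FF>" if "i \<in> I" for i
    unfolding a_def using N B(1)[OF that] E by (auto intro: smooth_prod)
  define W where "W = fmult P (E k) - (\<Sum>i\<in>I. fmult (a i) (B i))"
  have sum_field: "(\<Sum>i\<in>I. fmult (a i) (B i)) \<in> \<XX>" using a B(1) by auto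
  have W: "W \<in> \<XX>" unfolding W_def using P E sum_field by auto
  have W_orth: "metric_app g W (B j) = 0" if j: "j \<in> I" for j
  proof -
    have "metric_app g (\<Sum>i\<in>I. fmult (a i) (B i)) (B j) = (\<Sum>i\<in>I. metric_app g (fmult (a i) (B i)) (B j))"
      by (rule metric_app_sum_left) (use a B(1) j in auto)
    also have "\<dots> = (\<Sum>i\<in>I. if i = j then a j * N j else 0)"
      by (rule sum.cong) (use a B(1) j orth in \<open>auto simp: N_def\<close>)
    also have "\<dots> = a j * N j" using j insert.hyps(1) by simp
    also have "\<dots> = P * metric_app g (E k) (B j)"
      using prod.remove[OF insert.hyps(1) j, of "\<lambda>i. N i q" for q]
      by (simp add: a_def P_def fun_eq_iff mult_ac)
    finally show ?thesis
      unfolding W_def using P E B(1)[OF j] sum_field by simp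
  qed
  have W_at: "W q = P q *\<^sub>R E k q - (\<Sum>i\<in>I. a i q *\<^sub>R B i q)" for q
    by (simp add: W_def fun_sum_apply fmult_apply)
  have sum_span: "(\<Sum>i\<in>I. a i p *\<^sub>R B i p) \<in> span ((\<lambda>i. E i p) ` I)"
    by (intro span_sum span_scale B(3))
  have P_pos: "P q > 0" if "\<forall>i\<in>I. B i q \<noteq> 0" for q
    unfolding P_def by (rule prod_pos) (use that N_pos in auto)
  have W_p: "W p \<noteq> 0"
  proof
    assume "W p = 0"
    then have "P p *\<^sub>R E k p \<in> span ((\<lambda>i. E i p) ` I)" using sum_span W_at[of p] by simp
    moreover have "P p \<noteq> 0" using P_pos[of p] B(2) by auto
    ultimately have "E k p \<in> span ((\<lambda>i. E i p) ` I)" by (rule span_scale_cancel[rotated])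
    then show False using insert.prems(2)[of k] insert.hyps(2) by simp
  qed
  let ?B = "\<lambda>i. if i = k then W else B i"
  have same: "?B i = B i" if "i \<in> I" for i using that insert.hyps(2) by auto
  show ?case
  proof (intro exI[of _ ?B] conjI ballI allI impI)
    fix i assume "i \<in> insert k I"
    then show "?B i \<in> \<XX>" "?B i p \<noteq> 0" using W W_p B(1,2) by auto
    have "B j p \<in> span ((\<lambda>i. E i p) ` insert k I)" if "j \<in> I" for j
      using B(3)[OF that] span_mono[of "(\<lambda>i. E i p) ` I" "(\<lambda>i. E i p) ` insert k I"] by auto
    moreover have "W p \<in> span ((\<lambda>i. E i p) ` insert k I)"
      unfolding W_at using sum_span span_mono[of "(\<lambda>i. E i p) ` I" "(\<lambda>i. E i p) ` insert k I"]
      by (intro span_diff span_scale) (auto intro: span_base)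
    ultimately show "?B i p \<in> span ((\<lambda>i. E i p) ` insert k I)"
      using \<open>i \<in> insert k I\<close> by auto
  next
    fix i j assume "i \<in> insert k I" "j \<in> insert k I" "i \<noteq> j"
    moreover have "metric_app g (B j) W = 0" if "j \<in> I" for j
      using W_orth[OF that] metric_app_swap[OF W B(1)[OF that]] by simp
    ultimately show "metric_app g (?B i) (?B j) = 0"
      using W_orth orth by (cases "i = k"; cases "j = k") simp_all
  next
    fix q i assume nz: "\<forall>i\<in>insert k I. ?B i q \<noteq> 0" and i: "i \<in> insert k I"
    then have nz': "\<forall>i\<in>I. B i q \<noteq> 0" using same by (metis insertCI)
    have sub: "span ((\<lambda>i. B i q) ` I) \<subseteq> span ((\<lambda>i. ?B i q) ` insert k I)"
      by (rule span_mono) (use same in force)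
    have "(\<Sum>i\<in>I. a i q *\<^sub>R B i q) \<in> span ((\<lambda>i. B i q) ` I)"
      by (intro span_sum span_scale span_base) auto
    moreover have "W q \<in> span ((\<lambda>i. ?B i q) ` insert k I)"
      by (rule span_base) auto
    ultimately have "W q + (\<Sum>i\<in>I. a i q *\<^sub>R B i q) \<in> span ((\<lambda>i. ?B i q) ` insert k I)"
      using sub by (intro span_add) auto
    then have scaled: "P q *\<^sub>R E k q \<in> span ((\<lambda>i. ?B i q) ` insert k I)" by (simp add: W_at)
    have "P q \<noteq> 0" using P_pos[OF nz'] by simp
    then have "E k q \<in> span ((\<lambda>i. ?B i q) ` insert k I)"
      using scaled by (rule span_scale_cancel)
    moreover have "E j q \<in> span ((\<lambda>i. ?B i q) ` insert k I)" if "j \<in> I" for j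
      using span[OF nz' that] sub by blast
    ultimately show "E i q \<in> span ((\<lambda>i. ?B i q) ` insert k I)"
      using i by blast
  qed
qed

text \<open>
  Where all \<open>B i\<close> are nonzero they span the tangent space, and the identity is the orthogonal
  expansion of \<open>Z\<close>, multiplied by the product of the squared lengths and by the function \<open>\<psi>\<close> that
  vanishes outside the domain of the local frame.  Everywhere else both sides vanish: the
  summand of an index \<open>i\<close> contains the squared lengths of all other \<open>B j\<close>, and \<open>B i\<close> itself.
\<close>

lemma orthogonal_expansion:
  obtains J :: "'e set" and B w \<rho> where "finite J" "\<forall>i\<in>J. B i \<in> \<XX>" "\<forall>i\<in>J. w i \<in> \<FF>"
    "\<rho> \<in> \<FF>" "\<rho> p \<noteq> 0"
    "\<forall>Z\<in>\<XX>. fmult \<rho> Z = (\<Sum>i\<in>J. fmult (w i * metric_app g Z (B i)) (B i))"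
proof -
  obtain I :: "'e set" and E \<psi> where I: "finite I" and E: "\<And>b. E b \<in> \<XX>"
    and \<psi>: "\<psi> \<in> \<FF>" "\<psi> p \<noteq> 0"
    and spans: "\<And>q. \<psi> q \<noteq> 0 \<Longrightarrow> tangent_space A q \<subseteq> span ((\<lambda>b. E b q) ` I)"
    and indep: "\<And>b. b \<in> I \<Longrightarrow> E b p \<notin> span ((\<lambda>b. E b p) ` (I - {b}))"
    using local_frame[of p] by blast
  obtain B where B: "\<forall>i\<in>I. B i \<in> \<XX>" "\<forall>i\<in>I. B i p \<noteq> 0"
    and orth: "\<And>i j. i \<in> I \<Longrightarrow> j \<in> I \<Longrightarrow> i \<noteq> j \<Longrightarrow> metric_app g (B i) (B j) = 0"
    and span: "\<And>q i. \<forall>i\<in>I. B i q \<noteq> 0 \<Longrightarrow> i \<in> I \<Longrightarrow> E i q \<in> span ((\<lambda>i. B i q) ` I)"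
    using orthogonal_fields[OF I E indep] by blast
  define N where "N i = metric_app g (B i) (B i)" for i
  have N: "N i \<in> \<FF>" if "i \<in> I" for i using B(1) that by (simp add: N_def)
  have N_pos: "N i q > 0" if "i \<in> I" "B i q \<noteq> 0" for i q
    using that B(1) metric_pos[of "B i q" q] by (auto simp: N_def metric_app_def)
  have N_zero: "N i q = 0" if "i \<in> I" "B i q = 0" for i q
    using that B(1) metric_zero_right[of "B i q" q] vector_field_tangent[of "B i" q]
    by (auto simp: N_def metric_app_def)
  define w where "w i = \<psi> * (\<lambda>q. \<Prod>j\<in>I - {i}. N j q)" for i
  define \<rho> where "\<rho> = \<psi> * (\<lambda>q. \<Prod>j\<in>I. N j q)"
  have w_N: "\<rho> q = w i q * N i q" if "i \<in> I" for i q
    using prod.remove[OF I that, of "\<lambda>i. N i q"] by (simp add: \<rho>_def w_def mult_ac)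
  show thesis
  proof (rule that[of I B w \<rho>])
    show "\<forall>i\<in>I. w i \<in> \<FF>" using \<psi>(1) N by (auto simp: w_def intro: smooth_prod)
    show "\<rho> \<in> \<FF>" using \<psi>(1) N by (auto simp: \<rho>_def intro: smooth_prod)
    have "(\<Prod>j\<in>I. N j p) > 0" by (rule prod_pos) (use N_pos B(2) in auto)
    then show "\<rho> p \<noteq> 0" using \<psi>(2) by (simp add: \<rho>_def)
    show "\<forall>Z\<in>\<XX>. fmult \<rho> Z = (\<Sum>i\<in>I. fmult (w i * metric_app g Z (B i)) (B i))"
    proof (rule ballI, rule ext)
      fix Z q assume Z: "Z \<in> \<XX>"
      have "\<rho> q *\<^sub>R Z q = (\<Sum>i\<in>I. (w i q * metric_app g Z (B i) q) *\<^sub>R B i q)"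
      proof (cases "\<psi> q = 0")
        case True
        then show ?thesis by (simp add: \<rho>_def w_def)
      next
        case False
        show ?thesis
        proof (cases "\<forall>i\<in>I. B i q \<noteq> 0")
          case True
          have N_nz: "N i q \<noteq> 0" if "i \<in> I" for i using N_pos[OF that] True that by fastforce
          define t where "t i = metric_app g Z (B i) q / N i q" for i
          define V where "V = Z - (\<Sum>i\<in>I. fmult (\<lambda>_. t i) (B i))"
          have sum_field: "(\<Sum>i\<in>I. fmult (\<lambda>_. t i) (B i)) \<in> \<XX>" using B(1) by auto
          have V: "V \<in> \<XX>" using Z sum_field by (auto simp: V_def)
          have V_at: "V q = Z q - (\<Sum>i\<in>I. t i *\<^sub>R B i q)"
            by (simp add: V_def fun_sum_apply fmult_apply)
          have V_orth: "metric_app g V (B j) q = 0" if j: "j \<in> I" for j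
          proof -
            have "metric_app g (\<Sum>i\<in>I. fmult (\<lambda>_. t i) (B i)) (B j)
                = (\<Sum>i\<in>I. metric_app g (fmult (\<lambda>_. t i) (B i)) (B j))"
              by (rule metric_app_sum_left) (use B(1) j in auto)
            also have "\<dots> = (\<Sum>i\<in>I. if i = j then (\<lambda>_. t j) * N j else 0)"
              by (rule sum.cong) (use B(1) j orth in \<open>auto simp: N_def\<close>)
            also have "\<dots> = (\<lambda>_. t j) * N j" using j I by simp
            finally show ?thesis
              unfolding V_def using Z B(1) j sum_field N_nz[OF j] by (simp add: t_def)
          qed
          have "Z q \<in> span ((\<lambda>b. E b q) ` I)" using spans[OF False] Z by blast
          moreover have "span ((\<lambda>b. E b q) ` I) \<subseteq> span ((\<lambda>i. B i q) ` I)"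
            by (rule span_minimal) (use span[OF True] in auto)
          ultimately have "V q \<in> span ((\<lambda>i. B i q) ` I)"
            unfolding V_at by (intro span_diff span_sum span_scale) (auto intro: span_base)
          moreover have "subspace {u \<in> tangent_space A q. g q (V q) u = 0}"
            using V subspace_tangent_space[of q]
            by (auto simp: subspace_def metric_zero_right metric_add_right metric_scale_right)
          moreover have "(\<lambda>i. B i q) ` I \<subseteq> {u \<in> tangent_space A q. g q (V q) u = 0}"
            using V_orth B(1) by (auto simp: metric_app_def)
          ultimately have "g q (V q) (V q) = 0"
            using span_minimal[of "(\<lambda>i. B i q) ` I"] by blast
          then have "V q = 0" using metric_pos[of "V q" q] V by force
          then have "Z q = (\<Sum>i\<in>I. t i *\<^sub>R B i q)" using V_at by simp
          then have "\<rho> q *\<^sub>R Z q = (\<Sum>i\<in>I. (\<rho> q * t i) *\<^sub>R B i q)"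
            by (simp add: scaleR_right.sum)
          also have "\<dots> = (\<Sum>i\<in>I. (w i q * metric_app g Z (B i) q) *\<^sub>R B i q)"
            by (rule sum.cong) (use w_N N_nz in \<open>auto simp: t_def\<close>)
          finally show ?thesis .
        next
          case False
          then obtain i where i: "i \<in> I" "B i q = 0" by blast
          have "w j q *\<^sub>R B j q = 0" if j: "j \<in> I" for j
          proof (cases "j = i")
            case False
            then have "(\<Prod>l\<in>I - {j}. N l q) = 0"
              using I i N_zero[OF i] by (intro prod_zero) auto
            then show ?thesis by (simp add: w_def)
          qed (use i in simp)
          then have "(\<Sum>j\<in>I. (w j q * metric_app g Z (B j) q) *\<^sub>R B j q) = 0"
            by (intro sum.neutral) auto
          moreover have "\<rho> q = 0" using w_N[OF i(1), of q] N_zero[OF i] by simp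
          ultimately show ?thesis by simp
        qed
      qed
      then show "fmult \<rho> Z q = (\<Sum>i\<in>I. fmult (w i * metric_app g Z (B i)) (B i)) q"
        by (simp add: fun_sum_apply fmult_apply)
    qed
  qed (use I B in auto)
qed

text \<open>
  Applying \<open>\<alpha>\<close> to the expansion of \<open>\<rho> Z\<close> gives, for each \<open>p\<close>, a global field \<open>W' p\<close> with
  \<open>g (W' p) Z = \<rho> p * \<alpha> Z\<close>.  Since a tangent vector is determined by its products with vector
  fields, the value of \<open>W\<close> at \<open>p\<close> can be taken from \<open>W' p\<close>, and \<open>W\<close> is the quotient of \<open>W' p\<close> by
  \<open>\<rho> p\<close> in a neighbourhood of \<open>p\<close>, hence smooth.
\<close>

lemma musical_isomorphism:
  assumes smooth: "\<And>Z. Z \<in> \<XX> \<Longrightarrow> \<alpha> Z \<in> \<FF>"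
    and add: "\<And>Y Z. Y \<in> \<XX> \<Longrightarrow> Z \<in> \<XX> \<Longrightarrow> \<alpha> (Y + Z) = \<alpha> Y + \<alpha> Z"
    and mult: "\<And>f Z. f \<in> \<FF> \<Longrightarrow> Z \<in> \<XX> \<Longrightarrow> \<alpha> (fmult f Z) = f * \<alpha> Z"
  shows "\<exists>W\<in>\<XX>. \<forall>Z\<in>\<XX>. metric_app g W Z = \<alpha> Z"
proof -
  have zero: "\<alpha> 0 = 0"
  proof -
    have "fmult 0 0 = (0 :: 'a vfield)" by (simp add: fmult_def fun_eq_iff)
    then show ?thesis using mult[of 0 0] by simp
  qed
  have sum: "\<alpha> (\<Sum>i\<in>I. Y i) = (\<Sum>i\<in>I. \<alpha> (Y i))" if "\<forall>i\<in>I. Y i \<in> \<XX>" for I :: "'e set" and Y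
    using that
  proof (induction I rule: infinite_finite_induct)
    case (insert i I)
    then have "\<alpha> (Y i + sum Y I) = \<alpha> (Y i) + (\<Sum>i\<in>I. \<alpha> (Y i))"
      using add[of "Y i" "sum Y I"] by auto
    then show ?case by (simp only: sum.insert[OF insert.hyps])
  qed (simp_all add: zero)
  have "\<exists>\<rho> W. \<rho> \<in> \<FF> \<and> \<rho> p \<noteq> 0 \<and> W \<in> \<XX> \<and> (\<forall>Z\<in>\<XX>. metric_app g W Z = \<rho> * \<alpha> Z)" for p
  proof -
    obtain J :: "'e set" and B w \<rho> where J: "finite J" "\<forall>i\<in>J. B i \<in> \<XX>" "\<forall>i\<in>J. w i \<in> \<FF>"
      and \<rho>: "\<rho> \<in> \<FF>" "\<rho> p \<noteq> 0"
      and expand: "\<forall>Z\<in>\<XX>. fmult \<rho> Z = (\<Sum>i\<in>J. fmult (w i * metric_app g Z (B i)) (B i))"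
      by (rule orthogonal_expansion) (rule that)
    define W where "W = (\<Sum>i\<in>J. fmult (w i * \<alpha> (B i)) (B i))"
    have "metric_app g W Z = \<rho> * \<alpha> Z" if Z: "Z \<in> \<XX>" for Z
    proof -
      have "metric_app g W Z = (\<Sum>i\<in>J. metric_app g (fmult (w i * \<alpha> (B i)) (B i)) Z)"
        unfolding W_def by (rule metric_app_sum_left) (use J Z smooth in auto)
      also have "\<dots> = (\<Sum>i\<in>J. \<alpha> (fmult (w i * metric_app g Z (B i)) (B i)))"
        by (rule sum.cong) (use J Z smooth mult metric_app_swap[OF _ Z] in \<open>auto simp: mult_ac\<close>)
      also have "\<dots> = \<alpha> (fmult \<rho> Z)"
        using expand Z J by (simp add: sum)
      also have "\<dots> = \<rho> * \<alpha> Z" by (rule mult[OF \<rho>(1) Z])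
      finally show ?thesis .
    qed
    moreover have "W \<in> \<XX>" unfolding W_def using J smooth by auto
    ultimately show ?thesis using \<rho> by blast
  qed
  then obtain \<rho> W' where \<rho>: "\<And>p. \<rho> p \<in> \<FF>" "\<And>p. \<rho> p p \<noteq> 0" and W': "\<And>p. W' p \<in> \<XX>"
    "\<And>p Z. Z \<in> \<XX> \<Longrightarrow> metric_app g (W' p) Z = \<rho> p * \<alpha> Z"
    by metis
  define W where "W p = inverse (\<rho> p p) *\<^sub>R W' p p" for p
  have local_W: "\<rho> p q *\<^sub>R W q = W' p q" for p q
  proof -
    define V where "V = fmult (\<lambda>_. \<rho> p q * inverse (\<rho> q q)) (W' q) - W' p"
    have "V q = 0"
    proof (rule metric_nondegenerate_at)
      show "V \<in> \<XX>" using W'(1) by (simp add: V_def)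
      show "metric_app g V Z q = 0" if "Z \<in> \<XX>" for Z
        using that W' \<rho>(2)[of q] by (simp add: V_def)
    qed
    then show ?thesis by (simp add: V_def W_def fmult_apply)
  qed
  have "W \<in> \<XX>"
    unfolding vector_fields_def
  proof (intro CollectI conjI allI ballI)
    show "W p \<in> tangent_space A p" for p
      using W'(1) by (auto simp: W_def intro: subspace_scale[OF subspace_tangent_space])
    fix f assume f: "f \<in> \<FF>"
    show "(\<lambda>p. W p f) \<in> \<FF>"
    proof (rule smooth_local)
      fix p
      have "(\<lambda>q. \<rho> p q * W q f) = deriv_along (W' p) f"
        using local_W[of p] by (simp add: deriv_along_def scaleR_fun_def flip: local_W)
      then show "\<exists>\<rho>\<in>\<FF>. \<rho> p \<noteq> 0 \<and> (\<lambda>q. \<rho> q * W q f) \<in> \<FF>"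
        using \<rho> W'(1) f by (intro bexI[of _ "\<rho> p"]) auto
    qed
  qed
  moreover have "metric_app g W Z = \<alpha> Z" if Z: "Z \<in> \<XX>" for Z
  proof
    fix p
    have "metric_app g (fmult (\<lambda>_. inverse (\<rho> p p)) (W' p)) Z p = \<alpha> Z p"
      using W' \<rho>(2)[of p] Z by simp
    then show "metric_app g W Z p = \<alpha> Z p"
      by (simp add: metric_app_def W_def fmult_apply)
  qed
  ultimately show ?thesis by blast
qed

end

section \<open>Metric connections with skew torsion\<close>

context smooth_manifold
begin

definition tensorial :: "('a vfield \<Rightarrow> 'a \<Rightarrow> real) \<Rightarrow> bool" where
  "tensorial L \<longleftrightarrow> (\<forall>X\<in>\<XX>. \<forall>Y\<in>\<XX>. L (X + Y) = L X + L Y) \<and>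
     (\<forall>f\<in>\<FF>. \<forall>X\<in>\<XX>. L (fmult f X) = f * L X)"

lemma tensorialD:
  assumes "tensorial L"
  shows "X \<in> \<XX> \<Longrightarrow> Y \<in> \<XX> \<Longrightarrow> L (X + Y) = L X + L Y"
    "f \<in> \<FF> \<Longrightarrow> X \<in> \<XX> \<Longrightarrow> L (fmult f X) = f * L X"
    "L 0 = 0"
    "X \<in> \<XX> \<Longrightarrow> L (- X) = - L X"
proof -
  show add: "L (X + Y) = L X + L Y" if "X \<in> \<XX>" "Y \<in> \<XX>" for X Y
    using assms that by (simp add: tensorial_def)
  show "L (fmult f X) = f * L X" if "f \<in> \<FF>" "X \<in> \<XX>" for f X
    using assms that by (simp add: tensorial_def)
  show zero: "L 0 = 0"
    using add[of 0 0] by simp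
  show "L (- X) = - L X" if "X \<in> \<XX>" for X
    using add[of X "- X"] that zero by (simp add: eq_neg_iff_add_eq_0 add.commute)
qed

lemma tensorial_sum:
  assumes "tensorial L" "\<And>i. i \<in> I \<Longrightarrow> X i \<in> \<XX>"
  shows "L (\<Sum>i\<in>I. X i) = (\<Sum>i\<in>I. L (X i))"
  using assms(2)
proof (induction I rule: infinite_finite_induct)
  case (insert i I)
  then have "L (X i + sum X I) = L (X i) + (\<Sum>i\<in>I. L (X i))"
    using tensorialD(1)[OF assms(1), of "X i" "sum X I"] by auto
  then show ?case by (simp only: sum.insert[OF insert.hyps])
qed (simp_all add: tensorialD(3)[OF assms(1)])

text \<open>
  The two transpositions generate the symmetric group, so that linearity in the first argument
  is enough.
\<close>

lemma three_formI:
  assumes "\<And>X Y Z. X \<in> \<XX> \<Longrightarrow> Y \<in> \<XX> \<Longrightarrow> Z \<in> \<XX> \<Longrightarrow> T X Y Z \<in> \<FF>"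
    and "\<And>X Y Z. X \<in> \<XX> \<Longrightarrow> Y \<in> \<XX> \<Longrightarrow> Z \<in> \<XX> \<Longrightarrow> T Y X Z = - T X Y Z"
    and "\<And>X Y Z. X \<in> \<XX> \<Longrightarrow> Y \<in> \<XX> \<Longrightarrow> Z \<in> \<XX> \<Longrightarrow> T X Z Y = - T X Y Z"
    and "\<And>Y Z. Y \<in> \<XX> \<Longrightarrow> Z \<in> \<XX> \<Longrightarrow> tensorial (\<lambda>X. T X Y Z)"
  shows "three_form A T"
  unfolding three_form_def
proof (intro ballI conjI)
  fix X Y Z assume F: "X \<in> \<XX>" "Y \<in> \<XX>" "Z \<in> \<XX>"
  show "T X Y Z \<in> \<FF>" "T Y X Z = - T X Y Z" "T X Z Y = - T X Y Z"
    by (rule assms(1,2,3)[OF F])+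
  show "T (X + W) Y Z = T X Y Z + T W Y Z" if "W \<in> \<XX>" for W
    by (rule tensorialD(1)[OF assms(4)[OF F(2,3)] F(1) that])
  show "T (fmult f X) Y Z = f * T X Y Z" if "f \<in> \<FF>" for f
    by (rule tensorialD(2)[OF assms(4)[OF F(2,3)] that F(1)])
qed

lemma three_formD:
  assumes "three_form A T" "X \<in> \<XX>" "Y \<in> \<XX>" "Z \<in> \<XX>"
  shows "T X Y Z \<in> \<FF>" "T Y X Z = - T X Y Z" "T X Z Y = - T X Y Z"
  using assms unfolding three_form_def by blast+

lemma three_form_tensorial:
  assumes T: "three_form A T" and "Y \<in> \<XX>" "Z \<in> \<XX>"
  shows "tensorial (\<lambda>X. T X Y Z)" "tensorial (\<lambda>X. T Y X Z)" "tensorial (\<lambda>X. T Y Z X)"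
proof -
  show *: "tensorial (\<lambda>X. T X Y Z)"
    using assms unfolding tensorial_def three_form_def by blast
  have 2: "T Y X Z = - T X Y Z" if "X \<in> \<XX>" for X
    by (rule three_formD(2)[OF T that assms(2,3)])
  have 3: "T Y Z X = T X Y Z" if "X \<in> \<XX>" for X
    using three_formD(3)[OF T assms(2) that assms(3)] 2[OF that] by simp
  show "tensorial (\<lambda>X. T Y X Z)"
    unfolding tensorial_def
    by (intro conjI ballI) (simp_all add: 2 tensorialD(1,2)[OF *])
  show "tensorial (\<lambda>X. T Y Z X)"
    unfolding tensorial_def
    by (intro conjI ballI) (simp_all add: 3 tensorialD(1,2)[OF *])
qed

lemma three_form_cong:
  assumes T: "three_form A T"
    and eq: "\<And>X Y Z. X \<in> \<XX> \<Longrightarrow> Y \<in> \<XX> \<Longrightarrow> Z \<in> \<XX> \<Longrightarrow> T' X Y Z = T X Y Z"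
  shows "three_form A T'"
proof (rule three_formI)
  fix Y Z assume "Y \<in> \<XX>" "Z \<in> \<XX>"
  then show "tensorial (\<lambda>X. T' X Y Z)"
    using three_form_tensorial(1)[OF T, of Y Z] by (simp add: tensorial_def eq)
next
  fix X Y Z assume F: "X \<in> \<XX>" "Y \<in> \<XX>" "Z \<in> \<XX>"
  show "T' X Y Z \<in> \<FF>" using three_formD(1)[OF T F] by (simp add: eq F)
  show "T' Y X Z = - T' X Y Z" using three_formD(2)[OF T F] by (simp only: eq F)
  show "T' X Z Y = - T' X Y Z" using three_formD(3)[OF T F] by (simp only: eq F)
qed

lemma three_form_zero: "three_form A 0"
  by (simp add: three_form_def)

lemma three_form_add:
  assumes S: "three_form A S" and T: "three_form A T"
  shows "three_form A (S + T)"
proof (rule three_formI)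
  fix Y Z assume "Y \<in> \<XX>" "Z \<in> \<XX>"
  then show "tensorial (\<lambda>X. (S + T) X Y Z)"
    using three_form_tensorial(1)[OF S, of Y Z] three_form_tensorial(1)[OF T, of Y Z]
    by (simp add: tensorial_def algebra_simps)
next
  fix X Y Z assume F: "X \<in> \<XX>" "Y \<in> \<XX>" "Z \<in> \<XX>"
  show "(S + T) X Y Z \<in> \<FF>" using three_formD(1)[OF S F] three_formD(1)[OF T F] by simp
  show "(S + T) Y X Z = - (S + T) X Y Z"
    by (simp add: three_formD(2)[OF S F] three_formD(2)[OF T F])
  show "(S + T) X Z Y = - (S + T) X Y Z"
    by (simp add: three_formD(3)[OF S F] three_formD(3)[OF T F])
qed

lemma three_form_uminus:
  assumes T: "three_form A T"
  shows "three_form A (- T)"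
proof (rule three_formI)
  fix Y Z assume "Y \<in> \<XX>" "Z \<in> \<XX>"
  then show "tensorial (\<lambda>X. (- T) X Y Z)"
    using three_form_tensorial(1)[OF T, of Y Z] by (simp add: tensorial_def)
next
  fix X Y Z assume F: "X \<in> \<XX>" "Y \<in> \<XX>" "Z \<in> \<XX>"
  show "(- T) X Y Z \<in> \<FF>" using three_formD(1)[OF T F] by simp
  show "(- T) Y X Z = - (- T) X Y Z"
    unfolding uminus_apply three_formD(2)[OF T F] by simp
  show "(- T) X Z Y = - (- T) X Y Z"
    unfolding uminus_apply three_formD(3)[OF T F] by simp
qed

lemma three_form_sum:
  assumes "\<And>i. i \<in> I \<Longrightarrow> three_form A (T i)"
  shows "three_form A (\<Sum>i\<in>I. T i)"
  using assms
proof (induction I rule: infinite_finite_induct)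
  case (insert i I)
  then show ?case
    unfolding sum.insert[OF insert.hyps] by (intro three_form_add) auto
qed (simp_all add: three_form_zero)

lemma affine_connectionD:
  assumes "affine_connection A D" "X \<in> \<XX>" "Y \<in> \<XX>"
  shows "D X Y \<in> \<XX>"
    "Z \<in> \<XX> \<Longrightarrow> D (X + Z) Y = D X Y + D Z Y"
    "Z \<in> \<XX> \<Longrightarrow> D X (Y + Z) = D X Y + D X Z"
    "f \<in> \<FF> \<Longrightarrow> D (fmult f X) Y = fmult f (D X Y)"
    "f \<in> \<FF> \<Longrightarrow> D X (fmult f Y) = fmult (deriv_along X f) Y + fmult f (D X Y)"
  using assms by (simp_all add: affine_connection_def)

lemma torsion_field:
  "affine_connection A D \<Longrightarrow> X \<in> \<XX> \<Longrightarrow> Y \<in> \<XX> \<Longrightarrow> torsion D X Y \<in> \<XX>"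
  by (simp add: torsion_def affine_connectionD(1))

end

definition koszul :: "'a metric \<Rightarrow> 'a form3" where
  "koszul g X Y Z = deriv_along X (metric_app g Y Z) + deriv_along Y (metric_app g X Z)
     - deriv_along Z (metric_app g X Y) + metric_app g (lie_bracket X Y) Z
     - metric_app g (lie_bracket X Z) Y - metric_app g (lie_bracket Y Z) X"

context riemannian_manifold
begin

lemma metric_connection_derivative:
  assumes "metric_connection A g D" "X \<in> \<XX>" "Y \<in> \<XX>" "Z \<in> \<XX>"
  shows "deriv_along X (metric_app g Y Z) = metric_app g (D X Y) Z + metric_app g Y (D X Z)"
proof -
  have "cov_deriv_metric D g X Y Z = 0"
    using assms by (simp add: metric_connection_def)
  then show ?thesis by (simp add: cov_deriv_metric_def diff_diff_eq)
qed

lemma bracket_via_connection: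
  assumes "affine_connection A D" "X \<in> \<XX>" "Y \<in> \<XX>" "Z \<in> \<XX>"
  shows "metric_app g (lie_bracket X Y) Z
    = metric_app g (D X Y) Z - metric_app g (D Y X) Z - torsion3 g D X Y Z"
proof -
  have "lie_bracket X Y = D X Y - D Y X - torsion D X Y" by (simp add: torsion_def)
  then have "metric_app g (lie_bracket X Y) Z = metric_app g (D X Y - D Y X - torsion D X Y) Z"
    by simp
  also have "\<dots> = metric_app g (D X Y) Z - metric_app g (D Y X) Z - metric_app g (torsion D X Y) Z"
    using assms by (simp add: affine_connectionD(1) torsion_field)
  finally show ?thesis by (simp add: torsion3_def)
qed

text \<open>
  Expand all derivatives by the metric property and all brackets by the torsion; the terms other
  than \<open>g (D X Y) Z\<close> cancel.  The three torsion terms add up to one by skewness.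
\<close>

lemma koszul_formula:
  assumes D: "metric_connection A g D" and T: "three_form A (torsion3 g D)"
    and X: "X \<in> \<XX>" and Y: "Y \<in> \<XX>" and Z: "Z \<in> \<XX>"
  shows "2 * metric_app g (D X Y) Z p = koszul g X Y Z p + torsion3 g D X Y Z p"
proof -
  have aff: "affine_connection A D" using D by (simp add: metric_connection_def)
  note field = affine_connectionD(1)[OF aff]
  have swap: "metric_app g Y (D X Z) = metric_app g (D X Z) Y"
    "metric_app g X (D Y Z) = metric_app g (D Y Z) X"
    "metric_app g X (D Z Y) = metric_app g (D Z Y) X"
    using X Y Z by (simp_all add: field metric_app_swap)
  show ?thesis
    unfolding koszul_def metric_connection_derivative[OF D X Y Z]
      metric_connection_derivative[OF D Y X Z] metric_connection_derivative[OF D Z X Y]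
      bracket_via_connection[OF aff X Y Z] bracket_via_connection[OF aff X Z Y]
      bracket_via_connection[OF aff Y Z X] swap
    using three_formD(3)[OF T X Y Z] three_formD(3)[OF T Y X Z] three_formD(2)[OF T X Y Z]
    by simp
qed

lemma metric_connection_unique:
  assumes "metric_connection A g D" "three_form A (torsion3 g D)"
    and "metric_connection A g D'"
    and same: "\<And>X Y Z. X \<in> \<XX> \<Longrightarrow> Y \<in> \<XX> \<Longrightarrow> Z \<in> \<XX> \<Longrightarrow> torsion3 g D X Y Z = torsion3 g D' X Y Z"
    and X: "X \<in> \<XX>" and Y: "Y \<in> \<XX>"
  shows "D X Y = D' X Y"
proof (rule metric_nondegenerate)
  have T': "three_form A (torsion3 g D')"
    by (rule three_form_cong[OF assms(2)]) (simp add: same)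
  show "D X Y \<in> \<XX>" "D' X Y \<in> \<XX>"
    using assms(1,3) X Y by (simp_all add: metric_connection_def affine_connectionD(1))
  fix Z assume Z: "Z \<in> \<XX>"
  show "metric_app g (D X Y) Z = metric_app g (D' X Y) Z"
  proof
    fix p
    show "metric_app g (D X Y) Z p = metric_app g (D' X Y) Z p"
      using koszul_formula[OF assms(1,2) X Y Z, of p] koszul_formula[OF assms(3) T' X Y Z, of p]
        same[OF X Y Z] by simp
  qed
qed

lemma koszul_smooth: "X \<in> \<XX> \<Longrightarrow> Y \<in> \<XX> \<Longrightarrow> Z \<in> \<XX> \<Longrightarrow> koszul g X Y Z \<in> \<FF>"
  by (simp add: koszul_def)

lemma koszul_linear:
  assumes "X \<in> \<XX>" "Y \<in> \<XX>" "Z \<in> \<XX>"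
  shows "W \<in> \<XX> \<Longrightarrow> koszul g X Y (Z + W) = koszul g X Y Z + koszul g X Y W"
    "W \<in> \<XX> \<Longrightarrow> koszul g X (Y + W) Z = koszul g X Y Z + koszul g X W Z"
    "W \<in> \<XX> \<Longrightarrow> koszul g (X + W) Y Z = koszul g X Y Z + koszul g W Y Z"
    "f \<in> \<FF> \<Longrightarrow> koszul g X Y (fmult f Z) = f * koszul g X Y Z"
    "f \<in> \<FF> \<Longrightarrow> koszul g X (fmult f Y) Z = f * koszul g X Y Z + 2 * (deriv_along X f * metric_app g Y Z)"
    "f \<in> \<FF> \<Longrightarrow> koszul g (fmult f X) Y Z = f * koszul g X Y Z"
    "koszul g X Y Z + koszul g X Z Y = 2 * deriv_along X (metric_app g Y Z)"
    "koszul g X Y Z - koszul g Y X Z = 2 * metric_app g (lie_bracket X Y) Z"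
proof -
  note sym = metric_app_swap[OF assms(1,2)] metric_app_swap[OF assms(1,3)] metric_app_swap[OF assms(2,3)]
  show "W \<in> \<XX> \<Longrightarrow> koszul g X Y (Z + W) = koszul g X Y Z + koszul g X Y W"
    "W \<in> \<XX> \<Longrightarrow> koszul g X (Y + W) Z = koszul g X Y Z + koszul g X W Z"
    "W \<in> \<XX> \<Longrightarrow> koszul g (X + W) Y Z = koszul g X Y Z + koszul g W Y Z"
    using assms by (simp_all add: koszul_def)
  show "f \<in> \<FF> \<Longrightarrow> koszul g X Y (fmult f Z) = f * koszul g X Y Z"
    "f \<in> \<FF> \<Longrightarrow> koszul g X (fmult f Y) Z = f * koszul g X Y Z + 2 * (deriv_along X f * metric_app g Y Z)"
    "f \<in> \<FF> \<Longrightarrow> koszul g (fmult f X) Y Z = f * koszul g X Y Z"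
    using assms sym by (simp_all add: koszul_def algebra_simps)
  show "koszul g X Y Z + koszul g X Z Y = 2 * deriv_along X (metric_app g Y Z)"
    using assms sym lie_bracket_swap[of Z Y] by (simp add: koszul_def)
  show "koszul g X Y Z - koszul g Y X Z = 2 * metric_app g (lie_bracket X Y) Z"
    using assms sym lie_bracket_swap[of Y X] by (simp add: koszul_def)
qed

text \<open>
  The Koszul formula, corrected by the torsion, prescribes \<open>g (D X Y) Z\<close>, and the musical
  isomorphism turns this prescription into a vector field.  The Levi-Civita connection is the
  case of torsion 0.
\<close>

lemma metric_connection_with_torsion:
  assumes T: "three_form A T"
  shows "\<exists>D. metric_connection A g D \<and>
    (\<forall>X\<in>\<XX>. \<forall>Y\<in>\<XX>. \<forall>Z\<in>\<XX>. torsion3 g D X Y Z = T X Y Z)"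
proof -
  define K where "K X Y Z = (\<lambda>_. 1 / 2) * (koszul g X Y Z + T X Y Z)" for X Y Z
  have "\<exists>W\<in>\<XX>. \<forall>Z\<in>\<XX>. metric_app g W Z = K X Y Z" if XY: "X \<in> \<XX>" "Y \<in> \<XX>" for X Y
  proof (rule musical_isomorphism)
    fix Z assume Z: "Z \<in> \<XX>"
    show "K X Y Z \<in> \<FF>"
      using XY Z by (simp add: K_def koszul_smooth three_formD(1)[OF T])
    show "K X Y (Z + W) = K X Y Z + K X Y W" if "W \<in> \<XX>" for W
      using XY Z that tensorialD(1)[OF three_form_tensorial(3)[OF T XY]]
      by (simp add: K_def koszul_linear algebra_simps)
    show "K X Y (fmult f Z) = f * K X Y Z" if "f \<in> \<FF>" for f
      using XY Z that tensorialD(2)[OF three_form_tensorial(3)[OF T XY]]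
      by (simp add: K_def koszul_linear algebra_simps)
  qed
  then have ex: "\<exists>W. W \<in> \<XX> \<and> (\<forall>Z\<in>\<XX>. metric_app g W Z = K X Y Z)"
    if "X \<in> \<XX>" "Y \<in> \<XX>" for X Y
    using that by blast
  define D where "D X Y = (SOME W. W \<in> \<XX> \<and> (\<forall>Z\<in>\<XX>. metric_app g W Z = K X Y Z))" for X Y
  have D: "D X Y \<in> \<XX>" if "X \<in> \<XX>" "Y \<in> \<XX>" for X Y
    using someI_ex[OF ex[OF that]] by (simp add: D_def)
  have D_K: "metric_app g (D X Y) Z = K X Y Z" if "X \<in> \<XX>" "Y \<in> \<XX>" "Z \<in> \<XX>" for X Y Z
    using someI_ex[OF ex[OF that(1,2)]] that(3) by (simp add: D_def)
  have T_at: "T (X + W) Y Z = T X Y Z + T W Y Z" "T X (Y + W) Z = T X Y Z + T X W Z"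
    "f \<in> \<FF> \<Longrightarrow> T (fmult f X) Y Z = f * T X Y Z" "f \<in> \<FF> \<Longrightarrow> T X (fmult f Y) Z = f * T X Y Z"
    if "X \<in> \<XX>" "Y \<in> \<XX>" "Z \<in> \<XX>" "W \<in> \<XX>" for X Y Z W f
    using tensorialD(1,2)[OF three_form_tensorial(1)[OF T that(2,3)]]
      tensorialD(1,2)[OF three_form_tensorial(2)[OF T that(1,3)]] that by simp_all
  have aff: "affine_connection A D"
    unfolding affine_connection_def
  proof (intro ballI conjI)
    fix X Y assume X: "X \<in> \<XX>" and Y: "Y \<in> \<XX>"
    show "D X Y \<in> \<XX>" by (rule D[OF X Y])
    fix W assume W: "W \<in> \<XX>"
    show "D (X + W) Y = D X Y + D W Y"
      by (rule metric_nondegenerate)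
        (use X Y W in \<open>simp_all add: D D_K K_def koszul_linear T_at algebra_simps\<close>)
    show "D X (Y + W) = D X Y + D X W"
      by (rule metric_nondegenerate)
        (use X Y W in \<open>simp_all add: D D_K K_def koszul_linear T_at algebra_simps\<close>)
  next
    fix X Y f assume X: "X \<in> \<XX>" and Y: "Y \<in> \<XX>" and f: "f \<in> \<FF>"
    show "D (fmult f X) Y = fmult f (D X Y)"
      by (rule metric_nondegenerate)
        (use X Y f in \<open>simp_all add: D D_K K_def koszul_linear T_at[OF _ _ _ X] algebra_simps\<close>)
    show "D X (fmult f Y) = fmult (deriv_along X f) Y + fmult f (D X Y)"
      by (rule metric_nondegenerate)
        (use X Y f in \<open>simp_all add: D D_K K_def koszul_linear T_at[OF _ _ _ X] fun_eq_iff algebra_simps\<close>)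
  qed
  have metric: "cov_deriv_metric D g X Y Z = 0" if "X \<in> \<XX>" "Y \<in> \<XX>" "Z \<in> \<XX>" for X Y Z
  proof
    fix p
    have "koszul g X Y Z p + koszul g X Z Y p = 2 * deriv_along X (metric_app g Y Z) p"
      using fun_cong[OF koszul_linear(7)[OF that], of p] by simp
    then show "cov_deriv_metric D g X Y Z p = 0 p"
      using that D three_formD(3)[OF T that] metric_app_swap[of Y "D X Z"]
      by (simp add: cov_deriv_metric_def D_K K_def add_divide_distrib diff_divide_distrib)
  qed
  have "torsion3 g D X Y Z = T X Y Z" if "X \<in> \<XX>" "Y \<in> \<XX>" "Z \<in> \<XX>" for X Y Z
  proof
    fix p
    have "koszul g X Y Z p - koszul g Y X Z p = 2 * metric_app g (lie_bracket X Y) Z p"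
      using fun_cong[OF koszul_linear(8)[OF that], of p] by simp
    then show "torsion3 g D X Y Z p = T X Y Z p"
      using that D three_formD(2)[OF T that]
      by (simp add: torsion3_def torsion_def D_K K_def add_divide_distrib diff_divide_distrib)
  qed
  then show ?thesis using aff metric unfolding metric_connection_def by blast
qed

lemma levi_civita:
  shows "metric_connection A g (levi_civita A g)"
    and "X \<in> \<XX> \<Longrightarrow> Y \<in> \<XX> \<Longrightarrow> Z \<in> \<XX> \<Longrightarrow> torsion3 g (levi_civita A g) X Y Z = 0"
proof -
  obtain D where D: "metric_connection A g D"
    and T: "\<forall>X\<in>\<XX>. \<forall>Y\<in>\<XX>. \<forall>Z\<in>\<XX>. torsion3 g D X Y Z = (0 :: 'a form3) X Y Z"
    using metric_connection_with_torsion[OF three_form_zero] by blast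
  have "torsion D X Y = 0" if "X \<in> \<XX>" "Y \<in> \<XX>" for X Y
  proof (rule metric_nondegenerate)
    show "torsion D X Y \<in> \<XX>" "0 \<in> \<XX>"
      using D that by (simp_all add: metric_connection_def torsion_field)
    show "metric_app g (torsion D X Y) Z = metric_app g 0 Z" if "Z \<in> \<XX>" for Z
      using T \<open>X \<in> \<XX>\<close> \<open>Y \<in> \<XX>\<close> that by (simp add: torsion3_def)
  qed
  then have "\<exists>D. metric_connection A g D \<and> (\<forall>X\<in>\<XX>. \<forall>Y\<in>\<XX>. torsion D X Y = 0)"
    using D by blast
  from someI_ex[OF this] have lc: "metric_connection A g (levi_civita A g) \<and>
      (\<forall>X\<in>\<XX>. \<forall>Y\<in>\<XX>. torsion (levi_civita A g) X Y = 0)"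
    unfolding levi_civita_def .
  then show "metric_connection A g (levi_civita A g)" by blast
  show "X \<in> \<XX> \<Longrightarrow> Y \<in> \<XX> \<Longrightarrow> Z \<in> \<XX> \<Longrightarrow> torsion3 g (levi_civita A g) X Y Z = 0"
    using lc by (simp add: torsion3_def)
qed

lemma skew_connection_via_levi_civita:
  assumes D: "metric_connection A g D" "three_form A (torsion3 g D)"
    and "X \<in> \<XX>" "Y \<in> \<XX>" "Z \<in> \<XX>"
  shows "metric_app g (D X Y) Z p = metric_app g (levi_civita A g X Y) Z p + 1 / 2 * torsion3 g D X Y Z p"
proof -
  have "three_form A (torsion3 g (levi_civita A g))"
    by (rule three_form_cong[OF three_form_zero]) (simp add: levi_civita(2))
  then show ?thesis
    using koszul_formula[OF D assms(3-5), of p] koszul_formula[OF levi_civita(1) _ assms(3-5), of p]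
      levi_civita(2)[OF assms(3-5)] by simp
qed

end

section \<open>The tensors of a metric f-manifold\<close>

text \<open>
  The simplifier evaluates pointwise operations under a \<open>\<lambda>\<close> whenever a tangent vector or a
  vector field occurs eta-expanded.  These rules fold the result again.
\<close>

lemma tangent_fold [simp]:
  fixes u v :: "'a tangent"
  shows "(\<lambda>f. 0) = (0 :: 'a tangent)" "(\<lambda>f. u f + v f) = u + v" "(\<lambda>f. u f - v f) = u - v"
    "(\<lambda>f. - u f) = - u"
  by (simp_all add: fun_eq_iff)

lemma fmult_zero [simp]: "fmult f 0 = 0"
  by (rule ext) (simp add: fmult_apply)

lemma tangent_sum_fold [simp]:
  fixes u :: "'i \<Rightarrow> 'a tangent" and X :: "'i \<Rightarrow> 'a vfield"
  shows "(\<lambda>f. \<Sum>i\<in>I. u i f) = (\<Sum>i\<in>I. u i)" "(\<lambda>p. \<Sum>i\<in>I. X i p) = (\<Sum>i\<in>I. X i)"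
  by (simp_all only: fun_eq_iff fun_sum_apply simp_thms)

lemma vfield_fold [simp]:
  fixes X Y :: "'a vfield"
  shows "(\<lambda>p. 0) = (0 :: 'a vfield)" "(\<lambda>p. X p + Y p) = X + Y" "(\<lambda>p. X p - Y p) = X - Y"
    "(\<lambda>p. - X p) = - X"
  by (simp_all only: fun_eq_iff plus_fun_apply minus_apply uminus_apply zero_fun_apply simp_thms)

context smooth_manifold
begin

lemma lie_bracket_zero [simp]:
  assumes "Z \<in> \<XX>"
  shows "lie_bracket 0 Z = 0" "lie_bracket Z 0 = 0"
  using lie_bracket_linear(1)[of 0 Z 0] lie_bracket_linear(2)[of 0 Z 0] assms by simp_all

lemma wedge_three_form:
  assumes \<eta>: "tensorial \<eta>" "\<And>X. X \<in> \<XX> \<Longrightarrow> \<eta> X \<in> \<FF>"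
    and \<omega>: "\<And>Y. Y \<in> \<XX> \<Longrightarrow> tensorial (\<lambda>X. \<omega> X Y)"
      "\<And>X Y. X \<in> \<XX> \<Longrightarrow> Y \<in> \<XX> \<Longrightarrow> \<omega> X Y \<in> \<FF>"
    and swap: "\<And>X Y. X \<in> \<XX> \<Longrightarrow> Y \<in> \<XX> \<Longrightarrow> \<omega> Y X = - \<omega> X Y"
  shows "three_form A (wedge12 \<eta> \<omega>)"
proof (rule three_formI)
  fix Y Z assume F: "Y \<in> \<XX>" "Z \<in> \<XX>"
  show "tensorial (\<lambda>X. wedge12 \<eta> \<omega> X Y Z)"
    unfolding tensorial_def
    using F tensorialD[OF \<omega>(1)[OF F(1)]] tensorialD[OF \<omega>(1)[OF F(2)]] tensorialD[OF \<eta>(1)]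
    by (auto simp: wedge12_def algebra_simps)
next
  fix X Y Z assume F: "X \<in> \<XX>" "Y \<in> \<XX>" "Z \<in> \<XX>"
  show "wedge12 \<eta> \<omega> X Y Z \<in> \<FF>" using F \<eta>(2) \<omega>(2) by (simp add: wedge12_def)
  show "wedge12 \<eta> \<omega> Y X Z = - wedge12 \<eta> \<omega> X Y Z"
    using swap[OF F(1,2)] by (simp add: wedge12_def algebra_simps)
  show "wedge12 \<eta> \<omega> X Z Y = - wedge12 \<eta> \<omega> X Y Z"
    using swap[OF F(2,3)] by (simp add: wedge12_def algebra_simps)
qed

end

context riemannian_manifold
begin

abbreviation inner_field (\<open>\<langle>_, _\<rangle>\<close>) where "\<langle>X, Y\<rangle> \<equiv> metric_app g X Y"

end

sublocale metric_f_manifold \<subseteq> riemannian_manifold A "2 * n + s" g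
  by unfold_locales (rule metric)

context metric_f_manifold
begin

abbreviation \<Phi> where "\<Phi> \<equiv> endo_app \<phi>"

lemma phi_linear: "linear_on (tangent_space A p) (\<phi> p)"
  and phi_tangent: "v \<in> tangent_space A p \<Longrightarrow> \<phi> p v \<in> tangent_space A p"
  and phi_field [simp, intro]: "X \<in> \<XX> \<Longrightarrow> \<Phi> X \<in> \<XX>"
  using phi_tensor by (auto simp: endo_field_def)

lemma xi_field' [simp, intro]: "i \<in> {1..s} \<Longrightarrow> \<xi> i \<in> \<XX>"
  by (rule xi_field)

lemma phi_module [simp]:
  "X \<in> \<XX> \<Longrightarrow> Y \<in> \<XX> \<Longrightarrow> \<Phi> (X + Y) = \<Phi> X + \<Phi> Y"
  "X \<in> \<XX> \<Longrightarrow> \<Phi> (fmult f X) = fmult f (\<Phi> X)"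
  "X \<in> \<XX> \<Longrightarrow> \<Phi> (- X) = - \<Phi> X"
  "X \<in> \<XX> \<Longrightarrow> Y \<in> \<XX> \<Longrightarrow> \<Phi> (X - Y) = \<Phi> X - \<Phi> Y"
  "\<Phi> 0 = 0"
proof -
  show add: "\<Phi> (X + Y) = \<Phi> X + \<Phi> Y" if "X \<in> \<XX>" "Y \<in> \<XX>" for X Y
    by (rule ext) (use phi_linear that in \<open>simp add: endo_app_def linear_on_def\<close>)
  show scale: "\<Phi> (fmult f X) = fmult f (\<Phi> X)" if "X \<in> \<XX>" for f X
    by (rule ext) (use phi_linear that in \<open>simp add: endo_app_def fmult_def linear_on_def\<close>)
  have neg: "- X = fmult (\<lambda>_. -1) X" for X :: "'a vfield"
    by (simp add: fmult_def fun_eq_iff scaleR_fun_def)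
  show minus: "\<Phi> (- X) = - \<Phi> X" if "X \<in> \<XX>" for X
    unfolding neg by (rule scale[OF that])
  show "\<Phi> (X - Y) = \<Phi> X - \<Phi> Y" if "X \<in> \<XX>" "Y \<in> \<XX>" for X Y
    using add[of X "- Y"] minus[OF that(2)] that by simp
  show "\<Phi> 0 = 0" using add[of 0 0] by simp
qed

lemma phi_xi_at: "i \<in> {1..s} \<Longrightarrow> \<phi> p (\<xi> i p) = 0"
  using phi_kernel[of p] span_base[of "\<xi> i p" "(\<lambda>i. \<xi> i p) ` {1..s}"] by blast

lemma phi_xi [simp]: "i \<in> {1..s} \<Longrightarrow> \<Phi> (\<xi> i) = 0"
  by (rule ext) (simp add: endo_app_def phi_xi_at)

text \<open>
  Insert \<open>\<xi> i\<close> in the compatibility condition of the metric.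
\<close>

lemma eta_metric_at:
  assumes "i \<in> {1..s}" "v \<in> tangent_space A p"
  shows "\<eta> i p v = g p v (\<xi> i p)"
proof -
  have "\<xi> i p \<in> tangent_space A p" using assms(1) by auto
  then have "g p (\<phi> p v) (\<phi> p (\<xi> i p)) = g p v (\<xi> i p) - (\<Sum>j\<in>{1..s}. \<eta> j p v * \<eta> j p (\<xi> i p))"
    by (rule metric_compatible[OF assms(2)])
  also have "(\<Sum>j\<in>{1..s}. \<eta> j p v * \<eta> j p (\<xi> i p)) = (\<Sum>j\<in>{1..s}. if j = i then \<eta> i p v else 0)"
    by (rule sum.cong) (use eta_xi assms(1) in auto)
  also have "\<dots> = \<eta> i p v" using assms(1) by simp
  finally show ?thesis
    using phi_xi_at[OF assms(1)] metric_zero_right[OF phi_tangent[OF assms(2)]] by simp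
qed

lemma eta_metric: "i \<in> {1..s} \<Longrightarrow> X \<in> \<XX> \<Longrightarrow> form_app (\<eta> i) X = \<langle>X, \<xi> i\<rangle>"
  by (rule ext) (simp add: form_app_def metric_app_def eta_metric_at)

lemma phi_orthogonal_xi [simp]:
  assumes "i \<in> {1..s}" "X \<in> \<XX>"
  shows "\<langle>\<Phi> X, \<xi> i\<rangle> = 0"
proof -
  have "form_app (\<eta> i) (\<Phi> X) = 0"
    by (rule ext) (use assms eta_phi in \<open>simp add: form_app_def endo_app_def\<close>)
  then show ?thesis using eta_metric[of i "\<Phi> X"] assms by simp
qed

lemma xi_orthonormal: "i \<in> {1..s} \<Longrightarrow> j \<in> {1..s} \<Longrightarrow> \<langle>\<xi> i, \<xi> j\<rangle> p = (if i = j then 1 else 0)"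
  using eta_xi[of j i p] by (simp add: eta_metric[symmetric] form_app_def)

lemma phi_square:
  assumes "X \<in> \<XX>"
  shows "\<Phi> (\<Phi> X) = - X + (\<Sum>i\<in>{1..s}. fmult \<langle>X, \<xi> i\<rangle> (\<xi> i))"
proof
  fix p
  have "\<eta> i p (X p) = \<langle>X, \<xi> i\<rangle> p" if "i \<in> {1..s}" for i
    using eta_metric_at[OF that] assms by (simp add: metric_app_def)
  then show "\<Phi> (\<Phi> X) p = (- X + (\<Sum>i\<in>{1..s}. fmult \<langle>X, \<xi> i\<rangle> (\<xi> i))) p"
    using assms by (simp add: endo_app_def phi_squared fun_sum_apply fmult_apply)
qed

text \<open>
  This is how \<open>\<phi>\<^sup>2\<close> is eliminated from an argument of a tensor.
\<close>

lemma tensorial_phi_square: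
  assumes L: "tensorial L" and X: "X \<in> \<XX>"
  shows "L (\<Phi> (\<Phi> X)) p = - L X p + (\<Sum>i\<in>{1..s}. \<langle>X, \<xi> i\<rangle> p * L (\<xi> i) p)"
proof -
  have fields: "fmult \<langle>X, \<xi> i\<rangle> (\<xi> i) \<in> \<XX>" if "i \<in> {1..s}" for i using X that by auto
  have "L (\<Phi> (\<Phi> X)) = L (- X) + L (\<Sum>i\<in>{1..s}. fmult \<langle>X, \<xi> i\<rangle> (\<xi> i))"
    unfolding phi_square[OF X]
    by (rule tensorialD(1)[OF L]) (use X fields in auto)
  also have "L (\<Sum>i\<in>{1..s}. fmult \<langle>X, \<xi> i\<rangle> (\<xi> i)) = (\<Sum>i\<in>{1..s}. L (fmult \<langle>X, \<xi> i\<rangle> (\<xi> i)))"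
    by (rule tensorial_sum[OF L fields])
  also have "\<dots> = (\<Sum>i\<in>{1..s}. \<langle>X, \<xi> i\<rangle> * L (\<xi> i))"
    by (rule sum.cong) (use X tensorialD(2)[OF L] in auto)
  finally show ?thesis
    using tensorialD(4)[OF L X] by (simp add: fun_sum_apply)
qed

text \<open>
  The compatibility condition for \<open>X\<close> and \<open>\<phi> Y\<close> gives \<open>g (\<phi> X) (\<phi> (\<phi> Y)) = g X (\<phi> Y)\<close>.  As
  \<open>\<phi> X\<close> is orthogonal to the characteristic fields, \<open>\<phi>\<^sup>2\<close> acts as \<open>-1\<close> on the left.
\<close>

lemma phi_skew:
  assumes X: "X \<in> \<XX>" and Y: "Y \<in> \<XX>"
  shows "\<langle>\<Phi> X, Y\<rangle> = - \<langle>X, \<Phi> Y\<rangle>"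
proof
  fix p
  have "g p (\<phi> p (X p)) (\<phi> p (\<phi> p (Y p)))
      = g p (X p) (\<phi> p (Y p)) - (\<Sum>i\<in>{1..s}. \<eta> i p (X p) * \<eta> i p (\<phi> p (Y p)))"
    by (rule metric_compatible) (use X Y phi_tangent in auto)
  also have "(\<Sum>i\<in>{1..s}. \<eta> i p (X p) * \<eta> i p (\<phi> p (Y p))) = 0"
    by (rule sum.neutral) (use eta_phi Y in auto)
  finally have "\<langle>\<Phi> X, \<Phi> (\<Phi> Y)\<rangle> p = \<langle>X, \<Phi> Y\<rangle> p"
    by (simp add: metric_app_def endo_app_def)
  moreover have "tensorial (\<lambda>Z. \<langle>\<Phi> X, Z\<rangle>)"
    using X by (simp add: tensorial_def)
  from tensorial_phi_square[OF this Y, of p]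
  have "\<langle>\<Phi> X, \<Phi> (\<Phi> Y)\<rangle> p = - \<langle>\<Phi> X, Y\<rangle> p" using X by simp
  ultimately show "\<langle>\<Phi> X, Y\<rangle> p = (- \<langle>X, \<Phi> Y\<rangle>) p" by simp
qed

abbreviation d\<eta> where "d\<eta> i \<equiv> ext_deriv1 (form_app (\<eta> i))"

lemma d_eta_expand:
  assumes "i \<in> {1..s}" "X \<in> \<XX>" "Y \<in> \<XX>"
  shows "d\<eta> i X Y = deriv_along X \<langle>Y, \<xi> i\<rangle> - deriv_along Y \<langle>X, \<xi> i\<rangle> - \<langle>lie_bracket X Y, \<xi> i\<rangle>"
  using assms by (simp add: ext_deriv1_def eta_metric)

lemma d_eta_two_form:
  assumes i: "i \<in> {1..s}" and Y: "Y \<in> \<XX>"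
  shows "tensorial (\<lambda>X. d\<eta> i X Y)"
    "X \<in> \<XX> \<Longrightarrow> d\<eta> i X Y \<in> \<FF>"
    "X \<in> \<XX> \<Longrightarrow> d\<eta> i Y X = - d\<eta> i X Y"
proof -
  show "tensorial (\<lambda>X. d\<eta> i X Y)"
    unfolding tensorial_def using i Y by (auto simp: d_eta_expand algebra_simps)
  show "X \<in> \<XX> \<Longrightarrow> d\<eta> i X Y \<in> \<FF>" using i Y by (simp add: d_eta_expand)
  show "X \<in> \<XX> \<Longrightarrow> d\<eta> i Y X = - d\<eta> i X Y"
    using i Y lie_bracket_swap[of Y X] by (simp add: d_eta_expand)
qed

lemma eta_wedge_three_form:
  assumes i: "i \<in> {1..s}"
    and "\<And>Y. Y \<in> \<XX> \<Longrightarrow> tensorial (\<lambda>X. \<omega> X Y)"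
      "\<And>X Y. X \<in> \<XX> \<Longrightarrow> Y \<in> \<XX> \<Longrightarrow> \<omega> X Y \<in> \<FF>"
      "\<And>X Y. X \<in> \<XX> \<Longrightarrow> Y \<in> \<XX> \<Longrightarrow> \<omega> Y X = - \<omega> X Y"
  shows "three_form A (wedge12 (form_app (\<eta> i)) \<omega>)"
proof (rule wedge_three_form)
  show "tensorial (form_app (\<eta> i))"
    unfolding tensorial_def using i by (simp add: eta_metric)
  show "form_app (\<eta> i) X \<in> \<FF>" if "X \<in> \<XX>" for X using i that by (simp add: eta_metric)
qed (rule assms; assumption)+

abbreviation F where "F \<equiv> fundamental_form g \<phi>"

lemma F_def: "F X Y = \<langle>X, \<Phi> Y\<rangle>"
  by (simp add: fundamental_form_def)

lemma F_skew: "X \<in> \<XX> \<Longrightarrow> Y \<in> \<XX> \<Longrightarrow> F Y X = - F X Y"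
  using phi_skew[of X Y] metric_app_swap[of Y "\<Phi> X"] by (simp add: F_def)

lemma dF_three_form: "three_form A (ext_deriv2 F)"
proof (rule three_formI)
  fix Y Z assume F: "Y \<in> \<XX>" "Z \<in> \<XX>"
  show "tensorial (\<lambda>X. ext_deriv2 F X Y Z)"
    unfolding tensorial_def
  proof (intro conjI ballI)
    fix X f assume X: "X \<in> \<XX>" and f: "f \<in> \<FF>"
    have "\<langle>Z, \<Phi> X\<rangle> = - \<langle>X, \<Phi> Z\<rangle>" "\<langle>Y, \<Phi> X\<rangle> = - \<langle>X, \<Phi> Y\<rangle>"
      using F_skew[OF X F(1)] F_skew[OF X F(2)] by (simp_all add: F_def)
    then show "ext_deriv2 F (fmult f X) Y Z = f * ext_deriv2 F X Y Z"
      using F X f by (simp add: ext_deriv2_def F_def algebra_simps)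
  qed (use F in \<open>simp add: ext_deriv2_def F_def algebra_simps\<close>)
next
  fix X Y Z assume V: "X \<in> \<XX>" "Y \<in> \<XX>" "Z \<in> \<XX>"
  show "ext_deriv2 F X Y Z \<in> \<FF>" using V by (simp add: ext_deriv2_def F_def)
  have neg: "F (- W) X = - F W X" "F (- W) Z = - F W Z" if "W \<in> \<XX>" for W
    using that V by (simp_all add: F_def)
  have sm: "F X Y \<in> \<FF>" "F Y Z \<in> \<FF>" using V by (simp_all add: F_def)
  show "ext_deriv2 F Y X Z = - ext_deriv2 F X Y Z"
    unfolding ext_deriv2_def lie_bracket_swap[of Y X] F_skew[OF V(1,2)]
    using V sm by (simp add: neg)
  show "ext_deriv2 F X Z Y = - ext_deriv2 F X Y Z"
    unfolding ext_deriv2_def lie_bracket_swap[of Z Y] F_skew[OF V(2,3)]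
    using V sm by (simp add: neg)
qed

lemma dphi_F_three_form: "three_form A (dphi_F g \<phi>)"
proof (rule three_formI)
  note T = dF_three_form
  fix Y Z assume F: "Y \<in> \<XX>" "Z \<in> \<XX>"
  show "tensorial (\<lambda>X. dphi_F g \<phi> X Y Z)"
    unfolding tensorial_def dphi_F_def
    using tensorialD(1,2)[OF three_form_tensorial(1)[OF T, of "\<Phi> Y" "\<Phi> Z"]] F
    by simp
next
  note T = dF_three_form
  fix X Y Z assume F: "X \<in> \<XX>" "Y \<in> \<XX>" "Z \<in> \<XX>"
  have F': "\<Phi> X \<in> \<XX>" "\<Phi> Y \<in> \<XX>" "\<Phi> Z \<in> \<XX>" using F by auto
  show "dphi_F g \<phi> X Y Z \<in> \<FF>" using three_formD(1)[OF T F'] by (simp add: dphi_F_def)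
  show "dphi_F g \<phi> Y X Z = - dphi_F g \<phi> X Y Z"
    using three_formD(2)[OF T F'] by (simp add: dphi_F_def)
  show "dphi_F g \<phi> X Z Y = - dphi_F g \<phi> X Y Z"
    using three_formD(3)[OF T F'] by (simp add: dphi_F_def)
qed

abbreviation N where "N \<equiv> N1 s \<phi> \<xi> \<eta> g"

abbreviation T\<^sub>0 where "T\<^sub>0 \<equiv> torsion_formula s \<phi> \<xi> \<eta> g"

lemma torsion_formula_three_form:
  assumes N: "three_form A N"
  shows "three_form A T\<^sub>0"
proof -
  have "three_form A (wedge12 (form_app (\<eta> i)) (d\<eta> i))" if i: "i \<in> {1..s}" for i
    by (rule eta_wedge_three_form[OF i]; rule d_eta_two_form[OF i])
  moreover have "three_form A (wedge12 (form_app (\<eta> i)) (interior3 (\<xi> i) N))" if i: "i \<in> {1..s}" for i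
  proof (rule eta_wedge_three_form[OF i])
    fix Y assume Y: "Y \<in> \<XX>"
    show "tensorial (\<lambda>X. interior3 (\<xi> i) N X Y)"
      unfolding interior3_def by (rule three_form_tensorial(2)[OF N xi_field[OF i] Y])
    fix X assume X: "X \<in> \<XX>"
    show "interior3 (\<xi> i) N X Y \<in> \<FF>" "interior3 (\<xi> i) N Y X = - interior3 (\<xi> i) N X Y"
      unfolding interior3_def by (rule three_formD[OF N xi_field[OF i] X Y])+
  qed
  ultimately have "three_form A ((\<Sum>i\<in>{1..s}. wedge12 (form_app (\<eta> i)) (d\<eta> i)) + dphi_F g \<phi> + N
      + (- (\<Sum>i\<in>{1..s}. wedge12 (form_app (\<eta> i)) (interior3 (\<xi> i) N))))"
    by (intro three_form_add three_form_uminus three_form_sum dphi_F_three_form N)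
  then show ?thesis by (simp add: torsion_formula_def)
qed

text \<open>
  Both wedge products are collected in one sum, because \<open>d\<eta> i\<close> and the contraction of \<open>N\<close> by
  \<open>\<xi> i\<close> enter only through their difference.
\<close>

lemma torsion_formula_at:
  assumes "X \<in> \<XX>" "Y \<in> \<XX>" "Z \<in> \<XX>"
  shows "T\<^sub>0 X Y Z p = dphi_F g \<phi> X Y Z p + N X Y Z p
    + (\<Sum>i\<in>{1..s}. \<langle>X, \<xi> i\<rangle> p * (d\<eta> i Y Z p - N (\<xi> i) Y Z p)
        - \<langle>Y, \<xi> i\<rangle> p * (d\<eta> i X Z p - N (\<xi> i) X Z p)
        + \<langle>Z, \<xi> i\<rangle> p * (d\<eta> i X Y p - N (\<xi> i) X Y p))"
proof -
  have "(\<Sum>i\<in>{1..s}. wedge12 (form_app (\<eta> i)) (d\<eta> i)) X Y Z p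
      - (\<Sum>i\<in>{1..s}. wedge12 (form_app (\<eta> i)) (interior3 (\<xi> i) N)) X Y Z p
    = (\<Sum>i\<in>{1..s}. wedge12 (form_app (\<eta> i)) (d\<eta> i) X Y Z p
      - wedge12 (form_app (\<eta> i)) (interior3 (\<xi> i) N) X Y Z p)"
    by (simp add: fun_sum_apply sum_subtractf)
  also have "\<dots> = (\<Sum>i\<in>{1..s}. \<langle>X, \<xi> i\<rangle> p * (d\<eta> i Y Z p - N (\<xi> i) Y Z p)
        - \<langle>Y, \<xi> i\<rangle> p * (d\<eta> i X Z p - N (\<xi> i) X Z p)
        + \<langle>Z, \<xi> i\<rangle> p * (d\<eta> i X Y p - N (\<xi> i) X Y p))"
    by (rule sum.cong) (use assms in \<open>auto simp: wedge12_def interior3_def eta_metric algebra_simps\<close>)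
  finally show ?thesis by (simp add: torsion_formula_def)
qed

lemma N_expand:
  assumes "X \<in> \<XX>" "Y \<in> \<XX>" "Z \<in> \<XX>"
  shows "N X Y Z p = \<langle>nijenhuis_phi \<phi> X Y, Z\<rangle> p + (\<Sum>i\<in>{1..s}. d\<eta> i X Y p * \<langle>Z, \<xi> i\<rangle> p)"
proof -
  have fields: "nijenhuis_phi \<phi> X Y \<in> \<XX>" "fmult (d\<eta> i X Y) (\<xi> i) \<in> \<XX>" if "i \<in> {1..s}" for i
    using assms that d_eta_two_form(2) by (auto simp: nijenhuis_phi_def)
  have nij: "nijenhuis_phi \<phi> X Y \<in> \<XX>" using assms by (auto simp: nijenhuis_phi_def)
  have "\<langle>\<Sum>i\<in>{1..s}. fmult (d\<eta> i X Y) (\<xi> i), Z\<rangle> = (\<Sum>i\<in>{1..s}. \<langle>fmult (d\<eta> i X Y) (\<xi> i), Z\<rangle>)"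
    by (rule metric_app_sum_left[OF assms(3)]) (use fields in auto)
  also have "\<dots> = (\<Sum>i\<in>{1..s}. d\<eta> i X Y * \<langle>Z, \<xi> i\<rangle>)"
    by (rule sum.cong) (use assms d_eta_two_form(2) metric_app_swap[OF assms(3)] in auto)
  finally have "\<langle>\<Sum>i\<in>{1..s}. fmult (d\<eta> i X Y) (\<xi> i), Z\<rangle> p = (\<Sum>i\<in>{1..s}. d\<eta> i X Y p * \<langle>Z, \<xi> i\<rangle> p)"
    by (simp add: fun_sum_apply)
  moreover have "(\<Sum>i\<in>{1..s}. fmult (d\<eta> i X Y) (\<xi> i)) \<in> \<XX>" using fields by auto
  ultimately show ?thesis
    using nij assms by (simp add: N1_def N1_vector_def)
qed

end

section \<open>Metric connections with skew torsion and parallel characteristic fields\<close>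

locale adapted_connection = metric_f_manifold A n s \<phi> \<xi> \<eta> g
  for A :: "('a::{t2_space, second_countable_topology}, 'e::euclidean_space) chart set"
    and n s \<phi> \<xi> \<eta> g +
  fixes D :: "'a connection"
  assumes metric_D: "metric_connection A g D"
    and skew_D: "three_form A (torsion3 g D)"
    and xi_parallel: "\<And>i X. i \<in> {1..s} \<Longrightarrow> X \<in> vector_fields A \<Longrightarrow> D X (\<xi> i) = 0"
begin

abbreviation T where "T \<equiv> torsion3 g D"

text \<open>
  The obstruction to \<open>\<phi>\<close> being parallel.  Differentiating the identities that \<open>\<phi>\<close> satisfies gives
  its symmetries: it is skew in the last two arguments since \<open>\<phi>\<close> is, \<open>\<phi>\<close> may be moved between
  these arguments since \<open>\<phi>\<^sup>2\<close> is parallel, and it vanishes there on the characteristic fields.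
\<close>

definition P where "P X Y Z = \<langle>cov_deriv_endo D \<phi> X Y, Z\<rangle>"

lemma affine: "affine_connection A D"
  using metric_D by (simp add: metric_connection_def)

lemmas D_simps [simp] = affine_connectionD[OF affine]

lemma D_zero [simp]:
  assumes X: "X \<in> \<XX>"
  shows "D X 0 = 0" "Y \<in> \<XX> \<Longrightarrow> D X (- Y) = - D X Y"
proof -
  have "D X (0 + 0) = D X 0 + D X 0" by (rule D_simps(3)) (use X in simp_all)
  then show zero: "D X 0 = 0" by simp
  show "D X (- Y) = - D X Y" if Y: "Y \<in> \<XX>"
  proof -
    have "D X (Y + - Y) = D X Y + D X (- Y)" by (rule D_simps(3)) (use X Y in simp_all)
    then show ?thesis using zero by (simp add: eq_neg_iff_add_eq_0 add.commute)
  qed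
qed

lemmas D_metric = metric_connection_derivative[OF metric_D]

lemma cov_deriv_phi_field [simp, intro]: "X \<in> \<XX> \<Longrightarrow> Y \<in> \<XX> \<Longrightarrow> cov_deriv_endo D \<phi> X Y \<in> \<XX>"
  by (simp add: cov_deriv_endo_def)

lemma torsion_vector_field [simp, intro]: "X \<in> \<XX> \<Longrightarrow> Y \<in> \<XX> \<Longrightarrow> torsion D X Y \<in> \<XX>"
  by (rule torsion_field[OF affine])

lemma T_swap:
  assumes "X \<in> \<XX>" "Y \<in> \<XX>" "Z \<in> \<XX>"
  shows "T Y X Z p = - T X Y Z p" "T X Z Y p = - T X Y Z p"
  using three_formD(2,3)[OF skew_D assms] by simp_all

lemma T_tensorial:
  assumes "Y \<in> \<XX>" "Z \<in> \<XX>"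
  shows "tensorial (\<lambda>X. T X Y Z)" "tensorial (\<lambda>X. T Y X Z)" "tensorial (\<lambda>X. T Y Z X)"
  using three_form_tensorial[OF skew_D assms] .

lemma P_tensorial:
  assumes "Y \<in> \<XX>" "Z \<in> \<XX>"
  shows "tensorial (\<lambda>X. P X Y Z)" "tensorial (\<lambda>X. P Y X Z)" "tensorial (\<lambda>X. P Y Z X)"
  unfolding tensorial_def P_def cov_deriv_endo_def
  using assms by (intro conjI ballI; simp add: algebra_simps)+

lemma P_skew:
  assumes X: "X \<in> \<XX>" and Y: "Y \<in> \<XX>" and Z: "Z \<in> \<XX>"
  shows "P X Z Y p = - P X Y Z p"
proof -
  have expand: "P X Y Z = deriv_along X \<langle>\<Phi> Y, Z\<rangle> - \<langle>\<Phi> Y, D X Z\<rangle> + \<langle>D X Y, \<Phi> Z\<rangle>"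
    if "Y \<in> \<XX>" "Z \<in> \<XX>" for Y Z
    using X that phi_skew[of "D X Y" Z] D_metric[of X "\<Phi> Y" Z]
    by (simp add: P_def cov_deriv_endo_def)
  have "\<langle>\<Phi> Y, Z\<rangle> = - \<langle>\<Phi> Z, Y\<rangle>"
    using phi_skew[OF Y Z] metric_app_swap[of Y "\<Phi> Z"] Y Z by simp
  then show ?thesis
    using X Y Z metric_app_swap[of "\<Phi> Y" "D X Z"] metric_app_swap[of "\<Phi> Z" "D X Y"]
    by (simp add: expand)
qed

lemma D_phi_square:
  assumes X: "X \<in> \<XX>" and Y: "Y \<in> \<XX>"
  shows "D X (\<Phi> (\<Phi> Y)) = \<Phi> (\<Phi> (D X Y))"
proof -
  have xi: "deriv_along X \<langle>W, \<xi> i\<rangle> = \<langle>D X W, \<xi> i\<rangle>" if "i \<in> {1..s}" "W \<in> \<XX>" for i W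
    using D_metric[of X W "\<xi> i"] xi_parallel[OF that(1) X] X that by simp
  have fields: "fmult \<langle>Y, \<xi> i\<rangle> (\<xi> i) \<in> \<XX>" if "i \<in> {1..s}" for i using Y that by auto
  have sum: "D X (\<Sum>i\<in>I. fmult \<langle>Y, \<xi> i\<rangle> (\<xi> i)) = (\<Sum>i\<in>I. fmult \<langle>D X Y, \<xi> i\<rangle> (\<xi> i))"
    if "I \<subseteq> {1..s}" for I
    using finite_subset[OF that finite_atLeastAtMost] that
  proof (induction I rule: finite_induct)
    case (insert i I)
    then have i: "i \<in> {1..s}" and I: "I \<subseteq> {1..s}" by auto
    have "D X (fmult \<langle>Y, \<xi> i\<rangle> (\<xi> i)) = fmult \<langle>D X Y, \<xi> i\<rangle> (\<xi> i)"
      using X Y i xi[OF i Y] xi_parallel[OF i X] by simp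
    moreover have "D X (fmult \<langle>Y, \<xi> i\<rangle> (\<xi> i) + (\<Sum>i\<in>I. fmult \<langle>Y, \<xi> i\<rangle> (\<xi> i)))
        = D X (fmult \<langle>Y, \<xi> i\<rangle> (\<xi> i)) + D X (\<Sum>i\<in>I. fmult \<langle>Y, \<xi> i\<rangle> (\<xi> i))"
    proof (rule D_simps(3)[OF X fields[OF i]])
      show "(\<Sum>i\<in>I. fmult \<langle>Y, \<xi> i\<rangle> (\<xi> i)) \<in> \<XX>"
        by (rule vector_field_sum) (use fields I in blast)
    qed
    ultimately show ?case
      using insert.IH[OF I] by (simp only: sum.insert[OF insert.hyps])
  qed (use X in simp)
  have "(\<Sum>i\<in>{1..s}. fmult \<langle>Y, \<xi> i\<rangle> (\<xi> i)) \<in> \<XX>"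
    by (rule vector_field_sum) (rule fields)
  with X Y have "D X (\<Phi> (\<Phi> Y)) = D X (- Y) + D X (\<Sum>i\<in>{1..s}. fmult \<langle>Y, \<xi> i\<rangle> (\<xi> i))"
    unfolding phi_square[OF Y] by (intro D_simps(3)) auto
  also have "\<dots> = \<Phi> (\<Phi> (D X Y))"
    unfolding phi_square[OF D_simps(1)[OF X Y]] sum[OF order_refl] D_zero(2)[OF X Y] ..
  finally show ?thesis .
qed

lemma P_phi:
  assumes X: "X \<in> \<XX>" and Y: "Y \<in> \<XX>" and Z: "Z \<in> \<XX>"
  shows "P X (\<Phi> Y) Z = P X Y (\<Phi> Z)"
proof -
  have "cov_deriv_endo D \<phi> X (\<Phi> Y) = - \<Phi> (cov_deriv_endo D \<phi> X Y)"
    using X Y by (simp add: cov_deriv_endo_def D_phi_square)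
  then show ?thesis
    using X Y Z phi_skew[of "cov_deriv_endo D \<phi> X Y" Z] by (simp add: P_def)
qed

lemma P_xi:
  assumes "X \<in> \<XX>" "Z \<in> \<XX>" "i \<in> {1..s}"
  shows "P X (\<xi> i) Z p = 0" "P X Z (\<xi> i) p = 0"
proof -
  show "P X (\<xi> i) Z p = 0"
    using assms xi_parallel by (simp add: P_def cov_deriv_endo_def)
  then show "P X Z (\<xi> i) p = 0" using P_skew[of X "\<xi> i" Z p] assms by simp
qed

lemma P_phi_phi:
  assumes X: "X \<in> \<XX>" and Y: "Y \<in> \<XX>" and Z: "Z \<in> \<XX>"
  shows "P X Y (\<Phi> (\<Phi> Z)) p = - P X Y Z p"
  using tensorial_phi_square[OF P_tensorial(3)[OF X Y] Z, of p] X Y by (simp add: P_xi)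

lemma T_phi_phi:
  assumes X: "X \<in> \<XX>" and Y: "Y \<in> \<XX>" and Z: "Z \<in> \<XX>"
  shows "T X Y (\<Phi> (\<Phi> Z)) p = - T X Y Z p + (\<Sum>i\<in>{1..s}. \<langle>Z, \<xi> i\<rangle> p * T (\<xi> i) X Y p)"
proof -
  have "T X Y (\<xi> i) p = T (\<xi> i) X Y p" if "i \<in> {1..s}" for i
    using T_swap(2)[of X "\<xi> i" Y p] T_swap(1)[of "\<xi> i" X Y p] X Y that by simp
  then show ?thesis
    using tensorial_phi_square[OF T_tensorial(3)[OF X Y] Z, of p] by simp
qed

text \<open>
  Only the torsion survives in \<open>d\<eta> i\<close>, since \<open>\<xi> i\<close> is parallel.
\<close>

lemma d_eta_torsion:
  assumes i: "i \<in> {1..s}" and X: "X \<in> \<XX>" and Y: "Y \<in> \<XX>"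
  shows "d\<eta> i X Y p = T (\<xi> i) X Y p"
proof -
  have "d\<eta> i X Y p = T X Y (\<xi> i) p"
    using i X Y xi_parallel[OF i X] xi_parallel[OF i Y]
    by (simp add: d_eta_expand D_metric bracket_via_connection[OF affine])
  then show ?thesis
    using T_swap(2)[of X "\<xi> i" Y p] T_swap(1)[of "\<xi> i" X Y p] X Y i by simp
qed

text \<open>The contribution of the covariant derivative of \<open>\<phi>\<close> to the Nijenhuis tensor.\<close>

definition Q where "Q X Y Z = P (\<Phi> X) Y Z - P (\<Phi> Y) X Z + P X Y (\<Phi> Z) - P Y X (\<Phi> Z)"

text \<open>
  The part \<open>d\<eta> i \<otimes> \<xi> i\<close> of \<open>N\<close> compensates exactly the terms in \<open>\<xi> i\<close> that \<open>\<phi>\<^sup>2\<close> produces from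
  \<open>T X Y (\<phi>\<^sup>2 Z)\<close>.
\<close>

lemma N_torsion:
  assumes X: "X \<in> \<XX>" and Y: "Y \<in> \<XX>" and Z: "Z \<in> \<XX>"
  shows "N X Y Z p = T X Y Z p - T (\<Phi> X) (\<Phi> Y) Z p - T X (\<Phi> Y) (\<Phi> Z) p - T (\<Phi> X) Y (\<Phi> Z) p
    + Q X Y Z p"
proof -
  let ?S = "cov_deriv_endo D \<phi>" and ?\<tau> = "torsion D"
  have bracket: "lie_bracket X Y = D X Y - D Y X - ?\<tau> X Y" for X Y by (simp add: torsion_def)
  have D_phi: "D X (\<Phi> Y) = \<Phi> (D X Y) + ?S X Y" for X Y by (simp add: cov_deriv_endo_def)
  have "nijenhuis_phi \<phi> X Y = (?S (\<Phi> X) Y - ?S (\<Phi> Y) X - \<Phi> (?S X Y) + \<Phi> (?S Y X))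
      + (- ?\<tau> (\<Phi> X) (\<Phi> Y) - \<Phi> (\<Phi> (?\<tau> X Y)) + \<Phi> (?\<tau> X (\<Phi> Y)) + \<Phi> (?\<tau> (\<Phi> X) Y))"
    unfolding nijenhuis_phi_def bracket D_phi using X Y by simp
  then have "\<langle>nijenhuis_phi \<phi> X Y, Z\<rangle> = P (\<Phi> X) Y Z - P (\<Phi> Y) X Z + P X Y (\<Phi> Z) - P Y X (\<Phi> Z)
      - T (\<Phi> X) (\<Phi> Y) Z - T X Y (\<Phi> (\<Phi> Z)) - T X (\<Phi> Y) (\<Phi> Z) - T (\<Phi> X) Y (\<Phi> Z)"
    using X Y Z by (simp add: P_def torsion3_def phi_skew)
  then show ?thesis
    using T_phi_phi[OF X Y Z, of p] X Y Z
    by (simp add: N_expand d_eta_torsion Q_def mult.commute)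
qed

text \<open>
  The covariant derivative of the fundamental form along \<open>X\<close> is \<open>- P X\<close>; its cyclic sum and the
  torsion terms make up the exterior derivative.
\<close>

lemma dF_torsion:
  assumes X: "X \<in> \<XX>" and Y: "Y \<in> \<XX>" and Z: "Z \<in> \<XX>"
  shows "ext_deriv2 F X Y Z p = T X Y (\<Phi> Z) p + T X (\<Phi> Y) Z p + T (\<Phi> X) Y Z p
    - P X Y Z p - P Y Z X p - P Z X Y p"
proof -
  have der: "deriv_along X \<langle>Y, \<Phi> Z\<rangle> p = \<langle>D X Y, \<Phi> Z\<rangle> p - \<langle>D X Z, \<Phi> Y\<rangle> p + P X Z Y p"
    if "X \<in> \<XX>" "Y \<in> \<XX>" "Z \<in> \<XX>" for X Y Z
  proof -
    have "D X (\<Phi> Z) = \<Phi> (D X Z) + cov_deriv_endo D \<phi> X Z" by (simp add: cov_deriv_endo_def)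
    then have "deriv_along X \<langle>Y, \<Phi> Z\<rangle> = \<langle>D X Y, \<Phi> Z\<rangle> + \<langle>Y, \<Phi> (D X Z) + cov_deriv_endo D \<phi> X Z\<rangle>"
      using D_metric[of X Y "\<Phi> Z"] that by simp
    moreover have "\<langle>Y, \<Phi> (D X Z)\<rangle> = - \<langle>D X Z, \<Phi> Y\<rangle>"
      using that phi_skew[of "D X Z" Y] metric_app_swap[of Y "\<Phi> (D X Z)"] by simp
    ultimately show ?thesis
      using that metric_app_swap[of Y "cov_deriv_endo D \<phi> X Z"] by (simp add: P_def)
  qed
  have "T X Z (\<Phi> Y) p = - T X (\<Phi> Y) Z p" "T Y Z (\<Phi> X) p = T (\<Phi> X) Y Z p"
    using T_swap[of X "\<Phi> Y" Z p] T_swap(2)[of Y "\<Phi> X" Z p] T_swap(1)[of "\<Phi> X" Y Z p] X Y Z by auto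
  then show ?thesis
    using der[OF X Y Z] der[OF Y X Z] der[OF Z X Y] P_skew[OF X Y Z, of p] P_skew[OF Z X Y, of p] X Y Z
    by (simp add: ext_deriv2_def F_def bracket_via_connection[OF affine])
qed

lemma dphi_F_torsion:
  assumes X: "X \<in> \<XX>" and Y: "Y \<in> \<XX>" and Z: "Z \<in> \<XX>"
  shows "dphi_F g \<phi> X Y Z p = T (\<Phi> X) (\<Phi> Y) Z p + T X (\<Phi> Y) (\<Phi> Z) p + T (\<Phi> X) Y (\<Phi> Z) p
    - P (\<Phi> X) Y Z p - P (\<Phi> Y) Z X p - P (\<Phi> Z) X Y p
    - (\<Sum>i\<in>{1..s}. \<langle>X, \<xi> i\<rangle> p * T (\<xi> i) (\<Phi> Y) (\<Phi> Z) p - \<langle>Y, \<xi> i\<rangle> p * T (\<xi> i) (\<Phi> X) (\<Phi> Z) p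
        + \<langle>Z, \<xi> i\<rangle> p * T (\<xi> i) (\<Phi> X) (\<Phi> Y) p)"
proof -
  have P3: "P (\<Phi> X) (\<Phi> Y) (\<Phi> Z) p = - P (\<Phi> X) Y Z p" if "X \<in> \<XX>" "Y \<in> \<XX>" "Z \<in> \<XX>" for X Y Z
    using that P_phi[of "\<Phi> X" Y "\<Phi> Z"] P_phi_phi[of "\<Phi> X" Y Z p] by simp
  have 1: "T (\<Phi> (\<Phi> X)) (\<Phi> Y) (\<Phi> Z) p
      = - T X (\<Phi> Y) (\<Phi> Z) p + (\<Sum>i\<in>{1..s}. \<langle>X, \<xi> i\<rangle> p * T (\<xi> i) (\<Phi> Y) (\<Phi> Z) p)"
    by (rule tensorial_phi_square[OF T_tensorial(1) X]) (use Y Z in auto)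
  have "T (\<Phi> X) (\<Phi> (\<Phi> Y)) (\<Phi> Z) p
      = - T (\<Phi> X) Y (\<Phi> Z) p + (\<Sum>i\<in>{1..s}. \<langle>Y, \<xi> i\<rangle> p * T (\<Phi> X) (\<xi> i) (\<Phi> Z) p)"
    by (rule tensorial_phi_square[OF T_tensorial(2) Y]) (use X Z in auto)
  also have "(\<Sum>i\<in>{1..s}. \<langle>Y, \<xi> i\<rangle> p * T (\<Phi> X) (\<xi> i) (\<Phi> Z) p)
      = (\<Sum>i\<in>{1..s}. - (\<langle>Y, \<xi> i\<rangle> p * T (\<xi> i) (\<Phi> X) (\<Phi> Z) p))"
    by (rule sum.cong) (use T_swap(1)[of "\<xi> i" "\<Phi> X" "\<Phi> Z" p for i] X Z in auto)
  finally have 2: "T (\<Phi> X) (\<Phi> (\<Phi> Y)) (\<Phi> Z) p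
      = - T (\<Phi> X) Y (\<Phi> Z) p - (\<Sum>i\<in>{1..s}. \<langle>Y, \<xi> i\<rangle> p * T (\<xi> i) (\<Phi> X) (\<Phi> Z) p)"
    by (simp add: sum_negf)
  have 3: "T (\<Phi> X) (\<Phi> Y) (\<Phi> (\<Phi> Z)) p
      = - T (\<Phi> X) (\<Phi> Y) Z p + (\<Sum>i\<in>{1..s}. \<langle>Z, \<xi> i\<rangle> p * T (\<xi> i) (\<Phi> X) (\<Phi> Y) p)"
    by (rule T_phi_phi) (use X Y Z in auto)
  show ?thesis
    using X Y Z P3[OF X Y Z] P3[OF Y Z X] P3[OF Z X Y] 1 2 3
    by (simp add: dphi_F_def dF_torsion sum.distrib sum_subtractf)
qed

text \<open>
  Adding \<open>dphi_F\<close> and \<open>N\<close> leaves, besides \<open>T\<close> and terms in \<open>P\<close>, a sum in which \<open>T (\<xi> i)\<close> is applied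
  to \<open>\<phi>\<close> in both remaining arguments.  By \<open>N_torsion\<close> with first argument \<open>\<xi> i\<close> this is the
  difference of \<open>d\<eta> i\<close> and the contraction of \<open>N\<close>, up to \<open>Q\<close>, and so it cancels with the wedge
  products.
\<close>

lemma torsion_formula_defect:
  assumes X: "X \<in> \<XX>" and Y: "Y \<in> \<XX>" and Z: "Z \<in> \<XX>"
  shows "T\<^sub>0 X Y Z p = T X Y Z p + Q X Y Z p - P (\<Phi> X) Y Z p - P (\<Phi> Y) Z X p - P (\<Phi> Z) X Y p
    - (\<Sum>i\<in>{1..s}. \<langle>X, \<xi> i\<rangle> p * Q (\<xi> i) Y Z p - \<langle>Y, \<xi> i\<rangle> p * Q (\<xi> i) X Z p
        + \<langle>Z, \<xi> i\<rangle> p * Q (\<xi> i) X Y p)"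
proof -
  have N_xi: "d\<eta> i V W p - N (\<xi> i) V W p = T (\<xi> i) (\<Phi> V) (\<Phi> W) p - Q (\<xi> i) V W p"
    if "i \<in> {1..s}" "V \<in> \<XX>" "W \<in> \<XX>" for i V W
    using that tensorialD(3)[OF T_tensorial(1)]
    by (simp add: N_torsion d_eta_torsion)
  have "(\<Sum>i\<in>{1..s}. \<langle>X, \<xi> i\<rangle> p * (d\<eta> i Y Z p - N (\<xi> i) Y Z p)
        - \<langle>Y, \<xi> i\<rangle> p * (d\<eta> i X Z p - N (\<xi> i) X Z p)
        + \<langle>Z, \<xi> i\<rangle> p * (d\<eta> i X Y p - N (\<xi> i) X Y p))
      = (\<Sum>i\<in>{1..s}. (\<langle>X, \<xi> i\<rangle> p * T (\<xi> i) (\<Phi> Y) (\<Phi> Z) p - \<langle>Y, \<xi> i\<rangle> p * T (\<xi> i) (\<Phi> X) (\<Phi> Z) p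
        + \<langle>Z, \<xi> i\<rangle> p * T (\<xi> i) (\<Phi> X) (\<Phi> Y) p)
        - (\<langle>X, \<xi> i\<rangle> p * Q (\<xi> i) Y Z p - \<langle>Y, \<xi> i\<rangle> p * Q (\<xi> i) X Z p
        + \<langle>Z, \<xi> i\<rangle> p * Q (\<xi> i) X Y p))"
    by (rule sum.cong) (use X Y Z in \<open>auto simp: N_xi algebra_simps\<close>)
  then show ?thesis
    unfolding torsion_formula_at[OF X Y Z] dphi_F_torsion[OF X Y Z] N_torsion[OF X Y Z]
    by (simp add: sum_subtractf)
qed

text \<open>
  As \<open>g\<close> and \<open>\<xi> i\<close> are parallel, the Lie derivative of \<open>g\<close> along \<open>\<xi> i\<close> is the symmetrization of
  \<open>T (\<xi> i)\<close>.
\<close>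

lemma xi_killing:
  assumes "i \<in> {1..s}"
  shows "killing A g (\<xi> i)"
  unfolding killing_def
proof (intro conjI ballI)
  show "\<xi> i \<in> \<XX>" by (rule xi_field[OF assms])
  fix X Y assume X: "X \<in> \<XX>" and Y: "Y \<in> \<XX>"
  have swap: "\<langle>X, lie_bracket (\<xi> i) Y\<rangle> = \<langle>lie_bracket (\<xi> i) Y, X\<rangle>" "\<langle>X, D (\<xi> i) Y\<rangle> = \<langle>D (\<xi> i) Y, X\<rangle>"
    using assms X Y by (simp_all add: metric_app_swap)
  show "deriv_along (\<xi> i) \<langle>X, Y\<rangle> - \<langle>lie_bracket (\<xi> i) X, Y\<rangle> - \<langle>X, lie_bracket (\<xi> i) Y\<rangle> = 0"
  proof
    fix p
    show "(deriv_along (\<xi> i) \<langle>X, Y\<rangle> - \<langle>lie_bracket (\<xi> i) X, Y\<rangle> - \<langle>X, lie_bracket (\<xi> i) Y\<rangle>) p = 0 p"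
      using assms X Y xi_parallel[OF assms] T_swap(2)[of "\<xi> i" X Y p]
      by (simp add: swap D_metric bracket_via_connection[OF affine])
  qed
qed

text \<open>
  Let \<open>c X Y Z = P (\<phi> X) Y Z + P X Y (\<phi> Z)\<close>, so that \<open>Q\<close> is the alternation of \<open>c\<close> in its first two
  arguments.  As \<open>c\<close> is skew in the last two arguments, skewness of \<open>Q\<close> makes \<open>c\<close> totally skew.
  Moving \<open>\<phi>\<close> between the last two arguments does not change \<open>c\<close>, hence by skewness moving it to
  the first one does not either; comparing the results shows that \<open>P\<close> vanishes if its first
  argument is characteristic.  Then the torsion formula says that the cyclic sum of
  \<open>P (\<phi> X) Y Z\<close> is \<open>2 * c X Y Z\<close>.  With \<open>\<phi> Z\<close> in place of \<open>Z\<close> the terms in \<open>c\<close> cancel, and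
  \<open>P X Y Z + P Y Z X = P Z X Y\<close> remains.  The three cyclic versions of this equation have only the
  solution 0.
\<close>

lemma phi_parallel:
  assumes N: "three_form A N"
    and T0: "\<And>X Y Z. X \<in> \<XX> \<Longrightarrow> Y \<in> \<XX> \<Longrightarrow> Z \<in> \<XX> \<Longrightarrow> T X Y Z = T\<^sub>0 X Y Z"
    and X: "X \<in> \<XX>" and Y: "Y \<in> \<XX>"
  shows "cov_deriv_endo D \<phi> X Y = 0"
proof (rule metric_nondegenerate)
  show "cov_deriv_endo D \<phi> X Y \<in> \<XX>" "0 \<in> \<XX>" using X Y by auto
  fix Z assume Z: "Z \<in> \<XX>"
  show "\<langle>cov_deriv_endo D \<phi> X Y, Z\<rangle> = \<langle>0, Z\<rangle>"
  proof
    fix p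
    define c where "c X Y Z = P (\<Phi> X) Y Z p + P X Y (\<Phi> Z) p" for X Y Z
    have Q_c: "Q X Y Z p = c X Y Z - c Y X Z" for X Y Z
      by (simp add: Q_def c_def)
    have Q_skew: "Q X Z Y p = - Q X Y Z p" if "X \<in> \<XX>" "Y \<in> \<XX>" "Z \<in> \<XX>" for X Y Z
    proof -
      have "T X (\<Phi> Z) (\<Phi> Y) p = - T X (\<Phi> Y) (\<Phi> Z) p" "T (\<Phi> X) Z (\<Phi> Y) p = - T (\<Phi> X) (\<Phi> Y) Z p"
        "T (\<Phi> X) (\<Phi> Z) Y p = - T (\<Phi> X) Y (\<Phi> Z) p" "T X Z Y p = - T X Y Z p"
        using that by (auto intro: T_swap(2))
      then show ?thesis
        using three_formD(3)[OF N that] N_torsion[OF that, of p] N_torsion[OF that(1,3,2), of p] by simp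
    qed
    have c23: "c X Z Y = - c X Y Z" if "X \<in> \<XX>" "Y \<in> \<XX>" "Z \<in> \<XX>" for X Y Z
      using that P_skew[of "\<Phi> X" Y Z p] P_skew[of X "\<Phi> Y" Z p] P_phi[of X Y Z]
      by (simp add: c_def)
    have c13: "c Z X Y = - c Y X Z" if "X \<in> \<XX>" "Y \<in> \<XX>" "Z \<in> \<XX>" for X Y Z
      using Q_skew[OF that] c23[OF that] by (simp add: Q_c)
    have cyc: "c Y Z X = c X Y Z" if "X \<in> \<XX>" "Y \<in> \<XX>" "Z \<in> \<XX>" for X Y Z
      using c13[of Z X Y] c23[of X Y Z] c13[of Y X Z] c23[of Y X Z] that by simp
    have c12: "c Y X Z = - c X Y Z" if "X \<in> \<XX>" "Y \<in> \<XX>" "Z \<in> \<XX>" for X Y Z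
      using cyc[of X Y Z] c23[of Y X Z] that by simp
    have c_phi: "c X (\<Phi> Y) Z = c X Y (\<Phi> Z)" if "X \<in> \<XX>" "Y \<in> \<XX>" "Z \<in> \<XX>" for X Y Z
      using that by (simp add: c_def P_phi)
    have c_phi1: "c (\<Phi> X) Y Z = c X Y (\<Phi> Z)" if "X \<in> \<XX>" "Y \<in> \<XX>" "Z \<in> \<XX>" for X Y Z
      using that cyc[of "\<Phi> X" Y Z] c_phi[of Y Z X] cyc[of X Y "\<Phi> Z"] by simp
    have c_last: "c X Y (\<Phi> Z) = P (\<Phi> X) Y (\<Phi> Z) p - P X Y Z p"
      if "X \<in> \<XX>" "Y \<in> \<XX>" "Z \<in> \<XX>" for X Y Z
      using that by (simp add: c_def P_phi_phi)
    have P_square: "P (\<Phi> (\<Phi> X)) Y Z p = - P X Y Z p" if "X \<in> \<XX>" "Y \<in> \<XX>" "Z \<in> \<XX>" for X Y Z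
      using c_phi1[OF that] c_last[OF that] by (simp add: c_def)
    have P_xi1: "P (\<xi> i) Y Z p = 0" if "i \<in> {1..s}" "Y \<in> \<XX>" "Z \<in> \<XX>" for i Y Z
      using P_square[of "\<xi> i" Y Z] that tensorialD(3)[OF P_tensorial(1)[OF that(2,3)]] by simp
    have Q_xi: "Q (\<xi> i) Y Z p = 0" if "i \<in> {1..s}" "Y \<in> \<XX>" "Z \<in> \<XX>" for i Y Z
      using that tensorialD(3)[OF P_tensorial(1)[OF that(2,3)]]
      by (simp add: Q_def P_xi1 P_xi)
    have cyclic: "P (\<Phi> X) Y Z p + P (\<Phi> Y) Z X p + P (\<Phi> Z) X Y p = 2 * c X Y Z"
      if "X \<in> \<XX>" "Y \<in> \<XX>" "Z \<in> \<XX>" for X Y Z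
    proof -
      have "(\<Sum>i\<in>{1..s}. \<langle>X, \<xi> i\<rangle> p * Q (\<xi> i) Y Z p - \<langle>Y, \<xi> i\<rangle> p * Q (\<xi> i) X Z p
          + \<langle>Z, \<xi> i\<rangle> p * Q (\<xi> i) X Y p) = 0"
        by (rule sum.neutral) (use that Q_xi in auto)
      then show ?thesis
        using torsion_formula_defect[OF that, of p] T0[OF that] c12[OF that] by (simp add: Q_c)
    qed
    have relation: "P X Y Z p + P Y Z X p = P Z X Y p" if "X \<in> \<XX>" "Y \<in> \<XX>" "Z \<in> \<XX>" for X Y Z
    proof -
      have "c Y Z (\<Phi> X) = c X Y (\<Phi> Z)" using that cyc[of "\<Phi> X" Y Z] c_phi1 by simp
      then show ?thesis
        using that cyclic[of X Y "\<Phi> Z"] c_last[of X Y Z] c_last[of Y Z X] P_square[of Z X Y]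
          P_phi[of "\<Phi> Y" Z X] by simp
    qed
    have "P X Y Z p = 0"
      using relation[OF X Y Z] relation[OF Y Z X] relation[OF Z X Y] by simp
    then show "\<langle>cov_deriv_endo D \<phi> X Y, Z\<rangle> p = \<langle>0, Z\<rangle> p"
      using Z by (simp add: P_def)
  qed
qed

end


section \<open>Existence and uniqueness of the adapted connection\<close>

context metric_f_manifold
begin

abbreviation adapted where
  "adapted D \<equiv> almost_metric_phi_connection A s \<phi> \<xi> \<eta> g D \<and> skew_torsion A g D"

lemma adapted_connection_of:
  assumes "adapted D"
  shows "adapted_connection A n s \<phi> \<xi> \<eta> g D"
proof unfold_locales
  show "metric_connection A g D" "three_form A (torsion3 g D)"
    using assms by (simp_all add: almost_metric_phi_connection_def skew_torsion_def)
  show "D X (\<xi> i) = 0" if "i \<in> {1..s}" "X \<in> \<XX>" for i X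
    using assms that by (simp add: almost_metric_phi_connection_def)
qed

text \<open>
  As \<open>\<phi>\<close> is parallel, \<open>P\<close> and \<open>Q\<close> vanish in the formulas of the previous section.
\<close>

lemma adapted_torsion:
  assumes "adapted D"
  shows "X \<in> \<XX> \<Longrightarrow> Y \<in> \<XX> \<Longrightarrow> Z \<in> \<XX> \<Longrightarrow> torsion3 g D X Y Z = T\<^sub>0 X Y Z"
    and "three_form A N"
proof -
  interpret C: adapted_connection A n s \<phi> \<xi> \<eta> g D
    by (rule adapted_connection_of[OF assms])
  have P: "C.P X Y Z = 0" if "X \<in> \<XX>" "Y \<in> \<XX>" "Z \<in> \<XX>" for X Y Z
    using assms that by (simp add: C.P_def almost_metric_phi_connection_def)
  have Q: "C.Q X Y Z = 0" if "X \<in> \<XX>" "Y \<in> \<XX>" "Z \<in> \<XX>" for X Y Z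
    using that by (simp add: C.Q_def P)
  show "torsion3 g D X Y Z = T\<^sub>0 X Y Z" if "X \<in> \<XX>" "Y \<in> \<XX>" "Z \<in> \<XX>" for X Y Z
  proof
    fix p
    show "torsion3 g D X Y Z p = T\<^sub>0 X Y Z p"
      using that by (simp add: C.torsion_formula_defect P Q)
  qed
  define R where "R X Y Z = C.T X Y Z - C.T (\<Phi> X) (\<Phi> Y) Z - C.T X (\<Phi> Y) (\<Phi> Z) - C.T (\<Phi> X) Y (\<Phi> Z)"
    for X Y Z
  have "three_form A R"
  proof (rule three_formI)
    fix Y Z assume Y: "Y \<in> \<XX>" and Z: "Z \<in> \<XX>"
    have 1: "tensorial (\<lambda>X. C.T X Y Z)" "tensorial (\<lambda>X. C.T X (\<Phi> Y) Z)"
      "tensorial (\<lambda>X. C.T X (\<Phi> Y) (\<Phi> Z))" "tensorial (\<lambda>X. C.T X Y (\<Phi> Z))"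
      by (rule C.T_tensorial(1); use Y Z in simp)+
    show "tensorial (\<lambda>X. R X Y Z)"
      unfolding tensorial_def R_def
      by (simp add: tensorialD[OF 1(1)] tensorialD[OF 1(2)] tensorialD[OF 1(3)] tensorialD[OF 1(4)]
          algebra_simps)
  next
    fix X Y Z assume V: "X \<in> \<XX>" "Y \<in> \<XX>" "Z \<in> \<XX>"
    show "R X Y Z \<in> \<FF>"
      using V unfolding R_def by (intro smooth_ring three_formD(1)[OF C.skew_D]) auto
    have swap: "C.T Y' X' Z' = - C.T X' Y' Z'" "C.T X' Z' Y' = - C.T X' Y' Z'"
      if "X' \<in> \<XX>" "Y' \<in> \<XX>" "Z' \<in> \<XX>" for X' Y' Z'
      using three_formD(2,3)[OF C.skew_D that] .
    show "R Y X Z = - R X Y Z"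
      unfolding R_def
      using V swap(1)[of X Y Z] swap(1)[of "\<Phi> X" "\<Phi> Y" Z] swap(1)[of "\<Phi> X" Y "\<Phi> Z"]
        swap(1)[of X "\<Phi> Y" "\<Phi> Z"] by simp
    show "R X Z Y = - R X Y Z"
      unfolding R_def
      using V swap(2)[of X Y Z] swap(2)[of "\<Phi> X" "\<Phi> Y" Z] swap(2)[of "\<Phi> X" Y "\<Phi> Z"]
        swap(2)[of X "\<Phi> Y" "\<Phi> Z"] by simp
  qed
  then show "three_form A N"
  proof (rule three_form_cong)
    fix X Y Z assume V: "X \<in> \<XX>" "Y \<in> \<XX>" "Z \<in> \<XX>"
    show "N X Y Z = R X Y Z"
    proof
      fix p show "N X Y Z p = R X Y Z p"
        using V by (simp add: C.N_torsion R_def Q)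
    qed
  qed
qed

text \<open>
  Take the metric connection whose torsion is given by the formula.  What has to be shown first
  is that the characteristic fields are parallel; the equation for \<open>\<phi>\<close> is then \<open>phi_parallel\<close>.
\<close>

lemma adapted_connection_exists:
  assumes N: "three_form A N" and killing: "\<And>i. i \<in> {1..s} \<Longrightarrow> killing A g (\<xi> i)"
    and commute: "\<And>i j. i \<in> {1..s} \<Longrightarrow> j \<in> {1..s} \<Longrightarrow> lie_bracket (\<xi> i) (\<xi> j) = 0"
  shows "\<exists>D. adapted D"
proof -
  have T0: "three_form A T\<^sub>0" by (rule torsion_formula_three_form[OF N])
  obtain D where D: "metric_connection A g D"
    and T: "\<forall>X\<in>\<XX>. \<forall>Y\<in>\<XX>. \<forall>Z\<in>\<XX>. torsion3 g D X Y Z = T\<^sub>0 X Y Z"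
    using metric_connection_with_torsion[OF T0] by blast
  have skew: "three_form A (torsion3 g D)"
    by (rule three_form_cong[OF T0]) (use T in simp)
  have aff: "affine_connection A D" using D by (simp add: metric_connection_def)

  have N_xi: "N (\<xi> i) (\<xi> j) Z p = 0" if i: "i \<in> {1..s}" and j: "j \<in> {1..s}" and Z: "Z \<in> \<XX>" for i j Z p
  proof -
    have "d\<eta> k (\<xi> i) (\<xi> j) p = 0" if k: "k \<in> {1..s}" for k
    proof -
      have const: "\<langle>\<xi> l, \<xi> k\<rangle> = (\<lambda>_. if l = k then 1 else 0)" if "l \<in> {1..s}" for l
        by (rule ext) (use that k in \<open>simp add: xi_orthonormal\<close>)
      have "deriv_along V (\<lambda>_. if l = k then 1 else 0) = 0" if "V \<in> \<XX>" for V l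
        using that by simp
      then show ?thesis
        using i j k by (simp add: d_eta_expand const commute)
    qed
    moreover have "nijenhuis_phi \<phi> (\<xi> i) (\<xi> j) = 0"
      using i j by (simp add: nijenhuis_phi_def commute)
    ultimately show ?thesis using i j Z by (simp add: N_expand)
  qed
  have d_eta_xi: "d\<eta> i (\<xi> j) Z p = 0" if i: "i \<in> {1..s}" and j: "j \<in> {1..s}" and Z: "Z \<in> \<XX>" for i j Z p
  proof -
    have nij: "\<langle>nijenhuis_phi \<phi> (\<xi> j) Z, \<xi> i\<rangle> = 0"
      using i j Z by (simp add: nijenhuis_phi_def)
    have "N (\<xi> j) Z (\<xi> i) p = (\<Sum>k\<in>{1..s}. d\<eta> k (\<xi> j) Z p * \<langle>\<xi> i, \<xi> k\<rangle> p)"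
      using i j Z nij by (simp add: N_expand)
    also have "\<dots> = (\<Sum>k\<in>{1..s}. if k = i then d\<eta> i (\<xi> j) Z p else 0)"
      by (rule sum.cong) (use i in \<open>auto simp: xi_orthonormal\<close>)
    also have "\<dots> = d\<eta> i (\<xi> j) Z p" using i by simp
    finally have "d\<eta> i (\<xi> j) Z p = N (\<xi> j) Z (\<xi> i) p" ..
    \<comment> \<open>This is where the skewness of \<open>N\<close> meets the commutation of the characteristic fields.\<close>
    also have "\<dots> = 0"
      using three_formD(3)[OF N, of "\<xi> j" "\<xi> i" Z] N_xi[OF j i Z, of p] i j Z by simp
    finally show ?thesis .
  qed
  have T0_xi: "T\<^sub>0 (\<xi> j) X Z p = d\<eta> j X Z p" if j: "j \<in> {1..s}" and X: "X \<in> \<XX>" and Z: "Z \<in> \<XX>" for j X Z p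
  proof -
    have "dphi_F g \<phi> (\<xi> j) X Z = 0"
      using tensorialD(3)[OF three_form_tensorial(1)[OF dF_three_form, of "\<Phi> X" "\<Phi> Z"]] j X Z
      by (simp add: dphi_F_def)
    moreover have "(\<Sum>i\<in>{1..s}. \<langle>\<xi> j, \<xi> i\<rangle> p * (d\<eta> i X Z p - N (\<xi> i) X Z p)
        - \<langle>X, \<xi> i\<rangle> p * (d\<eta> i (\<xi> j) Z p - N (\<xi> i) (\<xi> j) Z p)
        + \<langle>Z, \<xi> i\<rangle> p * (d\<eta> i (\<xi> j) X p - N (\<xi> i) (\<xi> j) X p))
      = (\<Sum>i\<in>{1..s}. if i = j then d\<eta> j X Z p - N (\<xi> j) X Z p else 0)"
      by (rule sum.cong) (use j X Z in \<open>auto simp: xi_orthonormal d_eta_xi N_xi\<close>)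
    ultimately show ?thesis
      using torsion_formula_at[of "\<xi> j" X Z p] j X Z by simp
  qed
  have xi_parallel: "D X (\<xi> j) = 0" if j: "j \<in> {1..s}" and X: "X \<in> \<XX>" for j X
  proof (rule metric_nondegenerate)
    show "D X (\<xi> j) \<in> \<XX>" "0 \<in> \<XX>" using affine_connectionD(1)[OF aff X] j by auto
    fix Z assume Z: "Z \<in> \<XX>"
    show "\<langle>D X (\<xi> j), Z\<rangle> = \<langle>0, Z\<rangle>"
    proof
      fix p
      note xi = xi_field[OF j]
      have "deriv_along (\<xi> j) \<langle>X, Z\<rangle> - \<langle>lie_bracket (\<xi> j) X, Z\<rangle> - \<langle>X, lie_bracket (\<xi> j) Z\<rangle> = 0"
        using killing[OF j] X Z unfolding killing_def by blast
      then have "deriv_along (\<xi> j) \<langle>X, Z\<rangle> p = \<langle>lie_bracket (\<xi> j) X, Z\<rangle> p + \<langle>lie_bracket (\<xi> j) Z, X\<rangle> p"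
        using X Z xi metric_app_swap[of X "lie_bracket (\<xi> j) Z"] by (simp add: fun_eq_iff algebra_simps)
      \<comment> \<open>The Killing equation removes the symmetric part.\<close>
      then have "koszul g X (\<xi> j) Z p = d\<eta> j X Z p"
        using X Z xi j metric_app_swap[OF xi Z] lie_bracket_swap[of X "\<xi> j"]
        by (simp add: koszul_def d_eta_expand)
      moreover have "torsion3 g D X (\<xi> j) Z p = - d\<eta> j X Z p"
        using three_formD(2)[OF T0 xi X Z] T0_xi[OF j X Z, of p] T xi X Z by simp
      ultimately show "\<langle>D X (\<xi> j), Z\<rangle> p = \<langle>0, Z\<rangle> p"
        using koszul_formula[OF D skew X xi Z, of p] Z by simp
    qed
  qed
  interpret C: adapted_connection A n s \<phi> \<xi> \<eta> g D
  proof unfold_locales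
    show "metric_connection A g D" "three_form A (torsion3 g D)" by (rule D skew)+
    show "D X (\<xi> i) = 0" if "i \<in> {1..s}" "X \<in> \<XX>" for i X by (rule xi_parallel[OF that])
  qed
  have phi: "cov_deriv_endo D \<phi> X Y = 0" if "X \<in> \<XX>" "Y \<in> \<XX>" for X Y
    by (rule C.phi_parallel[OF N _ that]) (use T in blast)
  have eta: "cov_deriv_form D (\<eta> i) X Y = 0" if "i \<in> {1..s}" "X \<in> \<XX>" "Y \<in> \<XX>" for i X Y
    using that xi_parallel C.D_metric[of X Y "\<xi> i"] affine_connectionD(1)[OF aff]
    by (simp add: cov_deriv_form_def eta_metric)
  have "adapted D"
    unfolding almost_metric_phi_connection_def skew_torsion_def
    by (intro conjI ballI D skew) (rule phi xi_parallel eta; assumption)+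
  then show ?thesis by (rule exI[of _ D])
qed

end

theorem corollary3p10:
  fixes A :: "('a::{t2_space, second_countable_topology}, 'e::euclidean_space) chart set"
    and n s :: nat
    and \<phi> :: "'a endo"
    and \<xi> :: "nat \<Rightarrow> 'a vfield"
    and \<eta> :: "nat \<Rightarrow> 'a covector"
    and g :: "'a metric"
  assumes "metric_f_manifold A n s \<phi> \<xi> \<eta> g"
    and "\<forall>i\<in>{1..s}. \<forall>j\<in>{1..s}. lie_bracket (\<xi> i) (\<xi> j) = 0"
  shows
    "((three_form A (N1 s \<phi> \<xi> \<eta> g) \<and> (\<forall>i\<in>{1..s}. killing A g (\<xi> i)))
      \<longleftrightarrow> (\<exists>D. almost_metric_phi_connection A s \<phi> \<xi> \<eta> g D \<and> skew_torsion A g D))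
     \<and>
     (\<forall>D D'. almost_metric_phi_connection A s \<phi> \<xi> \<eta> g D \<and> skew_torsion A g D \<and>
        almost_metric_phi_connection A s \<phi> \<xi> \<eta> g D' \<and> skew_torsion A g D' \<longrightarrow>
        (\<forall>X\<in>vector_fields A. \<forall>Y\<in>vector_fields A. D X Y = D' X Y))
     \<and>
     (\<forall>D. almost_metric_phi_connection A s \<phi> \<xi> \<eta> g D \<and> skew_torsion A g D \<longrightarrow>
        (\<forall>X\<in>vector_fields A. \<forall>Y\<in>vector_fields A. \<forall>Z\<in>vector_fields A.
           torsion3 g D X Y Z = torsion_formula s \<phi> \<xi> \<eta> g X Y Z \<and>
           metric_app g (D X Y) Z =
             metric_app g (levi_civita A g X Y) Z
             + (\<lambda>p. 1/2 * torsion_formula s \<phi> \<xi> \<eta> g X Y Z p)))"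
proof -
  interpret metric_f_manifold A n s \<phi> \<xi> \<eta> g by (rule assms(1))
  have connection: "metric_connection A g D" "three_form A (torsion3 g D)" if "adapted D" for D
    using that by (simp_all add: almost_metric_phi_connection_def skew_torsion_def)
  have equivalence: "(three_form A N \<and> (\<forall>i\<in>{1..s}. killing A g (\<xi> i))) \<longleftrightarrow> (\<exists>D. adapted D)"
  proof
    assume "three_form A N \<and> (\<forall>i\<in>{1..s}. killing A g (\<xi> i))"
    then show "\<exists>D. adapted D"
      using assms(2) by (intro adapted_connection_exists) blast+
  next
    assume "\<exists>D. adapted D"
    then obtain D where D: "adapted D" by (elim exE)
    show "three_form A N \<and> (\<forall>i\<in>{1..s}. killing A g (\<xi> i))"
      using adapted_torsion(2)[OF D] adapted_connection.xi_killing[OF adapted_connection_of[OF D]]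
      by blast
  qed
  have unique: "D X Y = D' X Y"
    if D: "adapted D" and D': "adapted D'" and V: "X \<in> \<XX>" "Y \<in> \<XX>" for D D' X Y
    by (rule metric_connection_unique[OF connection[OF D] connection(1)[OF D'] _ V])
      (simp only: adapted_torsion(1)[OF D] adapted_torsion(1)[OF D'])
  have formula: "metric_app g (D X Y) Z = metric_app g (levi_civita A g X Y) Z + (\<lambda>p. 1/2 * T\<^sub>0 X Y Z p)"
    if D: "adapted D" and V: "X \<in> \<XX>" "Y \<in> \<XX>" "Z \<in> \<XX>" for D X Y Z
    by (rule ext)
      (simp add: skew_connection_via_levi_civita[OF connection[OF D] V] adapted_torsion(1)[OF D V])
  show ?thesis
  proof (intro conjI)
    show "(three_form A N \<and> (\<forall>i\<in>{1..s}. killing A g (\<xi> i))) \<longleftrightarrow> (\<exists>D. adapted D)"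
      by (rule equivalence)
    show "\<forall>D D'. almost_metric_phi_connection A s \<phi> \<xi> \<eta> g D \<and> skew_torsion A g D \<and>
        almost_metric_phi_connection A s \<phi> \<xi> \<eta> g D' \<and> skew_torsion A g D' \<longrightarrow>
        (\<forall>X\<in>\<XX>. \<forall>Y\<in>\<XX>. D X Y = D' X Y)"
    proof (rule allI, rule allI, rule impI)
      fix D D'
      assume DD': "almost_metric_phi_connection A s \<phi> \<xi> \<eta> g D \<and> skew_torsion A g D \<and>
          almost_metric_phi_connection A s \<phi> \<xi> \<eta> g D' \<and> skew_torsion A g D'"
      from DD' have D: "adapted D" and D': "adapted D'" by simp_all
      show "\<forall>X\<in>\<XX>. \<forall>Y\<in>\<XX>. D X Y = D' X Y" by (intro ballI unique[OF D D'])
    qed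
    show "\<forall>D. adapted D \<longrightarrow> (\<forall>X\<in>\<XX>. \<forall>Y\<in>\<XX>. \<forall>Z\<in>\<XX>. torsion3 g D X Y Z = T\<^sub>0 X Y Z \<and>
        metric_app g (D X Y) Z = metric_app g (levi_civita A g X Y) Z + (\<lambda>p. 1/2 * T\<^sub>0 X Y Z p))"
    proof (rule allI, rule impI)
      fix D assume D: "adapted D"
      show "\<forall>X\<in>\<XX>. \<forall>Y\<in>\<XX>. \<forall>Z\<in>\<XX>. torsion3 g D X Y Z = T\<^sub>0 X Y Z \<and>
          metric_app g (D X Y) Z = metric_app g (levi_civita A g X Y) Z + (\<lambda>p. 1/2 * T\<^sub>0 X Y Z p)"
        using adapted_torsion(1)[OF D] formula[OF D] by simp
    qed
  qed
qed

end
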